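(* Let $\Omega\subset\mathbb R^2$ be a bounded convex open set with piecewise $C^\infty$ boundary and $0\in\Omega$, having the symmetries of the square (invariant under $\sigma_1(x,y)=(-x,y)$, $\sigma_2(x,y)=(x,-y)$ and the rotation of angle $\frac\pi2$ about the origin), and put $\dot\Omega=\Omega\setminus\{0\}$. The Dirichlet-Neumann problems for the Laplacian on the four half-domains $$\Omega^{--dh}=\Omega\cap\{x+y<0\},\quad \Omega^{++dh}=\Omega\cap\{x+y>0\},\quad \Omega^{+-dh}=\Omega\cap\{x-y>0\},\quad \Omega^{-+dh}=\Omega\cap\{x-y<0\}$$ are also isospectral (have the same eigenvalues) to the Aharonov-Bohm operator $-\Delta_{\mathbf A}$ on $\dot\Omega$ and to its four restrictions $-\Delta_{\mathbf A,\Sigma_1}$, $-\Delta_{\mathbf A,a\,\Sigma_1}$, $-\Delta_{\mathbf A,\Sigma_2}$, $-\Delta_{\mathbf A,a\,\Sigma_2}$ to the spaces $L^2_{K,\Sigma_1}$, $L^2_{K,a\,\Sigma_1}$, $L^2_{K,\Sigma_2}$, $L^2_{K,a\,\Sigma_2}$.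
   Context: Aharonov-Bohm operator: for $\mathbf A(x,y)=(A_1,A_2)=\frac12\left(-\frac{y}{r^2},\frac{x}{r^2}\right)$, $r^2=x^2+y^2$, $-\Delta_{\mathbf A}$ is the Friedrichs extension in $L^2(\dot\Omega)=L^2(\dot\Omega;\mathbb C)$ of $(D_x-A_1)^2+(D_y-A_2)^2$ on $C_0^\infty(\dot\Omega)$, with $D_x=-i\partial_x$, $D_y=-i\partial_y$. Write $x+iy=re^{i\theta}$. $\Gamma u=\bar u$, $K=e^{i\theta}\Gamma$, and $L^2_K=\{u\in L^2(\dot\Omega):Ku=u\}$ (a real Hilbert space). $\Sigma_1u(x,y)=u(-x,y)$, $\Sigma_2u(x,y)=u(x,-y)$, $\Sigma_1^c=i\,\Gamma\,\Sigma_1$, $\Sigma_2^c=\Gamma\,\Sigma_2$. For $j=1,2$: $L^2_{K,\Sigma_j}=\{u\in L^2_K:\Sigma_j^cu=u\}$ and $L^2_{K,a\,\Sigma_j}=\{u\in L^2_K:\Sigma_j^cu=-u\}$; $K$ and $\Sigma_j^c$ commute with $-\Delta_{\mathbf A}$, so the restrictions make sense. Dirichlet-Neumann problem on one of the four half-domains: the flat part of the boundary, lying on a diagonal line through $0$, is divided by $0$ into two halves; the Neumann condition is imposed on one of these two halves (which one is immaterial, by reflection symmetry) and the Dirichlet condition on the rest of the boundary. The corresponding operator is the self-adjoint operator associated with the form $\int|\nabla w|^2$ on $H^1$ functions of the half-domain vanishing on the boundary outside the Neumann part. "Isospectral" means having the same set of eigenvalues. *)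

theory Defs
  imports "HOL-Analysis.Analysis"
begin

text \<open>
  The plane is identified with the type \<^typ>\<open>complex\<close>; differentiability of functions on it is
  real (Frechet) differentiability, and the partial derivatives in \<open>x\<close> and \<open>y\<close> are the directional
  derivatives along \<open>1\<close> and \<open>\<i>\<close>, the elements of \<^term>\<open>Basis :: complex set\<close>.
\<close>

section \<open>Smooth functions and piecewise smooth boundaries\<close>

definition pd :: "'a::real_normed_vector \<Rightarrow> ('a \<Rightarrow> 'b::real_normed_vector) \<Rightarrow> 'a \<Rightarrow> 'b"
  where "pd e f = (\<lambda>x. frechet_derivative f (at x) e)"

primrec Ck :: "nat \<Rightarrow> ('a::euclidean_space \<Rightarrow> 'b::real_normed_vector) \<Rightarrow> bool"
  where
    "Ck 0 f \<longleftrightarrow> continuous_on UNIV f"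
  | "Ck (Suc k) f \<longleftrightarrow> (\<forall>x. f differentiable (at x)) \<and> (\<forall>e\<in>Basis. Ck k (pd e f))"

definition smooth :: "('a::euclidean_space \<Rightarrow> 'b::real_normed_vector) \<Rightarrow> bool"
  where "smooth f \<longleftrightarrow> (\<forall>k. Ck k f)"

text \<open>
  The functions of \<open>C\<^sub>0\<^sup>\<infinity>(S)\<close>, extended by \<open>0\<close> to the plane.
\<close>

definition test_functions :: "complex set \<Rightarrow> (complex \<Rightarrow> complex) set"
  where "test_functions S =
    {\<phi>. smooth \<phi> \<and> compact (closure {z. \<phi> z \<noteq> 0}) \<and> closure {z. \<phi> z \<noteq> 0} \<subseteq> S}"

text \<open>
  The boundary is a Jordan curve that splits into finitely many regular arcs, each of them smooth up
  to its end points (that is, with a smooth extension to the real line).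
\<close>

definition piecewise_smooth_boundary :: "complex set \<Rightarrow> bool"
  where "piecewise_smooth_boundary S \<longleftrightarrow>
    (\<exists>\<gamma>. simple_path \<gamma> \<and> pathfinish \<gamma> = pathstart \<gamma> \<and> path_image \<gamma> = frontier S \<and>
      (\<exists>(n::nat) (t::nat \<Rightarrow> real). t 0 = 0 \<and> t n = 1 \<and>
        (\<forall>k<n. t k < t (Suc k) \<and>
          (\<exists>g :: real \<Rightarrow> complex. smooth g \<and>
            (\<forall>s\<in>{t k..t (Suc k)}. \<gamma> s = g s \<and> vector_derivative g (at s) \<noteq> 0)))))"


section \<open>\<open>L\<^sup>2\<close> spaces, operators and eigenvalues\<close>

text \<open>
  Elements of \<open>L\<^sup>2\<close> are represented by functions; every notion below depends only on their classes
  modulo almost everywhere equality.  An operator is represented by its graph: \<open>T u f\<close> says that \<open>u\<close>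
  belongs to the domain and is mapped to \<open>f\<close>.
\<close>

type_synonym cfun = "complex \<Rightarrow> complex"
type_synonym oper = "cfun \<Rightarrow> cfun \<Rightarrow> bool"

definition leb :: "complex set \<Rightarrow> complex measure"
  where "leb S = restrict_space lborel S"

definition L2 :: "complex measure \<Rightarrow> cfun set"
  where "L2 M = {u \<in> borel_measurable M. integrable M (\<lambda>z. (cmod (u z))\<^sup>2)}"

definition L2_inner :: "complex measure \<Rightarrow> cfun \<Rightarrow> cfun \<Rightarrow> complex"
  where "L2_inner M u v = (LINT z|M. u z * cnj (v z))"

definition L2_norm :: "complex measure \<Rightarrow> cfun \<Rightarrow> real"
  where "L2_norm M u = sqrt (LINT z|M. (cmod (u z))\<^sup>2)"

text \<open>
  The operator associated with a form \<open>q\<close> of domain \<open>Q\<close>.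
\<close>

definition form_operator :: "complex measure \<Rightarrow> cfun set \<Rightarrow> (cfun \<Rightarrow> cfun \<Rightarrow> complex) \<Rightarrow> oper"
  where "form_operator M Q q u f \<longleftrightarrow>
    u \<in> Q \<and> f \<in> L2 M \<and> (\<forall>v\<in>Q. q u v = L2_inner M f v)"

definition eigenvalues :: "complex measure \<Rightarrow> oper \<Rightarrow> complex set"
  where "eigenvalues M T =
    {\<mu>. \<exists>u\<in>L2 M. \<not> (AE z in M. u z = 0) \<and> T u (\<lambda>z. \<mu> * u z)}"

text \<open>
  On a real subspace of \<open>L\<^sup>2\<close> only real scalars are available.
\<close>

definition real_eigenvalues :: "complex measure \<Rightarrow> oper \<Rightarrow> real set"
  where "real_eigenvalues M T =
    {\<mu>. \<exists>u\<in>L2 M. \<not> (AE z in M. u z = 0) \<and> T u (\<lambda>z. of_real \<mu> * u z)}"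

definition restrict_oper :: "oper \<Rightarrow> cfun set \<Rightarrow> oper"
  where "restrict_oper T V u f \<longleftrightarrow> T u f \<and> u \<in> V \<and> f \<in> V"


section \<open>Friedrichs extension\<close>

text \<open>
  \<open>form_converges M D t \<phi> u\<close>: the sequence \<open>\<phi>\<close> in \<open>D\<close> converges to \<open>u\<close> in \<open>L\<^sup>2\<close> and is Cauchy for
  the form \<open>t\<close>.  The closure of \<open>t\<close> has these limits \<open>u\<close> as its domain, and its values are the limits
  of the values of \<open>t\<close>; they do not depend on the sequences when \<open>t\<close> is closable, in particular when
  it comes from a nonnegative symmetric operator.
\<close>

definition form_converges ::
    "complex measure \<Rightarrow> cfun set \<Rightarrow> (cfun \<Rightarrow> cfun \<Rightarrow> complex) \<Rightarrow> (nat \<Rightarrow> cfun) \<Rightarrow> cfun \<Rightarrow> bool"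
  where "form_converges M D t \<phi> u \<longleftrightarrow>
    (\<forall>n. \<phi> n \<in> D) \<and> u \<in> L2 M \<and>
    (\<lambda>n. L2_norm M (\<lambda>z. \<phi> n z - u z)) \<longlonglongrightarrow> 0 \<and>
    (\<forall>\<epsilon>>0. \<exists>N. \<forall>m\<ge>N. \<forall>n\<ge>N.
      cmod (t (\<lambda>z. \<phi> m z - \<phi> n z) (\<lambda>z. \<phi> m z - \<phi> n z)) < \<epsilon>)"

definition form_closure_dom ::
    "complex measure \<Rightarrow> cfun set \<Rightarrow> (cfun \<Rightarrow> cfun \<Rightarrow> complex) \<Rightarrow> cfun set"
  where "form_closure_dom M D t = {u. \<exists>\<phi>. form_converges M D t \<phi> u}"

definition form_closure ::
    "complex measure \<Rightarrow> cfun set \<Rightarrow> (cfun \<Rightarrow> cfun \<Rightarrow> complex) \<Rightarrow> cfun \<Rightarrow> cfun \<Rightarrow> complex"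
  where "form_closure M D t u v =
    (THE c. \<forall>\<phi> \<psi>. form_converges M D t \<phi> u \<longrightarrow> form_converges M D t \<psi> v \<longrightarrow>
      (\<lambda>n. t (\<phi> n) (\<psi> n)) \<longlonglongrightarrow> c)"

definition friedrichs :: "complex measure \<Rightarrow> cfun set \<Rightarrow> (cfun \<Rightarrow> cfun) \<Rightarrow> oper"
  where "friedrichs M D T =
    (let t = (\<lambda>\<phi> \<psi>. L2_inner M (T \<phi>) \<psi>)
     in form_operator M (form_closure_dom M D t) (form_closure M D t))"


section \<open>The Aharonov-Bohm operator and its symmetries\<close>

definition A1 :: "complex \<Rightarrow> real"
  where "A1 z = 1/2 * (- (Im z / (cmod z)\<^sup>2))"

definition A2 :: "complex \<Rightarrow> real"
  where "A2 z = 1/2 * (Re z / (cmod z)\<^sup>2)"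

definition DA1 :: "cfun \<Rightarrow> cfun"
  where "DA1 \<phi> = (\<lambda>z. - \<i> * pd 1 \<phi> z - of_real (A1 z) * \<phi> z)"

definition DA2 :: "cfun \<Rightarrow> cfun"
  where "DA2 \<phi> = (\<lambda>z. - \<i> * pd \<i> \<phi> z - of_real (A2 z) * \<phi> z)"

definition AB_expr :: "cfun \<Rightarrow> cfun"
  where "AB_expr \<phi> = (\<lambda>z. DA1 (DA1 \<phi>) z + DA2 (DA2 \<phi>) z)"

definition punctured :: "complex set \<Rightarrow> complex set"
  where "punctured S = S - {0}"

definition AB_operator :: "complex set \<Rightarrow> oper"
  where "AB_operator S =
    friedrichs (leb (punctured S)) (test_functions (punctured S)) AB_expr"

definition Gam :: "cfun \<Rightarrow> cfun"
  where "Gam u = (\<lambda>z. cnj (u z))"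

definition Kop :: "cfun \<Rightarrow> cfun"
  where "Kop u = (\<lambda>z. cis (Arg z) * Gam u z)"

definition Sig1 :: "cfun \<Rightarrow> cfun"
  where "Sig1 u = (\<lambda>z. u (Complex (- Re z) (Im z)))"

definition Sig2 :: "cfun \<Rightarrow> cfun"
  where "Sig2 u = (\<lambda>z. u (Complex (Re z) (- Im z)))"

definition Sig1c :: "cfun \<Rightarrow> cfun"
  where "Sig1c u = (\<lambda>z. \<i> * Gam (Sig1 u) z)"

definition Sig2c :: "cfun \<Rightarrow> cfun"
  where "Sig2c u = Gam (Sig2 u)"

definition L2_K :: "complex set \<Rightarrow> cfun set"
  where "L2_K S = {u \<in> L2 (leb (punctured S)). AE z in leb (punctured S). Kop u z = u z}"

definition L2_K_sym :: "complex set \<Rightarrow> (cfun \<Rightarrow> cfun) \<Rightarrow> cfun set"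
  where "L2_K_sym S R = {u \<in> L2_K S. AE z in leb (punctured S). R u z = u z}"

definition L2_K_antisym :: "complex set \<Rightarrow> (cfun \<Rightarrow> cfun) \<Rightarrow> cfun set"
  where "L2_K_antisym S R = {u \<in> L2_K S. AE z in leb (punctured S). R u z = - u z}"

definition AB_eigenvalues :: "complex set \<Rightarrow> complex set"
  where "AB_eigenvalues S = eigenvalues (leb (punctured S)) (AB_operator S)"

definition AB_restricted_eigenvalues :: "complex set \<Rightarrow> cfun set \<Rightarrow> real set"
  where "AB_restricted_eigenvalues S V =
    real_eigenvalues (leb (punctured S)) (restrict_oper (AB_operator S) V)"


section \<open>Mixed Dirichlet-Neumann Laplacians\<close>

definition has_weak_pd :: "complex set \<Rightarrow> complex \<Rightarrow> cfun \<Rightarrow> cfun \<Rightarrow> bool"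
  where "has_weak_pd U e w g \<longleftrightarrow>
    (\<forall>\<phi>\<in>test_functions U. (LINT z|leb U. w z * pd e \<phi> z) = - (LINT z|leb U. g z * \<phi> z))"

definition H1 :: "complex set \<Rightarrow> cfun set"
  where "H1 U = {w \<in> L2 (leb U). \<forall>e\<in>Basis. \<exists>g\<in>L2 (leb U). has_weak_pd U e w g}"

definition weak_pd :: "complex set \<Rightarrow> complex \<Rightarrow> cfun \<Rightarrow> cfun"
  where "weak_pd U e w = (SOME g. g \<in> L2 (leb U) \<and> has_weak_pd U e w g)"

text \<open>
  The functions of \<open>H\<^sup>1(U)\<close> that vanish on a closed part \<open>C\<close> of the boundary: the closure in \<open>H\<^sup>1(U)\<close>
  of the restrictions to \<open>U\<close> of the functions of \<open>C\<^sub>0\<^sup>\<infinity>\<close> on the plane whose support does not meet \<open>C\<close>.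
\<close>

definition H1_vanishing :: "complex set \<Rightarrow> complex set \<Rightarrow> cfun set"
  where "H1_vanishing U C =
    {w \<in> H1 U. \<exists>\<phi>. (\<forall>n. \<phi> n \<in> test_functions (- C)) \<and>
      (\<lambda>n. L2_norm (leb U) (\<lambda>z. \<phi> n z - w z)) \<longlonglongrightarrow> 0 \<and>
      (\<forall>e\<in>Basis. (\<lambda>n. L2_norm (leb U) (\<lambda>z. pd e (\<phi> n) z - weak_pd U e w z)) \<longlonglongrightarrow> 0)}"

definition gradient_form :: "complex set \<Rightarrow> cfun \<Rightarrow> cfun \<Rightarrow> complex"
  where "gradient_form U w v = (\<Sum>e\<in>Basis. L2_inner (leb U) (weak_pd U e w) (weak_pd U e v))"

text \<open>
  \<open>N\<close> is the part of the boundary of \<open>U\<close> that carries the Neumann condition.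
\<close>

definition DN_eigenvalues :: "complex set \<Rightarrow> complex set \<Rightarrow> complex set"
  where "DN_eigenvalues U N =
    eigenvalues (leb U) (form_operator (leb U) (H1_vanishing U (frontier U - N)) (gradient_form U))"

definition dh_mm :: "complex set \<Rightarrow> complex set"
  where "dh_mm S = S \<inter> {z. Re z + Im z < 0}"

definition dh_pp :: "complex set \<Rightarrow> complex set"
  where "dh_pp S = S \<inter> {z. Re z + Im z > 0}"

definition dh_pm :: "complex set \<Rightarrow> complex set"
  where "dh_pm S = S \<inter> {z. Re z - Im z > 0}"

definition dh_mp :: "complex set \<Rightarrow> complex set"
  where "dh_mp S = S \<inter> {z. Re z - Im z < 0}"

text \<open>
  The two open halves into which \<open>0\<close> divides the flat part of the boundary, for the half-domains
  bounded by the line \<open>x + y = 0\<close> and for those bounded by the line \<open>x - y = 0\<close>.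
\<close>

definition antidiagonal_halves :: "complex set \<Rightarrow> complex set set"
  where "antidiagonal_halves S =
    {{z \<in> S. Re z + Im z = 0 \<and> Re z > 0}, {z \<in> S. Re z + Im z = 0 \<and> Re z < 0}}"

definition diagonal_halves :: "complex set \<Rightarrow> complex set set"
  where "diagonal_halves S =
    {{z \<in> S. Re z - Im z = 0 \<and> Re z > 0}, {z \<in> S. Re z - Im z = 0 \<and> Re z < 0}}"

end

theory Submission
  imports Defs
begin

text \<open>
  Off a ray issuing from \<open>0\<close> the function \<open>e\<^sup>i\<^sup>\<theta>\<^sup>/\<^sup>2\<close> is smooth, and multiplication by it turns the gradient
  into the magnetic gradient.  If the domain is symmetric in the line carrying the ray, the map
  \<open>u \<mapsto> e\<^sup>-\<^sup>i\<^sup>\<theta>\<^sup>/\<^sup>2 u(z) + e\<^sup>i\<^sup>\<theta>\<^sup>/\<^sup>2 u(z')\<close>, where \<open>z'\<close> is the mirror image of \<open>z\<close>, sends the form domain of the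
  Aharonov-Bohm operator to that of the mixed problem on one side of the line: the sum vanishes on the
  ray, which carries the Dirichlet condition, while the other half of the line stays free.  Its adjoint
  is the extension by twisted reflection, which maps the form domains the other way.  Hence both maps
  preserve the weak eigenvalue equation.  The extension is injective; the first map kills only the
  functions that are antisymmetric for the twisted reflection, and the reflection in the orthogonal
  line exchanges these with the symmetric ones.  In the same way \<open>\<Sigma>\<^sub>1\<^sup>c\<close> and \<open>\<Sigma>\<^sub>2\<^sup>c\<close> anticommute on
  \<open>L\<^sup>2\<^sub>K\<close>, so each exchanges the two eigenspaces of the other.
\<close>

section \<open>Square integrable functions\<close>

text \<open>What shapes the proof is approximation. Both form domains are closures of spaces of test
  functions, but neither map sends test functions to test functions. The extended function has a
  kink along the Neumann ray; there |y| is replaced by sqrt(y^2 + eps^2), which is smooth and has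
  slope between -1 and 1. The folded function vanishes on the Dirichlet ray but not near it; it is
  cut off at the level 1/n of r + x = 2 r cos^2(theta/2), and a Lipschitz function vanishing on the
  ray is small enough there for the derivative of the cutoff to leave bounded terms that tend to 0.
  Gradients travel as data together with the functions, because the definitions of form closure and
  weak derivative use description and choice; closability and uniqueness of weak derivatives show
  that nothing is lost. Antilinear symmetries conjugate eigenvalues, which is harmless since testing
  an eigenfunction with itself shows that they are real. The geometry is normalised so that the
  common line is the real axis, with the Dirichlet ray on the negative side, where
  \<open>Arg\<close> jumps.\<close>

lemma borel_measurable_cnj [measurable (raw)]:
  "f \<in> borel_measurable M \<Longrightarrow> (\<lambda>x. cnj (f x)) \<in> borel_measurable M"
  by (rule borel_measurable_continuous_on[of cnj]) (auto intro: continuous_intros)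

lemma L2D: "u \<in> L2 M \<Longrightarrow> u \<in> borel_measurable M"
  "u \<in> L2 M \<Longrightarrow> integrable M (\<lambda>z. (cmod (u z))\<^sup>2)"
  by (auto simp: L2_def)

lemma L2_dom:
  assumes "v \<in> borel_measurable M" "integrable M b" "AE z in M. (cmod (v z))\<^sup>2 \<le> b z"
  shows "v \<in> L2 M"
proof -
  have "integrable M (\<lambda>z. (cmod (v z))\<^sup>2)"
    by (rule Bochner_Integration.integrable_bound[OF assms(2)]) (use assms in auto)
  with assms show ?thesis by (auto simp: L2_def)
qed

lemma cmod_add_sq: "(cmod (a + b))\<^sup>2 \<le> 2 * ((cmod a)\<^sup>2 + (cmod b)\<^sup>2)"
proof -
  have "(cmod (a + b))\<^sup>2 \<le> (cmod a + cmod b)\<^sup>2"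
    by (simp add: norm_triangle_ineq power_mono)
  also have "\<dots> \<le> 2 * ((cmod a)\<^sup>2 + (cmod b)\<^sup>2)"
    using sum_squares_bound[of "cmod a" "cmod b"] by (simp add: power2_sum)
  finally show ?thesis .
qed

lemma L2_zero [simp]: "(\<lambda>z. 0) \<in> L2 M"
  by (auto simp: L2_def)

lemma L2_add:
  assumes "u \<in> L2 M" "v \<in> L2 M" shows "(\<lambda>z. u z + v z) \<in> L2 M"
  by (rule L2_dom[where b = "\<lambda>z. 2 * ((cmod (u z))\<^sup>2 + (cmod (v z))\<^sup>2)"])
     (use assms[THEN L2D(1)] assms[THEN L2D(2)] cmod_add_sq in \<open>auto\<close>)

lemma L2_mult_bounded:
  assumes "u \<in> L2 M" "c \<in> borel_measurable M" "\<And>z. z \<in> space M \<Longrightarrow> cmod (c z) \<le> B"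
  shows "(\<lambda>z. c z * u z) \<in> L2 M"
proof (rule L2_dom[where b = "\<lambda>z. B\<^sup>2 * (cmod (u z))\<^sup>2"])
  show "AE z in M. (cmod (c z * u z))\<^sup>2 \<le> B\<^sup>2 * (cmod (u z))\<^sup>2"
    by (intro AE_I2) (simp add: norm_mult power_mult_distrib mult_right_mono power_mono assms(3))
qed (use assms in \<open>auto dest: L2D\<close>)

lemma L2_cmult: "u \<in> L2 M \<Longrightarrow> (\<lambda>z. c * u z) \<in> L2 M"
  by (rule L2_mult_bounded[where B = "cmod c"]) auto

lemma L2_uminus: "u \<in> L2 M \<Longrightarrow> (\<lambda>z. - u z) \<in> L2 M"
  by (auto simp: L2_def)

lemma L2_diff: "u \<in> L2 M \<Longrightarrow> v \<in> L2 M \<Longrightarrow> (\<lambda>z. u z - v z) \<in> L2 M"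
  using L2_add[OF _ L2_uminus] by fastforce

lemma L2_cnj: "u \<in> L2 M \<Longrightarrow> (\<lambda>z. cnj (u z)) \<in> L2 M"
  by (auto simp: L2_def)

lemmas L2_intros = L2_add L2_cmult L2_uminus L2_diff L2_cnj

lemma L2_int:
  assumes "u \<in> L2 M" "v \<in> L2 M" shows "integrable M (\<lambda>z. u z * v z)"
proof (rule Bochner_Integration.integrable_bound)
  show "integrable M (\<lambda>z. (cmod (u z))\<^sup>2 + (cmod (v z))\<^sup>2)"
    using assms[THEN L2D(2)] by auto
  have "cmod a * cmod b \<le> (cmod a)\<^sup>2 + (cmod b)\<^sup>2" for a b
    using sum_squares_bound[of "cmod a" "cmod b"] mult_nonneg_nonneg[of "cmod a" "cmod b"]
    unfolding mult.assoc by (smt (verit) norm_ge_zero)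
  then show "AE x in M. norm (u x * v x) \<le> norm ((cmod (u x))\<^sup>2 + (cmod (v x))\<^sup>2)"
    by (auto simp: norm_mult)
qed (use assms[THEN L2D(1)] assms[THEN L2D(2)] in auto)

lemma L2_int_cnj: "u \<in> L2 M \<Longrightarrow> v \<in> L2 M \<Longrightarrow> integrable M (\<lambda>z. u z * cnj (v z))"
  by (rule L2_int) (auto intro: L2_cnj)

section \<open>Norm, inner product, convergence and completeness\<close>

lemma L2_norm_ge0 [simp]: "0 \<le> L2_norm M u"
  by (simp add: L2_norm_def)

lemma L2_norm_sq: "(L2_norm M u)\<^sup>2 = (LINT z|M. (cmod (u z))\<^sup>2)"
  by (simp add: L2_norm_def)

lemma L2_inner_self: "L2_inner M u u = of_real ((L2_norm M u)\<^sup>2)"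
  by (simp add: L2_norm_sq L2_inner_def complex_norm_square[symmetric] flip: integral_complex_of_real)

lemma L2_norm_zero [simp]: "L2_norm M (\<lambda>z. 0) = 0"
  by (simp add: L2_norm_def)

lemma L2_norm_cmult: "L2_norm M (\<lambda>z. c * u z) = cmod c * L2_norm M u"
  by (simp add: L2_norm_def norm_mult power_mult_distrib real_sqrt_mult)

lemma L2_norm_minus_commute: "L2_norm M (\<lambda>z. u z - v z) = L2_norm M (\<lambda>z. v z - u z)"
  by (simp add: L2_norm_def norm_minus_commute)

lemma L2_norm_cong_AE:
  assumes "AE z in M. u z = v z" "u \<in> borel_measurable M" "v \<in> borel_measurable M"
  shows "L2_norm M u = L2_norm M v"
  unfolding L2_norm_def using assms
  by (intro arg_cong[where f = sqrt] integral_cong_AE) auto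

lemma L2_norm_eq_0:
  assumes "u \<in> L2 M" shows "L2_norm M u = 0 \<longleftrightarrow> (AE z in M. u z = 0)"
  using integral_nonneg_eq_0_iff_AE[OF L2D(2)[OF assms]] by (simp add: L2_norm_def)

text \<open>Weighted arithmetic-geometric mean: integrating
  \<open>2 * |u v| <= s * |u|^2 + |v|^2 / s\<close> bounds the inner product for every
  \<open>s > 0\<close>, and \<open>s = ||v|| / ||u||\<close> is the optimal weight. If one norm is
  0, the integrand vanishes almost everywhere.\<close>

lemma L2_CS:
  assumes "u \<in> L2 M" "v \<in> L2 M"
  shows "cmod (L2_inner M u v) \<le> L2_norm M u * L2_norm M v"
proof -
  let ?a = "L2_norm M u" and ?b = "L2_norm M v"
  have I: "integrable M (\<lambda>z. cmod (u z * cnj (v z)))"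
    using L2_int_cnj[OF assms] by (rule integrable_norm)
  have *: "2 * cmod (L2_inner M u v) \<le> s * ?a\<^sup>2 + ?b\<^sup>2 / s" if "s > 0" for s
  proof -
    have "cmod (L2_inner M u v) \<le> (LINT z|M. cmod (u z * cnj (v z)))"
      unfolding L2_inner_def by (rule integral_norm_bound)
    also have "2 * \<dots> = (LINT z|M. 2 * cmod (u z * cnj (v z)))" by simp
    also have "\<dots> \<le> (LINT z|M. s * (cmod (u z))\<^sup>2 + (cmod (v z))\<^sup>2 / s)"
    proof (rule integral_mono)
      fix z
      have "0 \<le> (s * cmod (u z) - cmod (v z))\<^sup>2 / s" using that by simp
      also have "\<dots> = s * (cmod (u z))\<^sup>2 + (cmod (v z))\<^sup>2 / s - 2 * cmod (u z * cnj (v z))"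
        using that by (simp add: power2_diff norm_mult field_simps power2_eq_square)
      finally show "2 * cmod (u z * cnj (v z)) \<le> s * (cmod (u z))\<^sup>2 + (cmod (v z))\<^sup>2 / s" by simp
    qed (use assms I in \<open>simp_all add: L2D\<close>)
    also have "\<dots> = s * ?a\<^sup>2 + ?b\<^sup>2 / s"
      using assms by (simp add: L2_norm_sq L2D)
    finally show ?thesis by simp
  qed
  show ?thesis
  proof (cases "?a = 0 \<or> ?b = 0")
    case False
    then have "?a > 0" "?b > 0" by (auto simp: less_le)
    then have "?b / ?a * ?a\<^sup>2 = ?a * ?b" "?b\<^sup>2 / (?b / ?a) = ?a * ?b"
      by (simp_all add: power2_eq_square)
    then show ?thesis using *[of "?b / ?a"] \<open>?a > 0\<close> \<open>?b > 0\<close> by simp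
  next
    case True
    then have "AE z in M. u z * cnj (v z) = 0"
      using L2_norm_eq_0[OF assms(1)] L2_norm_eq_0[OF assms(2)] by auto
    then have "L2_inner M u v = 0" unfolding L2_inner_def by (rule integral_eq_zero_AE)
    then show ?thesis by simp
  qed
qed

lemma L2_inner_cong_AE:
  assumes "AE z in M. u z = u' z" "AE z in M. v z = v' z"
    "u \<in> borel_measurable M" "v \<in> borel_measurable M" "u' \<in> borel_measurable M" "v' \<in> borel_measurable M"
  shows "L2_inner M u v = L2_inner M u' v'"
  unfolding L2_inner_def using assms by (intro integral_cong_AE) auto

lemma L2_inner_cnj: "L2_inner M v u = cnj (L2_inner M u v)"
  by (simp add: L2_inner_def mult.commute flip: Bochner_Integration.integral_cnj)

lemma L2_inner_add_left:
  "u \<in> L2 M \<Longrightarrow> v \<in> L2 M \<Longrightarrow> w \<in> L2 M \<Longrightarrow>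
    L2_inner M (\<lambda>z. u z + v z) w = L2_inner M u w + L2_inner M v w"
  by (simp add: L2_inner_def distrib_right L2_int_cnj)

lemma L2_inner_diff_left:
  "u \<in> L2 M \<Longrightarrow> v \<in> L2 M \<Longrightarrow> w \<in> L2 M \<Longrightarrow>
    L2_inner M (\<lambda>z. u z - v z) w = L2_inner M u w - L2_inner M v w"
  by (simp add: L2_inner_def left_diff_distrib L2_int_cnj)

lemma L2_inner_diff_right:
  "u \<in> L2 M \<Longrightarrow> v \<in> L2 M \<Longrightarrow> w \<in> L2 M \<Longrightarrow>
    L2_inner M w (\<lambda>z. u z - v z) = L2_inner M w u - L2_inner M w v"
  by (simp add: L2_inner_def right_diff_distrib L2_int_cnj)

lemma L2_inner_cmult_left: "L2_inner M (\<lambda>z. c * u z) v = c * L2_inner M u v"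
  by (simp add: L2_inner_def mult.assoc)

lemma L2_triangle:
  assumes "u \<in> L2 M" "v \<in> L2 M"
  shows "L2_norm M (\<lambda>z. u z + v z) \<le> L2_norm M u + L2_norm M v"
proof (rule power2_le_imp_le)
  have "(L2_norm M (\<lambda>z. u z + v z))\<^sup>2 =
      Re (L2_inner M (\<lambda>z. u z + v z) (\<lambda>z. u z + v z))"
    by (simp only: L2_inner_self Re_complex_of_real)
  also have "L2_inner M (\<lambda>z. u z + v z) (\<lambda>z. u z + v z) =
     L2_inner M u u + L2_inner M u v + cnj (L2_inner M u v) + L2_inner M v v"
    using assms by (simp add: L2_inner_def distrib_left distrib_right L2_int_cnj 
       mult.commute flip: Bochner_Integration.integral_cnj)
  also have "Re \<dots> = (L2_norm M u)\<^sup>2 + (L2_norm M v)\<^sup>2 + 2 * Re (L2_inner M u v)"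
    by (simp only: L2_inner_self plus_complex.sel Re_complex_of_real cnj.sel)
  also have "\<dots> \<le> (L2_norm M u)\<^sup>2 + (L2_norm M v)\<^sup>2 + 2 * (L2_norm M u * L2_norm M v)"
    using L2_CS[OF assms] complex_Re_le_cmod[of "L2_inner M u v"] by linarith
  finally show "(L2_norm M (\<lambda>z. u z + v z))\<^sup>2 \<le> (L2_norm M u + L2_norm M v)\<^sup>2"
    by (simp add: power2_sum)
qed simp

lemma L2_triangle_diff:
  assumes "u \<in> L2 M" "v \<in> L2 M" "w \<in> L2 M"
  shows "L2_norm M (\<lambda>z. u z - w z) \<le> L2_norm M (\<lambda>z. u z - v z) + L2_norm M (\<lambda>z. v z - w z)"
  using L2_triangle[OF L2_diff[OF assms(1,2)] L2_diff[OF assms(2,3)]] by simp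

lemma L2_inner_tendsto:
  assumes f: "\<And>n. f n \<in> L2 M" "u \<in> L2 M" "(\<lambda>n. L2_norm M (\<lambda>z. f n z - u z)) \<longlonglongrightarrow> 0"
    and g: "\<And>n. g n \<in> L2 M" "v \<in> L2 M" "(\<lambda>n. L2_norm M (\<lambda>z. g n z - v z)) \<longlonglongrightarrow> 0"
  shows "(\<lambda>n. L2_inner M (f n) (g n)) \<longlonglongrightarrow> L2_inner M u v"
proof -
  let ?a = "\<lambda>n. L2_norm M (\<lambda>z. f n z - u z)" and ?b = "\<lambda>n. L2_norm M (\<lambda>z. g n z - v z)"
  have b: "cmod (L2_inner M (f n) (g n) - L2_inner M u v) \<le> ?a n * ?b n + ?a n * L2_norm M v + L2_norm M u * ?b n" for n
  proof -
    have du: "(\<lambda>z. f n z - u z) \<in> L2 M" and dv: "(\<lambda>z. g n z - v z) \<in> L2 M"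
      using f g by (simp_all add: L2_diff)
    have eq: "L2_inner M (f n) (g n) - L2_inner M u v =
       L2_inner M (\<lambda>z. f n z - u z) (\<lambda>z. g n z - v z) + L2_inner M (\<lambda>z. f n z - u z) v
       + L2_inner M u (\<lambda>z. g n z - v z)"
      using f g by (simp add: L2_inner_diff_left L2_inner_diff_right L2_diff)
    have "cmod (L2_inner M (f n) (g n) - L2_inner M u v) \<le> cmod (L2_inner M (\<lambda>z. f n z - u z) (\<lambda>z. g n z - v z)) +
        cmod (L2_inner M (\<lambda>z. f n z - u z) v) + cmod (L2_inner M u (\<lambda>z. g n z - v z))"
      unfolding eq by (rule norm_triangle_le[OF add_mono[OF norm_triangle_ineq order_refl]])
    also have "\<dots> \<le> ?a n * ?b n + ?a n * L2_norm M v + L2_norm M u * ?b n"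
      using add_mono[OF add_mono[OF L2_CS[OF du dv] L2_CS[OF du g(2)]] L2_CS[OF f(2) dv]] by simp
    finally show ?thesis .
  qed
  have "(\<lambda>n. ?a n * ?b n + ?a n * L2_norm M v + L2_norm M u * ?b n) \<longlonglongrightarrow> 0 * 0 + 0 * L2_norm M v + L2_norm M u * 0"
    by (intro tendsto_intros f g)
  then have l: "(\<lambda>n. ?a n * ?b n + ?a n * L2_norm M v + L2_norm M u * ?b n) \<longlonglongrightarrow> 0"
    by simp
  have "(\<lambda>n. L2_inner M (f n) (g n) - L2_inner M u v) \<longlonglongrightarrow> 0"
    by (rule Lim_null_comparison[OF always_eventually l]) (use b in blast)
  then show ?thesis by (simp add: LIM_zero_iff)
qed

lemma L2_dominated:
  assumes "\<And>n. f n \<in> borel_measurable M" "u \<in> borel_measurable M"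
    and "integrable M (\<lambda>z. (b z)\<^sup>2)"
    and "\<And>n. AE z in M. cmod (f n z - u z) \<le> b z"
    and "AE z in M. (\<lambda>n. f n z) \<longlonglongrightarrow> u z"
  shows "(\<lambda>n. L2_norm M (\<lambda>z. f n z - u z)) \<longlonglongrightarrow> 0"
proof -
  have "(\<lambda>n. LINT z|M. (cmod (f n z - u z))\<^sup>2) \<longlonglongrightarrow> (LINT z|M. 0)"
  proof (rule integral_dominated_convergence[where w = "\<lambda>z. (b z)\<^sup>2"])
    show "AE z in M. (\<lambda>n. (cmod (f n z - u z))\<^sup>2) \<longlonglongrightarrow> 0"
      using assms(5)
    proof eventually_elim
      case (elim z)
      have "(\<lambda>n. (cmod (f n z - u z))\<^sup>2) \<longlonglongrightarrow> (cmod (u z - u z))\<^sup>2"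
        by (intro tendsto_intros elim)
      then show ?case by simp
    qed
    show "AE z in M. norm ((cmod (f n z - u z))\<^sup>2) \<le> (b z)\<^sup>2" for n
      using assms(4)[of n] by eventually_elim (simp add: power_mono)
  qed (use assms in auto)
  then have "(\<lambda>n. sqrt (LINT z|M. (cmod (f n z - u z))\<^sup>2)) \<longlonglongrightarrow> sqrt 0"
    by (intro tendsto_real_sqrt) simp
  then show ?thesis by (simp add: L2_norm_def)
qed

text \<open>Cauchy-Schwarz against the constant 1. It makes an L2-Cauchy sequence L1-Cauchy, which
  gives access to subsequences that are Cauchy almost everywhere.\<close>

lemma L2_norm_1_le:
  assumes "finite_measure M" "u \<in> L2 M"
  shows "integrable M u" "(LINT z|M. cmod (u z)) \<le> L2_norm M (\<lambda>z. 1) * L2_norm M u"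
proof -
  interpret finite_measure M by fact
  have 1: "(\<lambda>z. 1) \<in> L2 M" by (simp add: L2_def)
  have n: "(\<lambda>z. of_real (cmod (u z))) \<in> L2 M" using L2D[OF assms(2)] by (simp add: L2_def)
  show "integrable M u" using L2_int[OF 1 assms(2)] by simp
  have "(LINT z|M. cmod (u z)) = cmod (L2_inner M (\<lambda>z. 1) (\<lambda>z. of_real (cmod (u z))))"
    by (simp add: L2_inner_def)
  also have "\<dots> \<le> L2_norm M (\<lambda>z. 1) * L2_norm M (\<lambda>z. of_real (cmod (u z)))"
    by (rule L2_CS[OF 1 n])
  finally show "(LINT z|M. cmod (u z)) \<le> L2_norm M (\<lambda>z. 1) * L2_norm M u"
    by (simp add: L2_norm_def)
qed

text \<open>The limit is the pointwise limit of an almost everywhere convergent subsequence; Fatou's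
  lemma carries the Cauchy estimate over to it.\<close>

lemma L2_complete:
  assumes fin: "finite_measure M" and f: "\<And>n. f n \<in> L2 M"
    and C: "\<And>\<epsilon>. \<epsilon> > 0 \<Longrightarrow> \<exists>N. \<forall>m\<ge>N. \<forall>n\<ge>N. L2_norm M (\<lambda>z. f m z - f n z) < \<epsilon>"
  obtains u where "u \<in> L2 M" "(\<lambda>n. L2_norm M (\<lambda>z. f n z - u z)) \<longlonglongrightarrow> 0"
proof -
  have [measurable]: "f n \<in> borel_measurable M" for n using f L2D by blast
  have "\<exists>N. \<forall>i\<ge>N. \<forall>j\<ge>N. (LINT x|M. norm (f i x - f j x)) < e" if "e > 0" for e :: real
  proof -
    let ?c = "L2_norm M (\<lambda>z. 1)"
    have "e / (?c + 1) > 0" using that by (simp add: add_nonneg_pos)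
    from C[OF this] obtain N where N: "\<forall>m\<ge>N. \<forall>n\<ge>N. L2_norm M (\<lambda>z. f m z - f n z) < e / (?c + 1)" by blast
    show ?thesis
    proof (intro exI[of _ N] allI impI)
      fix i j assume "i \<ge> N" "j \<ge> N"
      have "(LINT x|M. norm (f i x - f j x)) \<le> ?c * L2_norm M (\<lambda>z. f i z - f j z)"
        by (rule L2_norm_1_le[OF fin L2_diff[OF f f]])
      also have "\<dots> \<le> ?c * (e / (?c + 1))"
        using N \<open>i \<ge> N\<close> \<open>j \<ge> N\<close> by (intro mult_left_mono) (auto simp: less_imp_le)
      also have "\<dots> < e"
      proof -
        have "?c + 1 > 0" by (simp add: add_nonneg_pos)
        then show ?thesis using that by (simp add: pos_divide_less_eq distrib_left)
      qed
      finally show "(LINT x|M. norm (f i x - f j x)) < e" .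
    qed
  qed
  from cauchy_L1_AE_cauchy_subseq[OF L2_norm_1_le(1)[OF fin f] this]
  obtain r where r: "strict_mono r" "AE x in M. Cauchy (\<lambda>i. f (r i) x)" by blast
  define u where "u = (\<lambda>x. lim (\<lambda>i. f (r i) x))"
  have [measurable]: "u \<in> borel_measurable M" unfolding u_def by measurable
  have lim: "AE x in M. (\<lambda>i. f (r i) x) \<longlonglongrightarrow> u x"
    using r(2) unfolding u_def by eventually_elim (simp add: Cauchy_convergent_iff convergent_LIMSEQ_iff)
  \<comment> \<open>Fatou: \<open>f n - u\<close> is the pointwise limit of
    \<open>f n - f (r k)\<close>, and \<open>N <= k <= r k\<close> keeps the norms of these
    differences below \<open>e\<close>.\<close>
  have key: "(\<integral>\<^sup>+ x. ennreal ((cmod (f n x - u x))\<^sup>2) \<partial>M) \<le> ennreal (e\<^sup>2)"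
    if N: "\<forall>m\<ge>N. \<forall>n\<ge>N. L2_norm M (\<lambda>z. f m z - f n z) < e" "n \<ge> N" for n N e
  proof -
    have "(\<integral>\<^sup>+ x. ennreal ((cmod (f n x - u x))\<^sup>2) \<partial>M)
       = (\<integral>\<^sup>+ x. liminf (\<lambda>k. ennreal ((cmod (f n x - f (r k) x))\<^sup>2)) \<partial>M)"
    proof (rule nn_integral_cong_AE, use lim in eventually_elim)
      case (elim x)
      have "(\<lambda>k. ennreal ((cmod (f n x - f (r k) x))\<^sup>2)) \<longlonglongrightarrow> ennreal ((cmod (f n x - u x))\<^sup>2)"
        by (intro tendsto_intros tendsto_ennrealI elim)
      from lim_imp_Liminf[OF _ this] show ?case by simp
    qed
    also have "\<dots> \<le> liminf (\<lambda>k. \<integral>\<^sup>+ x. ennreal ((cmod (f n x - f (r k) x))\<^sup>2) \<partial>M)"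
      by (rule nn_integral_liminf) simp
    also have "\<dots> \<le> ennreal (e\<^sup>2)"
    proof (rule Liminf_le, simp, rule eventually_sequentiallyI[of N])
      fix k assume "N \<le> k"
      then have "N \<le> r k" using seq_suble[OF r(1), of k] by simp
      have "(\<integral>\<^sup>+ x. ennreal ((cmod (f n x - f (r k) x))\<^sup>2) \<partial>M) = ennreal (LINT x|M. (cmod (f n x - f (r k) x))\<^sup>2)"
        by (intro nn_integral_eq_integral L2D(2)[OF L2_diff[OF f f]]) simp
      also have "\<dots> \<le> ennreal (e\<^sup>2)"
        using N \<open>N \<le> r k\<close> unfolding L2_norm_sq[symmetric]
        by (intro ennreal_leI power_mono) (auto simp: less_imp_le)
      finally show "(\<integral>\<^sup>+ x. ennreal ((cmod (f n x - f (r k) x))\<^sup>2) \<partial>M) \<le> ennreal (e\<^sup>2)" .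
    qed
    finally show ?thesis .
  qed
  have in2: "(\<lambda>x. f n x - u x) \<in> L2 M" if "\<forall>m\<ge>N. \<forall>n\<ge>N. L2_norm M (\<lambda>z. f m z - f n z) < e" "n \<ge> N" for n N e
    unfolding L2_def using key[OF that] by (auto intro!: integrableI_nonneg simp: le_less_trans)
  have u: "u \<in> L2 M"
  proof -
    obtain N where N: "\<forall>m\<ge>N. \<forall>n\<ge>N. L2_norm M (\<lambda>z. f m z - f n z) < 1" using C[of 1] by auto
    from L2_diff[OF f[of N] in2[OF N order_refl]] show ?thesis by simp
  qed
  moreover have "(\<lambda>n. L2_norm M (\<lambda>z. f n z - u z)) \<longlonglongrightarrow> 0"
  proof (rule LIMSEQ_I)
    fix e :: real assume "e > 0"
    obtain N where N: "\<forall>m\<ge>N. \<forall>n\<ge>N. L2_norm M (\<lambda>z. f m z - f n z) < e / 2"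
      using C[of "e / 2"] \<open>e > 0\<close> by auto
    have "L2_norm M (\<lambda>z. f n z - u z) < e" if "n \<ge> N" for n
    proof -
      have "ennreal (LINT x|M. (cmod (f n x - u x))\<^sup>2) = (\<integral>\<^sup>+ x. ennreal ((cmod (f n x - u x))\<^sup>2) \<partial>M)"
        by (intro nn_integral_eq_integral[symmetric] L2D(2)[OF in2[OF N that]]) simp
      also have "\<dots> \<le> ennreal ((e/2)\<^sup>2)" by (rule key[OF N that])
      finally have "(L2_norm M (\<lambda>z. f n z - u z))\<^sup>2 \<le> (e/2)\<^sup>2"
        unfolding L2_norm_sq by (simp add: ennreal_le_iff)
      then have "L2_norm M (\<lambda>z. f n z - u z) \<le> e/2"
        by (rule power2_le_imp_le) (use \<open>e > 0\<close> in simp)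
      then show ?thesis using \<open>e > 0\<close> by simp
    qed
    then show "\<exists>no. \<forall>n\<ge>no. norm (L2_norm M (\<lambda>z. f n z - u z) - 0) < e" by auto
  qed
  ultimately show ?thesis by (rule that)
qed

section \<open>Closures of first-order forms\<close>

text \<open>The closure of the graph of \<open>(P, Q)\<close> on the core \<open>D\<close>, as a
  relation: \<open>g\<close> and \<open>h\<close> play the part of the derivatives of
  \<open>u\<close>. With these as arguments no representative has to be chosen; for closable pairs
  they are determined almost everywhere.\<close>

definition form_graph :: "complex measure \<Rightarrow> cfun set \<Rightarrow> (cfun \<Rightarrow> cfun) \<Rightarrow> (cfun \<Rightarrow> cfun) \<Rightarrow> cfun \<Rightarrow> cfun \<Rightarrow> cfun \<Rightarrow> bool"
  where "form_graph M D P Q u g h \<longleftrightarrow> u \<in> L2 M \<and> g \<in> L2 M \<and> h \<in> L2 M \<and>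
    (\<forall>\<epsilon>>0. \<exists>\<phi>\<in>D. L2_norm M (\<lambda>z. \<phi> z - u z) < \<epsilon> \<and> L2_norm M (\<lambda>z. P \<phi> z - g z) < \<epsilon> \<and>
       L2_norm M (\<lambda>z. Q \<phi> z - h z) < \<epsilon>)"

text \<open>One equation for both operators: \<open>P\<close> and \<open>Q\<close> are the magnetic
  derivatives for one, the ordinary partial derivatives for the other. That \<open>u\<close> is
  nonzero is demanded separately.\<close>

definition weak_eigen :: "complex measure \<Rightarrow> cfun set \<Rightarrow> (cfun \<Rightarrow> cfun) \<Rightarrow> (cfun \<Rightarrow> cfun) \<Rightarrow> complex \<Rightarrow> cfun \<Rightarrow> bool"
  where "weak_eigen M D P Q \<mu> u \<longleftrightarrow> (\<exists>g h. form_graph M D P Q u g h \<and>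
    (\<forall>v g' h'. form_graph M D P Q v g' h' \<longrightarrow> L2_inner M g g' + L2_inner M h h' = \<mu> * L2_inner M u v))"

lemma form_graphD:
  assumes "form_graph M D P Q u g h" shows "u \<in> L2 M" "g \<in> L2 M" "h \<in> L2 M"
  using assms by (auto simp: form_graph_def)

lemma form_graphI_core:
  assumes "\<phi> \<in> D" "\<phi> \<in> L2 M" "P \<phi> \<in> L2 M" "Q \<phi> \<in> L2 M"
  shows "form_graph M D P Q \<phi> (P \<phi>) (Q \<phi>)"
  using assms unfolding form_graph_def by (auto intro!: bexI[of _ \<phi>])

lemma form_graphI_seq:
  assumes "\<And>n. \<phi> n \<in> D" "u \<in> L2 M" "g \<in> L2 M" "h \<in> L2 M"
    and "(\<lambda>n. L2_norm M (\<lambda>z. \<phi> n z - u z)) \<longlonglongrightarrow> 0"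
    and "(\<lambda>n. L2_norm M (\<lambda>z. P (\<phi> n) z - g z)) \<longlonglongrightarrow> 0"
    and "(\<lambda>n. L2_norm M (\<lambda>z. Q (\<phi> n) z - h z)) \<longlonglongrightarrow> 0"
  shows "form_graph M D P Q u g h"
  unfolding form_graph_def
proof (intro conjI allI impI)
  fix e :: real assume "e > 0"
  from order_tendstoD(2)[OF assms(5) this] order_tendstoD(2)[OF assms(6) this] order_tendstoD(2)[OF assms(7) this]
  have "\<forall>\<^sub>F n in sequentially. L2_norm M (\<lambda>z. \<phi> n z - u z) < e \<and> L2_norm M (\<lambda>z. P (\<phi> n) z - g z) < e \<and>
       L2_norm M (\<lambda>z. Q (\<phi> n) z - h z) < e" by eventually_elim simp
  then obtain n where "L2_norm M (\<lambda>z. \<phi> n z - u z) < e \<and> L2_norm M (\<lambda>z. P (\<phi> n) z - g z) < e \<and>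
       L2_norm M (\<lambda>z. Q (\<phi> n) z - h z) < e" unfolding eventually_sequentially by blast
  then show "\<exists>\<phi>\<in>D. L2_norm M (\<lambda>z. \<phi> z - u z) < e \<and> L2_norm M (\<lambda>z. P \<phi> z - g z) < e \<and>
       L2_norm M (\<lambda>z. Q \<phi> z - h z) < e" using assms(1) by blast
qed fact+

lemma form_graph_seq:
  assumes "form_graph M D P Q u g h"
  obtains \<phi> where "\<And>n. \<phi> n \<in> D"
    "(\<lambda>n. L2_norm M (\<lambda>z. \<phi> n z - u z)) \<longlonglongrightarrow> 0"
    "(\<lambda>n. L2_norm M (\<lambda>z. P (\<phi> n) z - g z)) \<longlonglongrightarrow> 0"
    "(\<lambda>n. L2_norm M (\<lambda>z. Q (\<phi> n) z - h z)) \<longlonglongrightarrow> 0"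
proof -
  have "\<forall>n. \<exists>\<phi>. \<phi> \<in> D \<and> L2_norm M (\<lambda>z. \<phi> z - u z) < inverse (real (Suc n)) \<and>
     L2_norm M (\<lambda>z. P \<phi> z - g z) < inverse (real (Suc n)) \<and> L2_norm M (\<lambda>z. Q \<phi> z - h z) < inverse (real (Suc n))"
    using assms unfolding form_graph_def by (metis inverse_positive_iff_positive of_nat_0_less_iff zero_less_Suc)
  then obtain \<phi> where \<phi>: "\<And>n. \<phi> n \<in> D" "\<And>n. L2_norm M (\<lambda>z. \<phi> n z - u z) < inverse (real (Suc n))"
     "\<And>n. L2_norm M (\<lambda>z. P (\<phi> n) z - g z) < inverse (real (Suc n))"
     "\<And>n. L2_norm M (\<lambda>z. Q (\<phi> n) z - h z) < inverse (real (Suc n))"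
    by metis
  have *: "a \<longlonglongrightarrow> 0" if "\<And>n. a n < inverse (real (Suc n))" "\<And>n. 0 \<le> a n" for a :: "nat \<Rightarrow> real"
    using that by (intro real_tendsto_sandwich[OF _ _ tendsto_const LIMSEQ_inverse_real_of_nat])
      (auto simp: less_imp_le)
  show ?thesis
    by (rule that[of \<phi>]) (use \<phi> in \<open>auto intro!: *\<close>)
qed

text \<open>A Lipschitz map between graph closures needs checking on the core only, and the image of
  a core function may itself be a mere limit of core functions. Only differences are estimated, so
  \<open>J\<close>, \<open>A\<close> and \<open>B\<close> may be antilinear.\<close>

lemma form_graph_transfer:
  assumes cl: "form_graph M D P Q u g h"
    and D: "\<And>\<phi>. \<phi> \<in> D \<Longrightarrow> \<phi> \<in> L2 M \<and> P \<phi> \<in> L2 M \<and> Q \<phi> \<in> L2 M"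
    and D': "\<And>\<phi>. \<phi> \<in> D' \<Longrightarrow> \<phi> \<in> L2 M' \<and> P' \<phi> \<in> L2 M' \<and> Q' \<phi> \<in> L2 M'"
    and J: "\<And>f f'. f \<in> L2 M \<Longrightarrow> f' \<in> L2 M \<Longrightarrow> J f \<in> L2 M' \<and> L2_norm M' (\<lambda>z. J f z - J f' z) \<le> c * L2_norm M (\<lambda>z. f z - f' z)"
    and A: "\<And>f f' k k'. f \<in> L2 M \<Longrightarrow> f' \<in> L2 M \<Longrightarrow> k \<in> L2 M \<Longrightarrow> k' \<in> L2 M \<Longrightarrow> A f k \<in> L2 M' \<and>
       L2_norm M' (\<lambda>z. A f k z - A f' k' z) \<le> c * (L2_norm M (\<lambda>z. f z - f' z) + L2_norm M (\<lambda>z. k z - k' z))"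
    and B: "\<And>f f' k k'. f \<in> L2 M \<Longrightarrow> f' \<in> L2 M \<Longrightarrow> k \<in> L2 M \<Longrightarrow> k' \<in> L2 M \<Longrightarrow> B f k \<in> L2 M' \<and>
       L2_norm M' (\<lambda>z. B f k z - B f' k' z) \<le> c * (L2_norm M (\<lambda>z. f z - f' z) + L2_norm M (\<lambda>z. k z - k' z))"
    and core: "\<And>\<phi>. \<phi> \<in> D \<Longrightarrow> form_graph M' D' P' Q' (J \<phi>) (A (P \<phi>) (Q \<phi>)) (B (P \<phi>) (Q \<phi>))"
  shows "form_graph M' D' P' Q' (J u) (A g h) (B g h)"
  unfolding form_graph_def
proof (intro conjI allI impI)
  note L = form_graphD[OF cl]
  show "J u \<in> L2 M'" "A g h \<in> L2 M'" "B g h \<in> L2 M'" using J A B L by blast+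
  fix e :: real assume "e > 0"
  \<comment> \<open>Two gradient errors below \<open>d\<close> add up to less than
    \<open>2 * d\<close>, which \<open>c\<close> enlarges to less than \<open>e / 2\<close>; the
    other half of \<open>e\<close> pays for approximating the image.\<close>
  define d where "d = e / (4 * (\<bar>c\<bar> + 1))"
  have "d > 0" using \<open>e > 0\<close> by (simp add: d_def add_nonneg_pos)
  have cd: "c * x < e / 2" if "x < 2 * d" "x \<ge> 0" for x
  proof -
    have "c * x \<le> \<bar>c\<bar> * x" using that by (simp add: mult_right_mono)
    also have "\<dots> \<le> \<bar>c\<bar> * (2 * d)" using that by (simp add: mult_left_mono)
    also have "\<dots> < (\<bar>c\<bar> + 1) * (2 * d)" using \<open>d > 0\<close> by simp
    also have "\<dots> = e / 2" by (simp add: d_def field_simps)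
    finally show ?thesis .
  qed
  obtain \<phi> where \<phi>: "\<phi> \<in> D" "L2_norm M (\<lambda>z. \<phi> z - u z) < d" "L2_norm M (\<lambda>z. P \<phi> z - g z) < d"
       "L2_norm M (\<lambda>z. Q \<phi> z - h z) < d"
    using cl \<open>d > 0\<close> unfolding form_graph_def by blast
  obtain \<psi> where \<psi>: "\<psi> \<in> D'" "L2_norm M' (\<lambda>z. \<psi> z - J \<phi> z) < e / 2"
       "L2_norm M' (\<lambda>z. P' \<psi> z - A (P \<phi>) (Q \<phi>) z) < e / 2"
       "L2_norm M' (\<lambda>z. Q' \<psi> z - B (P \<phi>) (Q \<phi>) z) < e / 2"
    using core[OF \<phi>(1)] \<open>e > 0\<close> unfolding form_graph_def by (meson half_gt_zero)
  note D\<phi> = D[OF \<phi>(1)] and D\<psi> = D'[OF \<psi>(1)]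
  have "L2_norm M' (\<lambda>z. \<psi> z - J u z) \<le> L2_norm M' (\<lambda>z. \<psi> z - J \<phi> z) + L2_norm M' (\<lambda>z. J \<phi> z - J u z)"
    using D\<phi> D\<psi> L J by (intro L2_triangle_diff) auto
  also have "L2_norm M' (\<lambda>z. J \<phi> z - J u z) \<le> c * L2_norm M (\<lambda>z. \<phi> z - u z)"
    using J D\<phi> L by blast
  also have "\<dots> < e / 2" using \<phi> \<open>d > 0\<close> by (intro cd) auto
  finally have 1: "L2_norm M' (\<lambda>z. \<psi> z - J u z) < e" using \<psi>(2) by simp
  let ?n = "L2_norm M (\<lambda>z. P \<phi> z - g z) + L2_norm M (\<lambda>z. Q \<phi> z - h z)"
  have n: "c * ?n < e / 2" using \<phi> \<open>d > 0\<close> by (intro cd) auto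
  have "L2_norm M' (\<lambda>z. P' \<psi> z - A g h z) \<le>
     L2_norm M' (\<lambda>z. P' \<psi> z - A (P \<phi>) (Q \<phi>) z) + L2_norm M' (\<lambda>z. A (P \<phi>) (Q \<phi>) z - A g h z)"
    using D\<phi> D\<psi> L A by (intro L2_triangle_diff) auto
  also have "L2_norm M' (\<lambda>z. A (P \<phi>) (Q \<phi>) z - A g h z) \<le> c * ?n"
    using A D\<phi> L by blast
  finally have 2: "L2_norm M' (\<lambda>z. P' \<psi> z - A g h z) < e" using \<psi>(3) n by simp
  have "L2_norm M' (\<lambda>z. Q' \<psi> z - B g h z) \<le>
     L2_norm M' (\<lambda>z. Q' \<psi> z - B (P \<phi>) (Q \<phi>) z) + L2_norm M' (\<lambda>z. B (P \<phi>) (Q \<phi>) z - B g h z)"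
    using D\<phi> D\<psi> L B by (intro L2_triangle_diff) auto
  also have "L2_norm M' (\<lambda>z. B (P \<phi>) (Q \<phi>) z - B g h z) \<le> c * ?n"
    using B D\<phi> L by blast
  finally have 3: "L2_norm M' (\<lambda>z. Q' \<psi> z - B g h z) < e" using \<psi>(4) n by simp
  show "\<exists>\<psi>\<in>D'. L2_norm M' (\<lambda>z. \<psi> z - J u z) < e \<and> L2_norm M' (\<lambda>z. P' \<psi> z - A g h z) < e \<and>
       L2_norm M' (\<lambda>z. Q' \<psi> z - B g h z) < e"
    using 1 2 3 \<psi>(1) by blast
qed

lemma form_graph_cong_AE:
  assumes "form_graph M D P Q u g h" "AE z in M. g z = g' z" "AE z in M. h z = h' z" "g' \<in> L2 M" "h' \<in> L2 M"
    and D: "\<And>\<phi>. \<phi> \<in> D \<Longrightarrow> \<phi> \<in> L2 M \<and> P \<phi> \<in> L2 M \<and> Q \<phi> \<in> L2 M"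
  shows "form_graph M D P Q u g' h'"
proof -
  note L = form_graphD[OF assms(1)]
  have "L2_norm M (\<lambda>z. P \<phi> z - g z) = L2_norm M (\<lambda>z. P \<phi> z - g' z)"
    "L2_norm M (\<lambda>z. Q \<phi> z - h z) = L2_norm M (\<lambda>z. Q \<phi> z - h' z)" if "\<phi> \<in> D" for \<phi>
    using assms(2,3) L2D(1)[OF L2_diff] D[OF that] L assms(4,5) by (auto intro!: L2_norm_cong_AE)
  with assms(1,4,5) show ?thesis unfolding form_graph_def by auto
qed

section \<open>Reflections and Lebesgue measure\<close>

text \<open>For \<open>a = exp (2 * i * alpha)\<close> this is the reflection in the line through 0
  at angle alpha: \<open>a = 1\<close> gives the real axis, \<open>a = -1\<close> the imaginary one.
  Since it sends 1 to \<open>a\<close>, it also serves to carry the positive real axis to any other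
  ray.\<close>

definition reflect :: "complex \<Rightarrow> complex \<Rightarrow> complex"
  where "reflect a z = a * cnj z"

lemma reflect_rf [simp]: "cmod a = 1 \<Longrightarrow> reflect a (reflect a z) = z"
proof -
  assume "cmod a = 1"
  then have "a * cnj a = 1" by (simp add: complex_norm_square[symmetric])
  then show ?thesis by (simp add: reflect_def mult.assoc[symmetric])
qed

lemma norm_reflect [simp]: "cmod a = 1 \<Longrightarrow> cmod (reflect a z) = cmod z"
  by (simp add: reflect_def norm_mult)

lemma reflect_add: "reflect a (x + y) = reflect a x + reflect a y" and reflect_diff: "reflect a (x - y) = reflect a x - reflect a y"
  by (simp_all add: reflect_def algebra_simps)

lemma reflect_measurable [measurable]: "reflect a \<in> borel_measurable borel"
  unfolding reflect_def by measurable

lemma continuous_on_reflect [continuous_intros]: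
  "continuous_on S f \<Longrightarrow> continuous_on S (\<lambda>x. reflect a (f x))"
  unfolding reflect_def by (intro continuous_intros)

lemma nn_integral_lborel_translate:
  fixes f :: "'a::euclidean_space \<Rightarrow> ennreal"
  assumes [measurable]: "f \<in> borel_measurable borel"
  shows "(\<integral>\<^sup>+x. f (c + x) \<partial>lborel) = (\<integral>\<^sup>+x. f x \<partial>lborel)"
proof -
  have "(\<integral>\<^sup>+x. f x \<partial>lborel) = (\<integral>\<^sup>+x. f x \<partial>distr lborel borel ((+) c))"
    by (simp add: lborel_distr_plus)
  also have "\<dots> = (\<integral>\<^sup>+x. f (c + x) \<partial>lborel)" by (rule nn_integral_distr) auto
  finally show ?thesis by simp
qed

text \<open>Uniqueness of Haar measure: by Fubini, an isometry that preserves the measure of the unit ball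
  preserves the measure of every Borel set.\<close>

lemma distr_reflect:
  assumes a: "cmod a = 1"
  shows "distr lborel borel (reflect a) = lborel"
proof (rule measure_eqI)
  fix A assume "A \<in> sets (distr lborel borel (reflect a))"
  then have [measurable]: "A \<in> sets borel" by simp
  let ?B = "ball (0::complex) 1"
  define b f where "b = (indicator ?B :: complex \<Rightarrow> ennreal)" and "f = (indicator A :: complex \<Rightarrow> ennreal)"
  have [measurable]: "b \<in> borel_measurable borel" "f \<in> borel_measurable borel"
    using borel_measurable_indicator[of ?B borel] borel_measurable_indicator[of A borel]
    by (simp_all add: b_def f_def)
  have bB: "(\<integral>\<^sup>+x. b x \<partial>lborel) = emeasure lborel ?B" and fA: "integral\<^sup>N N f = emeasure N A" if "sets N = sets borel" for N
    using that by (simp_all add: b_def f_def)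
  have ballm: "emeasure lborel (ball (c::complex) 1) = emeasure lborel ?B" for c
    by (simp add: emeasure_ball)
  \<comment> \<open>Integrated over \<open>w\<close> first, this is the product of the measures of
    \<open>A\<close> and of the ball. After the shift of \<open>x\<close> by
    \<open>reflect a w\<close>, the inner integral over \<open>w\<close> yields the measure of the
    preimage of \<open>A\<close> instead.\<close>
  have swap: "(\<integral>\<^sup>+x. \<integral>\<^sup>+w. f x * b (x - reflect a w) \<partial>lborel \<partial>lborel) =
     (\<integral>\<^sup>+w. \<integral>\<^sup>+x. f x * b (x - reflect a w) \<partial>lborel \<partial>lborel)"
    by (rule lborel_pair.Fubini'[symmetric]) measurable
  have "(\<integral>\<^sup>+w. b (x - reflect a w) \<partial>lborel) = emeasure lborel ?B" for x
  proof -
    have "(\<integral>\<^sup>+w. b (x - reflect a w) \<partial>lborel) = (\<integral>\<^sup>+w. indicator (ball (reflect a x) 1) w \<partial>lborel)"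
    proof (rule nn_integral_cong)
      fix w
      have "x - reflect a w = reflect a (reflect a x - w)" using a by (simp add: reflect_diff)
      then have "cmod (x - reflect a w) = cmod (reflect a x - w)" using norm_reflect[OF a] by metis
      then have "x - reflect a w \<in> ?B \<longleftrightarrow> w \<in> ball (reflect a x) 1" unfolding mem_ball_0 unfolding mem_ball dist_norm by simp
      then show "b (x - reflect a w) = (indicator (ball (reflect a x) 1) w :: ennreal)"
        unfolding b_def indicator_def by simp
    qed
    then show ?thesis using ballm by simp
  qed
  then have 1: "(\<integral>\<^sup>+x. \<integral>\<^sup>+w. f x * b (x - reflect a w) \<partial>lborel \<partial>lborel) = emeasure lborel A * emeasure lborel ?B"
    by (simp add: nn_integral_cmult nn_integral_multc fA)
  have "(\<integral>\<^sup>+w. \<integral>\<^sup>+x. f x * b (x - reflect a w) \<partial>lborel \<partial>lborel)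
      = (\<integral>\<^sup>+w. \<integral>\<^sup>+x. f (reflect a w + x) * b x \<partial>lborel \<partial>lborel)"
  proof (rule nn_integral_cong)
    fix w
    show "(\<integral>\<^sup>+x. f x * b (x - reflect a w) \<partial>lborel) = (\<integral>\<^sup>+x. f (reflect a w + x) * b x \<partial>lborel)"
      using nn_integral_lborel_translate[of "\<lambda>x. f x * b (x - reflect a w)" "reflect a w"] by simp
  qed
  also have "\<dots> = (\<integral>\<^sup>+x. \<integral>\<^sup>+w. f (reflect a w + x) * b x \<partial>lborel \<partial>lborel)"
    by (rule lborel_pair.Fubini') measurable
  also have "\<dots> = (\<integral>\<^sup>+x. (\<integral>\<^sup>+w. f (reflect a w + x) \<partial>lborel) * b x \<partial>lborel)"
    by (intro nn_integral_cong nn_integral_multc) measurable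
  also have "(\<lambda>x. \<integral>\<^sup>+w. f (reflect a w + x) \<partial>lborel) = (\<lambda>x. emeasure (distr lborel borel (reflect a)) A)"
  proof
    fix x
    have "(\<integral>\<^sup>+w. f (reflect a w + x) \<partial>lborel) = (\<integral>\<^sup>+w. f (reflect a (reflect a x + w)) \<partial>lborel)"
      using a by (simp add: reflect_add add.commute)
    also have "\<dots> = (\<integral>\<^sup>+w. f (reflect a w) \<partial>lborel)"
      by (rule nn_integral_lborel_translate) measurable
    also have "\<dots> = (\<integral>\<^sup>+w. f w \<partial>distr lborel borel (reflect a))"
      by (rule nn_integral_distr[symmetric]) auto
    finally show "(\<integral>\<^sup>+w. f (reflect a w + x) \<partial>lborel) = emeasure (distr lborel borel (reflect a)) A" by (simp add: fA)
  qed
  also have "(\<integral>\<^sup>+x. emeasure (distr lborel borel (reflect a)) A * b x \<partial>lborel) =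
     emeasure (distr lborel borel (reflect a)) A * emeasure lborel ?B"
    by (simp add: nn_integral_cmult bB)
  finally have eq: "emeasure lborel ?B * emeasure (distr lborel borel (reflect a)) A = emeasure lborel ?B * emeasure lborel A"
    using 1 swap by (simp only: mult.commute)
  \<comment> \<open>The factor contributed by the ball can be cancelled, being neither 0 nor
    infinite.\<close>
  have "emeasure lborel ?B \<noteq> 0" "emeasure lborel ?B \<noteq> top"
    by (simp_all add: emeasure_ball unit_ball_vol_2)
  with iffD1[OF ennreal_mult_cancel_left eq]
  show "emeasure (distr lborel borel (reflect a)) A = emeasure lborel A" by blast
qed simp

section \<open>Restricted Lebesgue measure and measure-preserving maps\<close>

lemma space_leb [simp]: "space (leb S) = S"
  by (simp add: leb_def space_restrict_space)

lemma sets_leb: "S \<in> sets borel \<Longrightarrow> A \<in> sets (leb S) \<longleftrightarrow> A \<in> sets borel \<and> A \<subseteq> S"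
  unfolding leb_def by (subst sets_restrict_space_iff) auto

lemma emeasure_leb: "S \<in> sets borel \<Longrightarrow> A \<in> sets (leb S) \<Longrightarrow> emeasure (leb S) A = emeasure lborel A"
  unfolding leb_def by (subst emeasure_restrict_space) (auto simp: sets_restrict_space_iff)

lemma finite_measure_leb:
  assumes "S \<in> sets borel" "bounded S" shows "finite_measure (leb S)"
proof
  obtain r where "S \<subseteq> ball 0 r" using assms(2) bounded_subset_ballD[of S 0] by blast
  then have "emeasure lborel S \<le> emeasure lborel (ball (0::complex) r)" by (rule emeasure_mono) simp
  also have "\<dots> < \<infinity>" by (rule emeasure_lborel_ball_finite)
  finally show "emeasure (leb S) (space (leb S)) \<noteq> \<infinity>"
    using assms(1) by (simp add: emeasure_leb sets_leb)
qed

lemma integral_leb: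
  fixes f :: "complex \<Rightarrow> 'b::{banach, second_countable_topology}"
  shows "S \<in> sets borel \<Longrightarrow> integral\<^sup>L (leb S) f = (LINT z|lborel. indicator S z *\<^sub>R f z)"
  unfolding leb_def by (subst integral_restrict_space) auto

lemma integrable_leb:
  fixes f :: "complex \<Rightarrow> 'b::{banach, second_countable_topology}"
  shows "S \<in> sets borel \<Longrightarrow> integrable (leb S) f \<longleftrightarrow> integrable lborel (\<lambda>z. indicator S z *\<^sub>R f z)"
  unfolding leb_def by (subst integrable_restrict_space) auto

lemma AE_leb: "S \<in> sets borel \<Longrightarrow> (AE z in leb S. P z) \<longleftrightarrow> (AE z in lborel. z \<in> S \<longrightarrow> P z)"
  unfolding leb_def by (subst AE_restrict_space_iff) auto

lemma measurable_leb_mono: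
  "A \<subseteq> B \<Longrightarrow> f \<in> borel_measurable (leb B) \<Longrightarrow> f \<in> borel_measurable (leb A)"
  unfolding leb_def by (rule measurable_restrict_mono)

lemma borel_measurable_leb:
  "f \<in> borel_measurable borel \<Longrightarrow> f \<in> borel_measurable (leb S)"
  unfolding leb_def by (rule measurable_restrict_space1) simp

lemma L2_leb_mono:
  assumes "A \<in> sets borel" "B \<in> sets borel" "A \<subseteq> B" "u \<in> L2 (leb B)" shows "u \<in> L2 (leb A)"
proof -
  note m = measurable_leb_mono[OF assms(3) L2D(1)[OF assms(4)]]
  have "integrable lborel (\<lambda>z. indicator A z *\<^sub>R (indicator B z *\<^sub>R (cmod (u z))\<^sup>2))"
    using integrable_mult_indicator[OF _ L2D(2)[OF assms(4), unfolded integrable_leb[OF assms(2)]], of A] assms(1) by simp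
  also have "(\<lambda>z. indicator A z *\<^sub>R (indicator B z *\<^sub>R (cmod (u z))\<^sup>2)) = (\<lambda>z. indicator A z *\<^sub>R (cmod (u z))\<^sup>2)"
    using assms(3) by (auto simp: indicator_def fun_eq_iff)
  finally show ?thesis using m assms(1) by (simp add: L2_def integrable_leb)
qed

text \<open>Two measures are involved because a reflection need not map a domain to itself: it
  carries the measure on the preimage of \<open>S\<close> to the one on \<open>S\<close>.\<close>

definition preserves :: "complex measure \<Rightarrow> complex measure \<Rightarrow> (complex \<Rightarrow> complex) \<Rightarrow> bool"
  where "preserves M N T \<longleftrightarrow> T \<in> measurable M N \<and> distr M N T = N"

lemma preserves_integral:
  fixes f :: "complex \<Rightarrow> 'b::{banach, second_countable_topology}"
  assumes "preserves M N T" "f \<in> borel_measurable N"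
  shows "(LINT z|M. f (T z)) = integral\<^sup>L N f"
  using integral_distr[of T M N f] assms by (auto simp: preserves_def)

lemma preserves_integrable:
  fixes f :: "complex \<Rightarrow> 'b::{banach, second_countable_topology}"
  assumes "preserves M N T" "f \<in> borel_measurable N"
  shows "integrable M (\<lambda>z. f (T z)) \<longleftrightarrow> integrable N f"
  using integrable_distr_eq[of T M N f] assms by (auto simp: preserves_def)

lemma preserves_AE:
  assumes "preserves M N T" "AE z in N. P z" shows "AE z in M. P (T z)"
  using assms AE_distrD[of T M N P] unfolding preserves_def by metis

lemma preserves_measurable:
  "preserves M N T \<Longrightarrow> f \<in> borel_measurable N \<Longrightarrow> (\<lambda>z. f (T z)) \<in> borel_measurable M"
  unfolding preserves_def by (auto intro: measurable_compose)

lemma preserves_L2: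
  "preserves M N T \<Longrightarrow> u \<in> L2 N \<Longrightarrow> (\<lambda>z. u (T z)) \<in> L2 M"
  using preserves_integrable[of M N T "\<lambda>z. (cmod (u z))\<^sup>2"]
  by (auto simp: L2_def intro: preserves_measurable)

lemma preserves_L2_norm:
  "preserves M N T \<Longrightarrow> u \<in> borel_measurable N \<Longrightarrow> L2_norm M (\<lambda>z. u (T z)) = L2_norm N u"
  using preserves_integral[of M N T "\<lambda>z. (cmod (u z))\<^sup>2"] by (auto simp: L2_norm_def)

lemma preserves_reflect:
  assumes a: "cmod a = 1" and S[measurable]: "S \<in> sets borel"
  shows "preserves (leb {z. reflect a z \<in> S}) (leb S) (reflect a)"
proof -
  let ?S = "{z. reflect a z \<in> S}"
  have S': "?S \<in> sets borel" using measurable_sets_borel[OF reflect_measurable S] by (simp add: vimage_def)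
  have m: "reflect a \<in> measurable (leb ?S) (leb S)"
    unfolding leb_def by (intro measurable_restrict_space3) auto
  have "distr (leb ?S) (leb S) (reflect a) = leb S"
  proof (rule measure_eqI)
    fix A assume "A \<in> sets (distr (leb ?S) (leb S) (reflect a))"
    then have A: "A \<in> sets (leb S)" and A': "A \<in> sets borel" "A \<subseteq> S" using S by (auto simp: sets_leb)
    have V: "reflect a -` A \<in> sets borel" using measurable_sets_borel[OF reflect_measurable A'(1)] by simp
    have "emeasure (distr (leb ?S) (leb S) (reflect a)) A = emeasure (leb ?S) (reflect a -` A \<inter> ?S)"
      using m A by (simp add: emeasure_distr)
    also have "\<dots> = emeasure lborel (reflect a -` A)"
      using A' S' V by (subst emeasure_leb) (auto simp: sets_leb intro!: arg_cong2[where f = emeasure])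
    also have "\<dots> = emeasure (distr lborel borel (reflect a)) A"
      using A'(1) by (simp add: emeasure_distr)
    also have "\<dots> = emeasure (leb S) A" using A S by (simp add: distr_reflect[OF a] emeasure_leb)
    finally show "emeasure (distr (leb ?S) (leb S) (reflect a)) A = emeasure (leb S) A" .
  qed simp
  with m show ?thesis by (simp add: preserves_def)
qed

section \<open>Smoothness on open sets\<close>

lemma pd_eqI: "(f has_derivative D) (at x) \<Longrightarrow> pd e f x = D e"
  unfolding pd_def using frechet_derivative_at by metis

lemma has_derivative_pd: "f differentiable (at x) \<Longrightarrow> (f has_derivative (\<lambda>e. pd e f x)) (at x)"
  unfolding pd_def by (simp add: frechet_derivative_works[symmetric] eta_contract_eq)

lemma differentiableI_at: "(f has_derivative D) (at x) \<Longrightarrow> f differentiable (at x)"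
  unfolding differentiable_def by blast

text \<open>Derivatives are those of the whole space at points of \<open>S\<close>, not relative to
  \<open>S\<close>. For open \<open>S\<close> the values outside do not matter, which admits
  functions singular elsewhere, such as the potential and the half-angle phase.\<close>

primrec Ck_on :: "nat \<Rightarrow> ('a::euclidean_space \<Rightarrow> 'b::real_normed_vector) \<Rightarrow> 'a set \<Rightarrow> bool"
  where
    "Ck_on 0 f S \<longleftrightarrow> continuous_on S f"
  | "Ck_on (Suc k) f S \<longleftrightarrow> (\<forall>x\<in>S. f differentiable (at x)) \<and> (\<forall>e\<in>Basis. Ck_on k (pd e f) S)"

definition smooth_on :: "('a::euclidean_space \<Rightarrow> 'b::real_normed_vector) \<Rightarrow> 'a set \<Rightarrow> bool"
  where "smooth_on f S \<longleftrightarrow> (\<forall>k. Ck_on k f S)"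

lemma Ck_iff_Ck_on: "Ck k f \<longleftrightarrow> Ck_on k f UNIV"
  by (induction k arbitrary: f) auto

lemma smooth_iff_smooth_on: "smooth f \<longleftrightarrow> smooth_on f UNIV"
  by (simp add: smooth_def smooth_on_def Ck_iff_Ck_on)

lemma Ck_on_cong:
  assumes "open S" "\<And>x. x \<in> S \<Longrightarrow> f x = g x" "Ck_on k g S"
  shows "Ck_on k f S"
  using assms
proof (induction k arbitrary: f g)
  case 0
  then show ?case using continuous_on_cong[of S S f g] by simp
next
  case (Suc k)
  have D: "(f has_derivative (\<lambda>e. pd e g x)) (at x)" if "x \<in> S" for x
  proof (rule has_derivative_transform_within_open[OF has_derivative_pd Suc.prems(1) that])
    show "g differentiable at x" using Suc.prems(3) that by simp
    show "g y = f y" if "y \<in> S" for y using Suc.prems(2)[OF that] by simp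
  qed
  have "Ck_on k (pd e f) S" if "e \<in> Basis" for e
  proof (rule Suc.IH[OF Suc.prems(1)])
    show "pd e f x = pd e g x" if "x \<in> S" for x by (rule pd_eqI[OF D[OF that]])
    show "Ck_on k (pd e g) S" using Suc.prems(3) that by simp
  qed
  then show ?case using D by (auto intro: differentiableI_at)
qed

lemma Ck_onI:
  assumes "open S" and D: "\<And>x. x \<in> S \<Longrightarrow> (f has_derivative D x) (at x)"
    "\<And>e. e \<in> Basis \<Longrightarrow> Ck_on k (\<lambda>x. D x e) S"
  shows "Ck_on (Suc k) f S"
proof -
  have "Ck_on k (pd e f) S" if "e \<in> Basis" for e
    by (rule Ck_on_cong[OF assms(1) _ assms(3)[OF that]]) (rule pd_eqI[OF D(1)])
  then show ?thesis using D by (auto intro: differentiableI_at)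
qed

lemma Ck_on_subset: "Ck_on k f S \<Longrightarrow> T \<subseteq> S \<Longrightarrow> Ck_on k f T"
  by (induction k arbitrary: f) (auto intro: continuous_on_subset)

lemma Ck_on_Un:
  assumes "open S" "open T" "Ck_on k f S" "Ck_on k f T" shows "Ck_on k f (S \<union> T)"
  using assms(3,4) by (induction k arbitrary: f) (use assms(1,2) in \<open>auto intro: continuous_on_open_Un\<close>)

lemma Ck_on_cont: "Ck_on k f S \<Longrightarrow> continuous_on S f"
proof (cases k)
  case (Suc n)
  assume "Ck_on k f S"
  then show ?thesis unfolding Suc
    by (auto intro!: continuous_at_imp_continuous_on differentiable_imp_continuous_within)
qed simp

lemma Ck_on_SucD: "Ck_on (Suc k) f S \<Longrightarrow> Ck_on k f S"
proof (induction k arbitrary: f)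
  case 0 then show ?case using Ck_on_cont[OF 0] by simp
next
  case (Suc k) then show ?case by (metis Ck_on.simps(2))
qed

lemma Ck_on_const: "open S \<Longrightarrow> Ck_on k (\<lambda>x. c) S"
proof (induction k arbitrary: c)
  case (Suc k)
  then show ?case by (intro Ck_onI[where D = "\<lambda>x e. 0"]) auto
qed simp

lemma Ck_on_linear:
  assumes L: "bounded_linear L" and "open S"
  shows "Ck_on k f S \<Longrightarrow> Ck_on k (\<lambda>x. L (f x)) S"
proof (induction k arbitrary: f)
  case 0 then show ?case by (simp add: linear_continuous_on_compose bounded_linear.linear[OF L] bounded_linear.continuous_on[OF L])
next
  case (Suc k)
  then show ?case using \<open>open S\<close>
    by (intro Ck_onI[where D = "\<lambda>x e. L (pd e f x)"] bounded_linear.has_derivative[OF L]) (auto intro: has_derivative_pd)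
qed

lemma Ck_on_ident_linear:
  assumes L: "bounded_linear L" and "open S"
  shows "Ck_on k L S"
proof (cases k)
  case 0 then show ?thesis using bounded_linear.continuous_on[OF L continuous_on_id] by (simp add: id_def)
next
  case (Suc n)
  show ?thesis unfolding Suc
    by (rule Ck_onI[where D = "\<lambda>x. L"])
      (use \<open>open S\<close> in \<open>auto intro!: Ck_on_const bounded_linear_imp_has_derivative[OF L]\<close>)
qed

lemma Ck_on_add: "open S \<Longrightarrow> Ck_on k f S \<Longrightarrow> Ck_on k g S \<Longrightarrow> Ck_on k (\<lambda>x. f x + g x) S"
proof (induction k arbitrary: f g)
  case 0 then show ?case by (simp add: continuous_on_add)
next
  case (Suc k)
  then show ?case
    by (intro Ck_onI[where D = "\<lambda>x e. pd e f x + pd e g x"] has_derivative_add) (auto intro: has_derivative_pd)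
qed

lemma Ck_on_sum:
  assumes "finite I" "open S" "\<And>i. i \<in> I \<Longrightarrow> Ck_on k (f i) S"
  shows "Ck_on k (\<lambda>x. \<Sum>i\<in>I. f i x) S"
  using assms(1,3) by (induction I) (auto intro!: Ck_on_add Ck_on_const assms(2))

lemma Ck_on_bilinear:
  assumes B: "bounded_bilinear B" and S: "open S"
  shows "Ck_on k f S \<Longrightarrow> Ck_on k g S \<Longrightarrow> Ck_on k (\<lambda>x. B (f x) (g x)) S"
proof (induction k arbitrary: f g)
  case 0 then show ?case by (simp add: bounded_bilinear.continuous_on[OF B])
next
  case (Suc k)
  show ?case
  proof (rule Ck_onI[where D = "\<lambda>x e. B (f x) (pd e g x) + B (pd e f x) (g x)"])
    show "((\<lambda>x. B (f x) (g x)) has_derivative (\<lambda>e. B (f x) (pd e g x) + B (pd e f x) (g x))) (at x)" if "x \<in> S" for x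
      using Suc.prems that by (intro bounded_bilinear.FDERIV[OF B] has_derivative_pd) auto
    show "Ck_on k (\<lambda>x. B (f x) (pd e g x) + B (pd e f x) (g x)) S" if "e \<in> Basis" for e
      using Suc.prems that by (intro Ck_on_add S Suc.IH) (auto intro: Ck_on_SucD)
  qed (rule S)
qed

lemma Ck_on_inverse:
  fixes f :: "'a::euclidean_space \<Rightarrow> 'b::real_normed_field"
  assumes S: "open S" and nz: "\<And>x. x \<in> S \<Longrightarrow> f x \<noteq> 0"
  shows "Ck_on k f S \<Longrightarrow> Ck_on k (\<lambda>x. inverse (f x)) S"
proof (induction k)
  case 0 then show ?case by (simp add: continuous_on_inverse nz)
next
  case (Suc k)
  show ?case
  proof (rule Ck_onI[where D = "\<lambda>x e. - (inverse (f x) * pd e f x * inverse (f x))"])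
    show "((\<lambda>x. inverse (f x)) has_derivative (\<lambda>e. - (inverse (f x) * pd e f x * inverse (f x)))) (at x)" if "x \<in> S" for x
      by (rule Deriv.has_derivative_inverse[where f = f, OF nz[OF that] has_derivative_pd]) (use Suc.prems that in auto)
    show "Ck_on k (\<lambda>x. - (inverse (f x) * pd e f x * inverse (f x))) S" if "e \<in> Basis" for e
      using Suc.prems that
      by (intro Ck_on_linear[OF bounded_linear_minus[OF bounded_linear_ident]] S Ck_on_bilinear[OF bounded_bilinear_mult] Suc.IH)
        (auto intro: Ck_on_SucD)
  qed (rule S)
qed

text \<open>Chain rule in coordinates: the derivative is a sum over \<open>Basis\<close> of
  derivatives of \<open>H\<close> times \<open>pd b f\<close> composed with \<open>H\<close>, and
  the induction hypothesis applies to \<open>pd b f\<close> in place of \<open>f\<close>.\<close>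

lemma Ck_on_compose:
  fixes H :: "'a::euclidean_space \<Rightarrow> 'b::euclidean_space"
  assumes S: "open S" and H: "smooth_on H S"
  shows "Ck_on k f UNIV \<Longrightarrow> Ck_on k (\<lambda>x. f (H x)) S"
proof (induction k arbitrary: f)
  case 0 then show ?case
    using H Ck_on_cont[of 0 H S] continuous_on_compose2[of UNIV f S H] by (simp add: smooth_on_def)
next
  case (Suc k)
  have HD: "(H has_derivative (\<lambda>e. pd e H x)) (at x)" if "x \<in> S" for x
  proof -
    have "Ck_on 1 H S" using H by (simp add: smooth_on_def)
    then show ?thesis using that by (intro has_derivative_pd) simp
  qed
  have fD: "(f has_derivative (\<lambda>e. pd e f y)) (at y)" for y
    using Suc.prems by (intro has_derivative_pd) simp
  show ?case
  proof (rule Ck_onI[where D = "\<lambda>x e. \<Sum>b\<in>Basis. (pd e H x \<bullet> b) *\<^sub>R pd b f (H x)"])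
    fix x assume "x \<in> S"
    have "pd (pd e H x) f (H x) = (\<Sum>b\<in>Basis. (pd e H x \<bullet> b) *\<^sub>R pd b f (H x))" for e
    proof -
      interpret linear "\<lambda>e. pd e f (H x)" by (rule has_derivative_linear[OF fD])
      have "pd (pd e H x) f (H x) = pd (\<Sum>b\<in>Basis. (pd e H x \<bullet> b) *\<^sub>R b) f (H x)"
        by (simp add: euclidean_representation)
      then show ?thesis by (simp add: sum scale)
    qed
    then show "((\<lambda>x. f (H x)) has_derivative (\<lambda>e. \<Sum>b\<in>Basis. (pd e H x \<bullet> b) *\<^sub>R pd b f (H x))) (at x)"
      using has_derivative_compose[OF HD[OF \<open>x \<in> S\<close>] fD] by simp
  next
    fix e :: 'a assume e: "e \<in> Basis"
    have "Ck_on k (pd e H) S" using H e unfolding smooth_on_def by (metis Ck_on.simps(2))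
    then show "Ck_on k (\<lambda>x. \<Sum>b\<in>Basis. (pd e H x \<bullet> b) *\<^sub>R pd b f (H x)) S"
      using Suc.prems e
      by (intro Ck_on_sum S Ck_on_bilinear[OF bounded_bilinear_scaleR] Suc.IH
            Ck_on_linear[OF bounded_linear_inner_left]) auto
  qed (rule S)
qed

text \<open>For solutions of a first-order equation, whose derivative is as regular as the function
  itself: regularity climbs one order at a time. The square root, \<open>phase\<close> and
  \<open>half_phase\<close> are treated in this way.\<close>

lemma smooth_on_bootstrap:
  assumes "open S" "\<And>x. x \<in> S \<Longrightarrow> (f has_derivative D x) (at x)"
    "\<And>k e. e \<in> Basis \<Longrightarrow> Ck_on k f S \<Longrightarrow> Ck_on k (\<lambda>x. D x e) S"
  shows "smooth_on f S"
  unfolding smooth_on_def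
proof
  fix k show "Ck_on k f S"
  proof (induction k)
    case 0
    then show ?case using assms(2)
      by (auto intro!: continuous_at_imp_continuous_on has_derivative_continuous)
  next
    case (Suc k)
    show ?case by (rule Ck_onI[OF assms(1,2)]) (use assms(3) Suc in auto)
  qed
qed

lemma smooth_on_cong: "open S \<Longrightarrow> (\<And>x. x \<in> S \<Longrightarrow> f x = g x) \<Longrightarrow> smooth_on g S \<Longrightarrow> smooth_on f S"
  unfolding smooth_on_def using Ck_on_cong by blast

lemma smooth_on_subset: "smooth_on f S \<Longrightarrow> T \<subseteq> S \<Longrightarrow> smooth_on f T"
  unfolding smooth_on_def using Ck_on_subset by blast

lemma smooth_on_Un: "open S \<Longrightarrow> open T \<Longrightarrow> smooth_on f S \<Longrightarrow> smooth_on f T \<Longrightarrow> smooth_on f (S \<union> T)"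
  unfolding smooth_on_def using Ck_on_Un by blast

lemma smooth_on_const: "open S \<Longrightarrow> smooth_on (\<lambda>x. c) S"
  by (simp add: smooth_on_def Ck_on_const)

lemma smooth_on_linear: "bounded_linear L \<Longrightarrow> open S \<Longrightarrow> smooth_on f S \<Longrightarrow> smooth_on (\<lambda>x. L (f x)) S"
  by (simp add: smooth_on_def Ck_on_linear)

lemma smooth_on_ident_linear: "bounded_linear L \<Longrightarrow> open S \<Longrightarrow> smooth_on L S"
  by (simp add: smooth_on_def Ck_on_ident_linear)

lemma smooth_on_add: "open S \<Longrightarrow> smooth_on f S \<Longrightarrow> smooth_on g S \<Longrightarrow> smooth_on (\<lambda>x. f x + g x) S"
  by (simp add: smooth_on_def Ck_on_add)

lemma smooth_on_uminus: "open S \<Longrightarrow> smooth_on f S \<Longrightarrow> smooth_on (\<lambda>x. - f x) S"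
  by (rule smooth_on_linear[OF bounded_linear_minus[OF bounded_linear_ident]])

lemma smooth_on_diff: "open S \<Longrightarrow> smooth_on f S \<Longrightarrow> smooth_on g S \<Longrightarrow> smooth_on (\<lambda>x. f x - g x) S"
  using smooth_on_add[of S f "\<lambda>x. - g x"] by (simp add: smooth_on_uminus)

lemma smooth_on_mult:
  fixes f :: "'a::euclidean_space \<Rightarrow> 'b::real_normed_algebra"
  shows "open S \<Longrightarrow> smooth_on f S \<Longrightarrow> smooth_on g S \<Longrightarrow> smooth_on (\<lambda>x. f x * g x) S"
  by (simp add: smooth_on_def Ck_on_bilinear[OF bounded_bilinear_mult])

lemma smooth_on_inverse:
  fixes f :: "'a::euclidean_space \<Rightarrow> 'b::real_normed_field"
  shows "open S \<Longrightarrow> (\<And>x. x \<in> S \<Longrightarrow> f x \<noteq> 0) \<Longrightarrow> smooth_on f S \<Longrightarrow> smooth_on (\<lambda>x. inverse (f x)) S"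
  by (simp add: smooth_on_def Ck_on_inverse)

lemma smooth_on_compose:
  fixes H :: "'a::euclidean_space \<Rightarrow> 'b::euclidean_space"
  shows "open S \<Longrightarrow> smooth_on H S \<Longrightarrow> smooth_on f UNIV \<Longrightarrow> smooth_on (\<lambda>x. f (H x)) S"
  using Ck_on_compose[of S H] unfolding smooth_on_def by blast

lemma smooth_on_of_real: "open S \<Longrightarrow> smooth_on f S \<Longrightarrow> smooth_on (\<lambda>x. complex_of_real (f x)) S"
  by (rule smooth_on_linear[OF bounded_linear_of_real])

lemma smooth_on_cnj: "open S \<Longrightarrow> smooth_on f S \<Longrightarrow> smooth_on (\<lambda>x. cnj (f x)) S"
  by (rule smooth_on_linear[OF bounded_linear_cnj])

lemma smooth_on_Re: "open S \<Longrightarrow> smooth_on Re S"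
  and smooth_on_Im: "open S \<Longrightarrow> smooth_on Im S"
  by (simp_all add: smooth_on_ident_linear bounded_linear_Re bounded_linear_Im)

lemma smooth_on_pd: "e \<in> Basis \<Longrightarrow> smooth_on f S \<Longrightarrow> smooth_on (pd e f) S"
  unfolding smooth_on_def by (metis Ck_on.simps(2))

lemma smooth_on_differentiable: "smooth_on f S \<Longrightarrow> x \<in> S \<Longrightarrow> f differentiable (at x)"
  unfolding smooth_on_def by (metis Ck_on.simps(2))

lemma smooth_on_has_derivative: "smooth_on f S \<Longrightarrow> x \<in> S \<Longrightarrow> (f has_derivative (\<lambda>e. pd e f x)) (at x)"
  by (intro has_derivative_pd smooth_on_differentiable)

lemma smooth_on_continuous: "smooth_on f S \<Longrightarrow> continuous_on S f"
  unfolding smooth_on_def by (metis Ck_on.simps(1))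

lemma smooth_on_sqrt:
  fixes f :: "'a::euclidean_space \<Rightarrow> real"
  assumes S: "open S" and pos: "\<And>x. x \<in> S \<Longrightarrow> 0 < f x" and f: "smooth_on f S"
  shows "smooth_on (\<lambda>x. sqrt (f x)) S"
proof (rule smooth_on_bootstrap[OF S, where D = "\<lambda>x e. pd e f x * (inverse (sqrt (f x)) * (1/2))"])
  show "((\<lambda>x. sqrt (f x)) has_derivative (\<lambda>e. pd e f x * (inverse (sqrt (f x)) * (1/2)))) (at x)" if "x \<in> S" for x
  proof -
    have "((\<lambda>x. sqrt (f x)) has_derivative (\<lambda>e. (pd e f x) * (inverse (sqrt (f x)) / 2))) (at x)"
      by (rule DERIV_compose_FDERIV[OF DERIV_real_sqrt[OF pos[OF that]] smooth_on_has_derivative[OF f that]])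
    then show ?thesis by simp
  qed
  show "Ck_on k (\<lambda>x. pd e f x * (inverse (sqrt (f x)) * (1/2))) S"
    if "e \<in> Basis" "Ck_on k (\<lambda>x. sqrt (f x)) S" for k e
    using smooth_on_pd[OF that(1) f] that(2) pos S
    by (intro Ck_on_bilinear[OF bounded_bilinear_mult] Ck_on_inverse Ck_on_const)
      (auto simp: smooth_on_def dest: pos)
qed

section \<open>Test functions\<close>

lemma Basis_complex: "(Basis :: complex set) = {1, \<i>}"
  by (rule Basis_complex_def)

lemma test_smooth_on: "\<phi> \<in> test_functions S \<Longrightarrow> smooth_on \<phi> T"
  by (auto simp: test_functions_def smooth_iff_smooth_on intro: smooth_on_subset)

lemma test_compact:
  assumes "\<phi> \<in> test_functions S"
  obtains K where "compact K" "K \<subseteq> S" "\<And>z. z \<notin> K \<Longrightarrow> \<phi> z = 0"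
  by (rule that[of "closure {z. \<phi> z \<noteq> 0}"])
     (use assms closure_subset[of "{z. \<phi> z \<noteq> 0}"] in \<open>auto simp: test_functions_def\<close>)

text \<open>The plane is the union of the open sets \<open>S\<close> and \<open>- K\<close>, and on
  the second the function is 0. Smoothness therefore has to be verified only on \<open>S\<close>,
  even if the formula contains factors that are singular elsewhere.\<close>

lemma test_functionsI:
  assumes "open S" "smooth_on \<phi> S" "compact K" "K \<subseteq> S" "\<And>z. z \<notin> K \<Longrightarrow> \<phi> z = 0"
  shows "\<phi> \<in> test_functions S"
proof -
  have op: "open (- K)" using assms(3) by (simp add: compact_imp_closed open_Compl)
  have "smooth_on \<phi> (- K)"
    by (rule smooth_on_cong[OF op _ smooth_on_const[OF op, of 0]]) (use assms(5) in auto)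
  from smooth_on_Un[OF assms(1) op assms(2) this] have "smooth_on \<phi> UNIV"
    using assms(4) by (metis Un_UNIV_left Un_assoc Un_commute boolean_algebra.disj_cancel_right subset_Un_eq)
  moreover have "closure {z. \<phi> z \<noteq> 0} \<subseteq> K"
    using assms(3,5) by (intro closure_minimal) (auto intro: compact_imp_closed)
  moreover have "compact (closure {z. \<phi> z \<noteq> 0})"
    using calculation(2) assms(3) by (meson bounded_subset compact_closure compact_imp_bounded closure_subset)
  ultimately show ?thesis using assms(4) by (auto simp: test_functions_def smooth_iff_smooth_on)
qed

lemma test_mono: "\<phi> \<in> test_functions S \<Longrightarrow> S \<subseteq> T \<Longrightarrow> \<phi> \<in> test_functions T"
  by (auto simp: test_functions_def)

lemma test_differentiable: "\<phi> \<in> test_functions S \<Longrightarrow> \<phi> differentiable (at x)"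
  using smooth_on_differentiable[OF test_smooth_on, of \<phi> S x UNIV] by simp

lemma test_has_derivative: "\<phi> \<in> test_functions S \<Longrightarrow> (\<phi> has_derivative (\<lambda>e. pd e \<phi> x)) (at x)"
  by (intro has_derivative_pd test_differentiable)

lemma test_mult:
  assumes "open S" "smooth_on c S" "\<phi> \<in> test_functions S"
  shows "(\<lambda>z. c z * \<phi> z) \<in> test_functions S"
proof -
  obtain K where "compact K" "K \<subseteq> S" "\<And>z. z \<notin> K \<Longrightarrow> \<phi> z = 0" by (rule test_compact[OF assms(3)]) blast
  then show ?thesis
    by (intro test_functionsI[OF assms(1) smooth_on_mult[OF assms(1,2) test_smooth_on[OF assms(3)]]]) auto
qed

lemma test_cmult: "open S \<Longrightarrow> \<phi> \<in> test_functions S \<Longrightarrow> (\<lambda>z. c * \<phi> z) \<in> test_functions S"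
  by (rule test_mult) (auto intro: smooth_on_const)

lemma test_add:
  assumes "open S" "\<phi> \<in> test_functions S" "\<psi> \<in> test_functions S"
  shows "(\<lambda>z. \<phi> z + \<psi> z) \<in> test_functions S"
proof -
  obtain K where K: "compact K" "K \<subseteq> S" "\<And>z. z \<notin> K \<Longrightarrow> \<phi> z = 0" by (rule test_compact[OF assms(2)]) blast
  obtain L where L: "compact L" "L \<subseteq> S" "\<And>z. z \<notin> L \<Longrightarrow> \<psi> z = 0" by (rule test_compact[OF assms(3)]) blast
  show ?thesis
    by (rule test_functionsI[OF assms(1) smooth_on_add[OF assms(1) test_smooth_on[OF assms(2)] test_smooth_on[OF assms(3)]]
          compact_Un[OF K(1) L(1)]]) (use K L in auto)
qed

lemma test_uminus: "open S \<Longrightarrow> \<phi> \<in> test_functions S \<Longrightarrow> (\<lambda>z. - \<phi> z) \<in> test_functions S"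
  using test_cmult[of S \<phi> "-1"] by simp

lemma test_diff: "open S \<Longrightarrow> \<phi> \<in> test_functions S \<Longrightarrow> \<psi> \<in> test_functions S \<Longrightarrow> (\<lambda>z. \<phi> z - \<psi> z) \<in> test_functions S"
  using test_add[of S \<phi> "\<lambda>z. - \<psi> z"] by (simp add: test_uminus)

lemma test_cnj:
  assumes "open S" "\<phi> \<in> test_functions S" shows "(\<lambda>z. cnj (\<phi> z)) \<in> test_functions S"
proof -
  obtain K where "compact K" "K \<subseteq> S" "\<And>z. z \<notin> K \<Longrightarrow> \<phi> z = 0" by (rule test_compact[OF assms(2)]) blast
  then show ?thesis
    by (intro test_functionsI[OF assms(1) smooth_on_cnj[OF assms(1) test_smooth_on[OF assms(2)]]]) auto
qed

lemma test_pd: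
  assumes "open S" "\<phi> \<in> test_functions S" "e \<in> Basis" shows "pd e \<phi> \<in> test_functions S"
proof -
  obtain K where K: "compact K" "K \<subseteq> S" "\<And>z. z \<notin> K \<Longrightarrow> \<phi> z = 0" by (rule test_compact[OF assms(2)]) blast
  have "pd e \<phi> z = 0" if "z \<notin> K" for z
  proof -
    have "open (- K)" using K(1) by (simp add: compact_imp_closed open_Compl)
    have "(\<phi> has_derivative (\<lambda>e. 0)) (at z)"
      by (rule has_derivative_transform_within_open[OF has_derivative_const \<open>open (- K)\<close>]) (use that K in auto)
    then show ?thesis by (rule pd_eqI)
  qed
  with K show ?thesis
    by (intro test_functionsI[OF assms(1) smooth_on_pd[OF assms(3) test_smooth_on[OF assms(2)]]]) auto
qed

lemma test_compose:
  assumes "open S" "open T" "\<phi> \<in> test_functions S" "smooth_on H T" "compact K" "K \<subseteq> T" "\<And>z. z \<notin> K \<Longrightarrow> \<phi> (H z) = 0"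
  shows "(\<lambda>z. \<phi> (H z)) \<in> test_functions T"
  by (rule test_functionsI[OF assms(2) smooth_on_compose[OF assms(2,4) test_smooth_on[OF assms(3)]] assms(5,6,7)])

section \<open>Bounds and integration by parts for test functions\<close>

lemma test_continuous: "\<phi> \<in> test_functions S \<Longrightarrow> continuous_on T \<phi>"
  using smooth_on_continuous[OF test_smooth_on] by blast

lemma test_bounded:
  assumes "\<phi> \<in> test_functions S" obtains B where "B \<ge> 0" "\<And>z. cmod (\<phi> z) \<le> B"
proof -
  obtain K where K: "compact K" "K \<subseteq> S" "\<And>z. z \<notin> K \<Longrightarrow> \<phi> z = 0" by (rule test_compact[OF assms]) blast
  have "bounded (\<phi> ` K)"
    by (intro compact_imp_bounded compact_continuous_image K test_continuous[OF assms])
  then obtain B where "B > 0" "\<forall>x\<in>\<phi> ` K. cmod x \<le> B" unfolding bounded_pos by blast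
  have "cmod (\<phi> z) \<le> B" for z
    using \<open>B > 0\<close> \<open>\<forall>x\<in>\<phi> ` K. cmod x \<le> B\<close> K(3)[of z] by (cases "z \<in> K") auto
  then show ?thesis using that[of B] \<open>B > 0\<close> by simp
qed

lemma test_measurable: "\<phi> \<in> test_functions S \<Longrightarrow> \<phi> \<in> borel_measurable borel"
  by (rule borel_measurable_continuous_onI[OF test_continuous])

lemma test_integrable:
  assumes "\<phi> \<in> test_functions S" shows "integrable lborel \<phi>"
proof -
  obtain K where K: "compact K" "K \<subseteq> S" "\<And>z. z \<notin> K \<Longrightarrow> \<phi> z = 0" by (rule test_compact[OF assms]) blast
  have "integrable lborel (\<lambda>z. indicator K z *\<^sub>R \<phi> z)"
    by (rule borel_integrable_compact[OF K(1) test_continuous[OF assms]])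
  also have "(\<lambda>z. indicator K z *\<^sub>R \<phi> z) = \<phi>" using K(3) by (auto simp: indicator_def fun_eq_iff)
  finally show ?thesis .
qed

lemma test_L2:
  assumes "\<phi> \<in> test_functions S" "T \<in> sets borel" shows "\<phi> \<in> L2 (leb T)"
proof -
  \<comment> \<open>The product of a test function and its conjugate is a test function of modulus
    \<open>|\<phi>|^2\<close>, so square integrability reduces to integrability.\<close>
  have "(\<lambda>z. \<phi> z * cnj (\<phi> z)) \<in> test_functions UNIV"
    using assms(1) test_smooth_on[OF assms(1)] test_cnj[of UNIV \<phi>] test_mono[of \<phi> S UNIV] by (intro test_mult) auto
  then have "integrable lborel (\<lambda>z. norm (\<phi> z * cnj (\<phi> z)))" by (intro integrable_norm test_integrable)
  then have "integrable lborel (\<lambda>z. indicator T z *\<^sub>R (cmod (\<phi> z))\<^sup>2)"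
    using assms(2) by (intro integrable_mult_indicator) (auto simp: norm_mult power2_eq_square)
  then show ?thesis
    unfolding L2_def using assms borel_measurable_leb[OF test_measurable[OF assms(1)]] by (simp add: integrable_leb)
qed

lemma test_lipschitz:
  assumes "\<phi> \<in> test_functions S" obtains C where "C \<ge> 0" "\<And>x y. cmod (\<phi> x - \<phi> y) \<le> C * cmod (x - y)"
proof -
  have \<phi>: "\<phi> \<in> test_functions UNIV" using assms by (rule test_mono) simp
  obtain B1 where B1: "B1 \<ge> 0" "\<And>z. cmod (pd 1 \<phi> z) \<le> B1"
    by (rule test_bounded[OF test_pd[OF open_UNIV \<phi>, of 1]]) (auto simp: Basis_complex)
  obtain B2 where B2: "B2 \<ge> 0" "\<And>z. cmod (pd \<i> \<phi> z) \<le> B2"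
    by (rule test_bounded[OF test_pd[OF open_UNIV \<phi>, of \<i>]]) (auto simp: Basis_complex)
  have "cmod (\<phi> x - \<phi> y) \<le> (B1 + B2) * cmod (x - y)" for x y
  proof (rule differentiable_bound[of UNIV \<phi> "\<lambda>x e. pd e \<phi> x"])
    show "(\<phi> has_derivative (\<lambda>e. pd e \<phi> z)) (at z within UNIV)" for z
      using test_has_derivative[OF \<phi>] by simp
    show "onorm (\<lambda>e. pd e \<phi> z) \<le> B1 + B2" for z
    proof (rule onorm_le)
      fix e
      interpret linear "\<lambda>e. pd e \<phi> z" by (rule has_derivative_linear[OF test_has_derivative[OF \<phi>]])
      have e: "e = Re e *\<^sub>R 1 + Im e *\<^sub>R \<i>" by (simp add: complex_eq_iff)
      have "pd e \<phi> z = Re e *\<^sub>R pd 1 \<phi> z + Im e *\<^sub>R pd \<i> \<phi> z"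
        by (subst e, subst add, simp only: scale)
      also have "cmod \<dots> \<le> \<bar>Re e\<bar> * cmod (pd 1 \<phi> z) + \<bar>Im e\<bar> * cmod (pd \<i> \<phi> z)"
        by (rule norm_triangle_le) simp
      also have "\<dots> \<le> cmod e * B1 + cmod e * B2"
        by (intro add_mono mult_mono abs_Re_le_cmod abs_Im_le_cmod B1 B2) auto
      finally show "cmod (pd e \<phi> z) \<le> (B1 + B2) * cmod e" by (simp add: algebra_simps)
    qed
  qed auto
  then show ?thesis using that[of "B1 + B2"] B1 B2 by simp
qed

lemma integral_lborel_translate:
  fixes f :: "'a::euclidean_space \<Rightarrow> 'b::{banach, second_countable_topology}"
  assumes "f \<in> borel_measurable borel"
  shows "(LINT x|lborel. f (c + x)) = (LINT x|lborel. f x)"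
proof -
  have "(LINT x|lborel. f x) = (LINT x|distr lborel borel ((+) c). f x)"
    by (simp only: lborel_distr_plus)
  also have "\<dots> = (LINT x|lborel. f (c + x))" using assms by (intro integral_distr) auto
  finally show ?thesis by simp
qed

lemma integrable_lborel_translate:
  fixes f :: "'a::euclidean_space \<Rightarrow> 'b::{banach, second_countable_topology}"
  assumes "integrable lborel f"
  shows "integrable lborel (\<lambda>x. f (c + x))"
proof -
  have "integrable (distr lborel borel ((+) c)) f" using assms by (simp only: lborel_distr_plus)
  then show ?thesis by (subst (asm) integrable_distr_eq) (use assms in auto)
qed

text \<open>Difference quotients have integral 0 by translation invariance. They converge to the
  derivative under a common bound, the Lipschitz constant on a ball containing the support and its
  shifts.\<close>

lemma integral_pd_eq_0:
  assumes "\<phi> \<in> test_functions S" "e \<in> Basis"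
  shows "(LINT z|lborel. pd e \<phi> z) = 0"
proof -
  have \<phi>: "\<phi> \<in> test_functions UNIV" using assms(1) by (rule test_mono) simp
  obtain K where K: "compact K" "\<And>z. z \<notin> K \<Longrightarrow> \<phi> z = 0" by (rule test_compact[OF \<phi>]) blast
  obtain C where C: "C \<ge> 0" "\<And>x y. cmod (\<phi> x - \<phi> y) \<le> C * cmod (x - y)" by (rule test_lipschitz[OF \<phi>]) blast
  have ne: "cmod e = 1" using assms(2) by auto
  obtain r where r: "K \<subseteq> ball 0 r" using bounded_subset_ballD[OF compact_imp_bounded[OF K(1)], of 0] by blast
  define h where "h n = 1 / real (Suc n)" for n
  have h: "0 < h n" "h n \<le> 1" for n by (auto simp: h_def)
  define q where "q n z = (\<phi> (h n *\<^sub>R e + z) - \<phi> z) /\<^sub>R h n" for n z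
  note [measurable] = test_measurable[OF \<phi>] test_measurable[OF test_pd[OF open_UNIV \<phi> assms(2)]]
  have "(LINT z|lborel. q n z) = 0" for n
    using test_integrable[OF \<phi>] integrable_lborel_translate[OF test_integrable[OF \<phi>], of "h n *\<^sub>R e"]
      integral_lborel_translate[of \<phi> "h n *\<^sub>R e"] unfolding q_def by simp
  moreover have "(\<lambda>n. LINT z|lborel. q n z) \<longlonglongrightarrow> (LINT z|lborel. pd e \<phi> z)"
  \<comment> \<open>The shifts have length \<open>h n <= 1\<close>, hence the radius
    \<open>r + 1\<close>.\<close>
  proof (rule integral_dominated_convergence[where w = "\<lambda>z. C * indicator (ball 0 (r + 1)) z"])
    show "(pd e \<phi>) \<in> borel_measurable lborel" "\<And>n. q n \<in> borel_measurable lborel"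
      unfolding q_def by simp_all
    show "integrable lborel (\<lambda>z::complex. C * indicator (ball 0 (r + 1)) z)"
      using emeasure_lborel_ball_finite[of "0::complex" "r + 1"]
      by (intro integrable_mult_right integrable_real_indicator) auto
    show "AE z in lborel. (\<lambda>n. q n z) \<longlonglongrightarrow> pd e \<phi> z"
    proof (rule AE_I2)
      fix z
      have "((\<lambda>t. (\<phi> (t *\<^sub>R e + z) - \<phi> z) /\<^sub>R t) \<longlongrightarrow> pd e \<phi> z) (at 0)"
      proof -
        have "((\<lambda>t. \<phi> (t *\<^sub>R e + z)) has_derivative (\<lambda>t. pd (t *\<^sub>R e) \<phi> z)) (at 0)"
        proof -
          have 1: "((\<lambda>t. t *\<^sub>R e + z) has_derivative (\<lambda>t. t *\<^sub>R e)) (at 0)"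
            by (auto intro!: derivative_eq_intros)
          have 2: "(\<phi> has_derivative (\<lambda>e. pd e \<phi> z)) (at (0 *\<^sub>R e + z))"
            using test_has_derivative[OF \<phi>] by simp
          from has_derivative_compose[OF 1 2] show ?thesis .
        qed
        moreover have "(\<lambda>t. pd (t *\<^sub>R e) \<phi> z) = (\<lambda>t. t *\<^sub>R pd e \<phi> z)"
          using linear_cmul[OF has_derivative_linear[OF test_has_derivative[OF \<phi>]]] by auto
        ultimately have "((\<lambda>t. norm (\<phi> (t *\<^sub>R e + z) - \<phi> z - t *\<^sub>R pd e \<phi> z) / norm t) \<longlongrightarrow> 0) (at 0)"
          by (simp add: has_derivative_iff_norm)
        then have "((\<lambda>t. norm ((\<phi> (t *\<^sub>R e + z) - \<phi> z) /\<^sub>R t - pd e \<phi> z)) \<longlongrightarrow> 0) (at 0)"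
        proof (rule Lim_transform_eventually)
          show "\<forall>\<^sub>F t in at 0. norm (\<phi> (t *\<^sub>R e + z) - \<phi> z - t *\<^sub>R pd e \<phi> z) / norm t =
             norm ((\<phi> (t *\<^sub>R e + z) - \<phi> z) /\<^sub>R t - pd e \<phi> z)"
          proof (rule eventually_at_filter[THEN iffD2], rule always_eventually, intro allI impI)
            fix t :: real assume "t \<noteq> 0"
            then have "(\<phi> (t *\<^sub>R e + z) - \<phi> z) /\<^sub>R t - pd e \<phi> z = (\<phi> (t *\<^sub>R e + z) - \<phi> z - t *\<^sub>R pd e \<phi> z) /\<^sub>R t"
              by (simp add: scaleR_diff_right)
            then show "norm (\<phi> (t *\<^sub>R e + z) - \<phi> z - t *\<^sub>R pd e \<phi> z) / norm t =
             norm ((\<phi> (t *\<^sub>R e + z) - \<phi> z) /\<^sub>R t - pd e \<phi> z)"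
              by (simp only: norm_scaleR) (simp add: divide_inverse mult.commute)
          qed
        qed
        then show ?thesis by (simp only: tendsto_norm_zero_iff LIM_zero_iff)
      qed
      moreover have "h \<longlonglongrightarrow> 0"
        using LIMSEQ_inverse_real_of_nat unfolding h_def by (simp add: inverse_eq_divide)
      then have "filterlim h (at 0) sequentially"
        unfolding filterlim_at using h by (auto simp: less_imp_neq[symmetric])
      ultimately show "(\<lambda>n. q n z) \<longlonglongrightarrow> pd e \<phi> z"
        unfolding q_def by (rule filterlim_compose)
    qed
    show "AE z in lborel. norm (q n z) \<le> C * indicator (ball 0 (r + 1)) z" for n
    proof (rule AE_I2)
      fix z
      show "norm (q n z) \<le> C * indicator (ball 0 (r + 1)) z"
      proof (cases "z \<in> ball 0 (r + 1)")
        case True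
        have "norm (q n z) \<le> (C * cmod ((h n *\<^sub>R e + z) - z)) / h n"
          using C(2)[of "h n *\<^sub>R e + z" z] h[of n]
          by (simp add: q_def divide_inverse mult.commute mult_left_mono)
        also have "\<dots> = C" using h[of n] ne by simp
        finally show ?thesis using True by simp
      next
        case False
        then have "cmod z \<ge> r + 1" by simp
        moreover have "cmod z \<le> cmod (h n *\<^sub>R e + z) + h n"
          using norm_triangle_ineq4[of "h n *\<^sub>R e + z" "h n *\<^sub>R e"] ne h[of n] by simp
        ultimately have "cmod (h n *\<^sub>R e + z) \<ge> r" "cmod z \<ge> r" using h[of n] by linarith+
        then have "h n *\<^sub>R e + z \<notin> K" "z \<notin> K" using r by (auto dest!: subsetD)
        then show ?thesis using K False by (simp add: q_def)
      qed
    qed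
  qed
  ultimately show ?thesis using LIMSEQ_unique[OF tendsto_const, of 0] by simp
qed

lemma pd_mult:
  fixes f g :: "complex \<Rightarrow> complex"
  shows "f differentiable (at x) \<Longrightarrow> g differentiable (at x) \<Longrightarrow> pd e (\<lambda>z. f z * g z) x = f x * pd e g x + pd e f x * g x"
  by (rule pd_eqI) (intro has_derivative_mult has_derivative_pd)

lemma pd_add:
  "f differentiable (at x) \<Longrightarrow> g differentiable (at x) \<Longrightarrow> pd e (\<lambda>z. f z + g z) x = pd e f x + pd e g x"
  by (rule pd_eqI) (intro has_derivative_add has_derivative_pd)

lemma pd_diff:
  "f differentiable (at x) \<Longrightarrow> g differentiable (at x) \<Longrightarrow> pd e (\<lambda>z. f z - g z) x = pd e f x - pd e g x"
  by (rule pd_eqI) (intro has_derivative_diff has_derivative_pd)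

lemma pd_cnj: "f differentiable (at x) \<Longrightarrow> pd e (\<lambda>z. cnj (f z)) x = cnj (pd e f x)"
  by (rule pd_eqI) (intro has_derivative_cnj has_derivative_pd)

lemma pd_cmult:
  fixes f :: "complex \<Rightarrow> complex"
  shows "f differentiable (at x) \<Longrightarrow> pd e (\<lambda>z. c * f z) x = c * pd e f x"
  by (rule pd_eqI) (intro has_derivative_mult_right has_derivative_pd)

lemma integration_by_parts:
  fixes \<phi> \<psi> :: cfun
  assumes "\<phi> \<in> test_functions S" "\<psi> \<in> test_functions T" "e \<in> Basis"
  shows "(LINT z|lborel. \<phi> z * pd e \<psi> z) = - (LINT z|lborel. pd e \<phi> z * \<psi> z)"
proof -
  have \<phi>: "\<phi> \<in> test_functions UNIV" and \<psi>: "\<psi> \<in> test_functions UNIV" using assms by (auto intro: test_mono)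
  note I = test_integrable[OF test_mult[OF open_UNIV test_smooth_on[of _ UNIV]]]
  have "0 = (LINT z|lborel. pd e (\<lambda>z. \<phi> z * \<psi> z) z)"
    by (rule integral_pd_eq_0[symmetric, OF test_mult[OF open_UNIV test_smooth_on[OF \<phi>] \<psi>] assms(3)])
  also have "\<dots> = (LINT z|lborel. \<phi> z * pd e \<psi> z + pd e \<phi> z * \<psi> z)"
    using test_differentiable[OF \<phi>] test_differentiable[OF \<psi>] by (simp add: pd_mult)
  also have "\<dots> = (LINT z|lborel. \<phi> z * pd e \<psi> z) + (LINT z|lborel. pd e \<phi> z * \<psi> z)"
    by (intro Bochner_Integration.integral_add I[OF \<phi>] I test_pd \<phi> \<psi> open_UNIV assms(3))
  finally show ?thesis by (simp add: eq_neg_iff_add_eq_0)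
qed

section \<open>Cutoff functions\<close>

text \<open>The functions \<open>t^(-n) exp (-1/t)\<close> on the positive axis, continued by 0. The
  derivative of each is a linear combination of others of the family, so that smoothness is an
  induction with \<open>n\<close> arbitrary.\<close>

definition flat :: "nat \<Rightarrow> real \<Rightarrow> real"
  where "flat n t = (if t > 0 then (1 / t) ^ n * exp (- (1 / t)) else 0)"

lemma flat_nonpos [simp]: "t \<le> 0 \<Longrightarrow> flat n t = 0"
  by (simp add: flat_def)

lemma flat_nonneg [simp]: "0 \<le> flat n t"
  by (simp add: flat_def)

text \<open>With \<open>s = 1/t\<close> this compares one term of the exponential series with its
  sum: \<open>s^n / n! <= exp s\<close>.\<close>

lemma flat_le_fact: "flat n t \<le> fact n"
proof (cases "t > 0")
  case True
  define s where "s = 1 / t"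
  have s: "s > 0" using True by (simp add: s_def)
  have "s ^ n /\<^sub>R fact n \<le> exp s"
    using sum_le_suminf[OF sums_summable[OF exp_converges[of s]], of "{n}"] s
    using sums_unique[OF exp_converges[of s]] by simp
  then have "s ^ n * exp (- s) \<le> fact n" by (simp add: exp_minus field_simps)
  with True show ?thesis by (simp add: flat_def s_def)
qed simp

lemma flat_0_le: "flat 0 t \<le> 1"
  using flat_le_fact[of 0 t] by simp

lemma flat_Suc: "t > 0 \<Longrightarrow> t * flat (Suc n) t = flat n t"
  by (simp add: flat_def field_simps)

lemma flat_tendsto_0: "(flat n \<longlongrightarrow> 0) (at 0)"
proof (rule filterlim_split_at)
  show "(flat n \<longlongrightarrow> 0) (at_left 0)"
    by (rule tendsto_eventually) (auto simp: eventually_at_filter)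
  have "((\<lambda>t. (inverse t) ^ n / exp (inverse t)) \<longlongrightarrow> (0::real)) (at_right 0)"
    by (rule filterlim_compose[OF tendsto_power_div_exp_0 filterlim_inverse_at_top_right])
  then show "(flat n \<longlongrightarrow> 0) (at_right 0)"
    by (rule Lim_transform_eventually)
      (auto simp: eventually_at_filter flat_def exp_minus divide_inverse)
qed

lemma flat_has_derivative:
  "(flat n has_real_derivative flat (n + 2) t - real n * flat (n + 1) t) (at t)"
proof -
  consider "t < 0" | "t = 0" | "t > 0" by linarith
  then show ?thesis
  proof cases
    case 1
    have "((\<lambda>t. 0) has_real_derivative 0) (at t)" by simp
    then have "(flat n has_real_derivative 0) (at t)"
      by (rule has_field_derivative_transform_within_open[of _ _ _ "{..<0}"]) (use 1 in auto)
    then show ?thesis using 1 by simp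
  next
    case 2
    \<comment> \<open>The difference quotient at 0 is the member of the family with index
      \<open>n + 1\<close>, which tends to 0.\<close>
    have "((\<lambda>h. flat n h / h) \<longlongrightarrow> 0) (at 0)"
      by (rule Lim_transform_eventually[OF flat_tendsto_0[of "Suc n"]])
        (auto simp: eventually_at_filter flat_def)
    then show ?thesis unfolding 2 by (simp add: DERIV_def)
  next
    case 3
    have "((\<lambda>t. (1 / t) ^ n * exp (- (1 / t))) has_real_derivative flat (n + 2) t - real n * flat (n + 1) t) (at t)"
    proof (cases n)
      case 0
      show ?thesis unfolding 0 using 3
        by (auto intro!: derivative_eq_intros simp: flat_def power2_eq_square)
    next
      case (Suc m)
      show ?thesis unfolding Suc using 3
        by (auto intro!: derivative_eq_intros simp: flat_def field_simps power2_eq_square) (cases m; simp)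
    qed
    then show ?thesis
      by (rule has_field_derivative_transform_within_open[of _ _ _ "{0<..}"]) (use 3 in \<open>auto simp: flat_def\<close>)
  qed
qed

text \<open>A cutoff \<open>flat 0 (n * d)\<close> never reaches 1, but tends to 1 wherever
  \<open>d > 0\<close>. Together with the bound by 1 this is what dominated convergence asks for; no
  plateau is built.\<close>

lemma flat_0_at_top: "(flat 0 \<longlongrightarrow> 1) at_top"
proof -
  have "((\<lambda>t::real. exp (- (inverse t))) \<longlongrightarrow> exp (- 0)) at_top"
    by (intro tendsto_intros tendsto_inverse_0_at_top filterlim_ident)
  then have "((\<lambda>t::real. exp (- (inverse t))) \<longlongrightarrow> 1) at_top" by simp
  then show ?thesis
    by (rule Lim_transform_eventually[OF _ eventually_mono[OF eventually_gt_at_top[of 0]]])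
      (auto simp: flat_def inverse_eq_divide)
qed

lemma flat_Suc_at_top: "(flat (Suc n) \<longlongrightarrow> 0) at_top"
proof -
  have "((\<lambda>t::real. (inverse t) ^ Suc n * exp (- (inverse t))) \<longlongrightarrow> 0 ^ Suc n * exp (- 0)) at_top"
    by (intro tendsto_intros tendsto_inverse_0_at_top filterlim_ident)
  then have "((\<lambda>t::real. (inverse t) ^ Suc n * exp (- (inverse t))) \<longlongrightarrow> 0) at_top" by simp
  then show ?thesis
    by (rule Lim_transform_eventually[OF _ eventually_mono[OF eventually_gt_at_top[of 0]]])
      (auto simp: flat_def inverse_eq_divide)
qed

lemma continuous_on_flat [continuous_intros]:
  "continuous_on S f \<Longrightarrow> continuous_on S (\<lambda>x. flat n (f x))"
  by (rule continuous_on_compose2[of UNIV "flat n"])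
    (auto intro!: continuous_at_imp_continuous_on DERIV_isCont[OF flat_has_derivative])

lemma flat_compose_has_derivative:
  fixes r :: "'a::euclidean_space \<Rightarrow> real"
  assumes "(r has_derivative r') (at x)"
  shows "((\<lambda>x. flat n (r x)) has_derivative (\<lambda>e. r' e * (flat (n + 2) (r x) - real n * flat (n + 1) (r x)))) (at x)"
  using DERIV_compose_FDERIV[OF flat_has_derivative assms] .

lemma smooth_on_flat:
  fixes r :: "'a::euclidean_space \<Rightarrow> real"
  assumes S: "open S" and r: "smooth_on r S"
  shows "smooth_on (\<lambda>x. flat n (r x)) S"
proof -
  have "Ck_on k (\<lambda>x. flat n (r x)) S" for k
  proof (induction k arbitrary: n)
    case 0 then show ?case using smooth_on_continuous[OF r] by (simp add: continuous_on_flat)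
  next
    case (Suc k)
    show ?case
    proof (rule Ck_onI[OF S flat_compose_has_derivative[OF smooth_on_has_derivative[OF r]]])
      fix e :: 'a assume "e \<in> Basis"
      then have "Ck_on k (pd e r) S" using smooth_on_pd[OF _ r] by (simp add: smooth_on_def)
      moreover have "Ck_on k (\<lambda>x. flat (n + 2) (r x) + (- real n) * flat (n + 1) (r x)) S"
        by (intro Ck_on_add Ck_on_linear[OF bounded_linear_mult_right] Suc S)
      ultimately have "Ck_on k (\<lambda>x. pd e r x * (flat (n + 2) (r x) + (- real n) * flat (n + 1) (r x))) S"
        by (intro Ck_on_bilinear[OF bounded_bilinear_mult] S)
      then show "Ck_on k (\<lambda>x. pd e r x * (flat (n + 2) (r x) - real n * flat (n + 1) (r x))) S" by simp
    qed
  qed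
  then show ?thesis by (simp add: smooth_on_def)
qed

lemma set_integral_box_eq_0:
  fixes h :: "'a::euclidean_space \<Rightarrow> 'b::{banach, second_countable_topology}"
  assumes h: "integrable lborel h" and box: "\<And>a b. (LINT z:box a b|lborel. h z) = 0"
    and tot: "(LINT z|lborel. h z) = 0"
  shows "AE z in lborel. h z = 0"
proof (rule sigma_finite_measure.density_zero[OF sigma_finite_lborel h])
  have si: "set_integrable lborel A h" if "A \<in> sets borel" for A
    unfolding set_integrable_def using h that by (intro integrable_mult_indicator) auto
  let ?G = "range (\<lambda>(a, b). box a b :: 'a set)"
  have bor: "sigma_sets UNIV ?G = sets (borel :: 'a measure)"
    using borel_eq_box[where 'a = 'a] by (metis sets_measure_of top_greatest Pow_UNIV)
  have G: "Int_stable ?G" by (auto simp: Int_stable_def box_Int_box)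
  fix A :: "'a set" assume "A \<in> sets lborel"
  then have A: "A \<in> sigma_sets UNIV ?G" by (simp add: bor)
  \<comment> \<open>The boxes are an intersection-stable generator of the Borel sets. Complements
    use the vanishing total integral, disjoint unions countable additivity.\<close>
  show "(LINT z:A|lborel. h z) = 0"
    using G subset_UNIV[of ?G, folded Pow_UNIV] A
  proof (induction rule: sigma_sets_induct_disjoint)
    case (compl A)
    then have A: "A \<in> sets borel" by (simp add: bor)
    have "(LINT z:A \<union> (UNIV - A)|lborel. h z) = (LINT z:A|lborel. h z) + (LINT z:UNIV - A|lborel. h z)"
      using A by (intro set_integral_Un si) auto
    moreover have "(LINT z:A \<union> (UNIV - A)|lborel. h z) = 0"
      using tot by (simp add: set_lebesgue_integral_def)
    ultimately show ?case using compl by simp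
  next
    case (union A)
    then have A: "A i \<in> sets borel" for i by (auto simp: bor)
    have "(LINT z:(\<Union>i. A i)|lborel. h z) = (\<Sum>i. (LINT z:(A i)|lborel. h z))"
      using A union(1) by (intro lebesgue_integral_countable_add si) (auto simp: disjoint_family_on_def)
    then show ?case using union by simp
  qed (use box in \<open>auto simp: set_lebesgue_integral_def\<close>)
qed

text \<open>The indicator of the open box is the limit of products of \<open>flat 0\<close> at
  \<open>n\<close> times the signed distances to the four sides. These products vanish outside the
  box and are test functions of \<open>U\<close>, because the closed box lies in
  \<open>U\<close>.\<close>

lemma set_integral_subbox_eq_0:
  fixes g :: cfun
  assumes U: "open U" and g: "g \<in> L2 (leb U)"
    and test: "\<And>\<phi>. \<phi> \<in> test_functions U \<Longrightarrow> (LINT z|leb U. g z * \<phi> z) = 0"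
    and sub: "cbox a b \<subseteq> U"
  shows "(LINT z:box a b|lborel. g z) = 0"
proof -
  have Ub: "U \<in> sets borel" using U by simp
  define r where "r k n z = (if k = 0 then real n * (Re z - Re a) else if k = 1 then real n * (Re b - Re z)
     else if k = 2 then real n * (Im z - Im a) else real n * (Im b - Im z))" for k :: nat and n :: nat and z :: complex
  have sr: "smooth_on (r k n) UNIV" for k n
    unfolding r_def
    by (cases "k = 0"; cases "k = 1"; cases "k = 2")
      (simp_all, (intro smooth_on_mult smooth_on_diff smooth_on_const smooth_on_Re smooth_on_Im open_UNIV)+)
  define f where "f k n z = complex_of_real (flat 0 (r k n z))" for k n z
  define \<beta> where "\<beta> n z = f 0 n z * (f 1 n z * (f 2 n z * f 3 n z))" for n z
  have zero: "\<beta> n z = 0" if "z \<notin> box a b" for n z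
  proof -
    have "Re z \<le> Re a \<or> Re b \<le> Re z \<or> Im z \<le> Im a \<or> Im b \<le> Im z"
      using that by (auto simp: in_box_complex_iff not_less)
    then show ?thesis
      by (auto simp: \<beta>_def f_def r_def mult_nonneg_nonpos)
  qed
  have \<beta>: "\<beta> n \<in> test_functions U" for n
  proof (rule test_functionsI[OF U _ compact_cbox sub])
    show "smooth_on (\<beta> n) U" unfolding \<beta>_def f_def
      by (intro smooth_on_mult smooth_on_of_real smooth_on_flat U smooth_on_subset[OF sr]) auto
    show "\<beta> n z = 0" if "z \<notin> cbox a b" for z using that zero box_subset_cbox[of a b] by blast
  qed
  have le: "cmod (\<beta> n z) \<le> 1" for n z
    unfolding \<beta>_def f_def norm_mult norm_of_real by (intro mult_le_one) (auto simp: flat_0_le)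
  have lim: "(\<lambda>n. \<beta> n z) \<longlonglongrightarrow> indicator (box a b) z" for z
  proof (cases "z \<in> box a b")
    case True
    have "(\<lambda>n. flat 0 (real n * x)) \<longlonglongrightarrow> 1" if "x > 0" for x
      by (rule filterlim_compose[OF flat_0_at_top])
        (rule filterlim_at_top_mult_tendsto_pos[OF tendsto_const that filterlim_real_sequentially])
    then have "(\<lambda>n. f k n z) \<longlonglongrightarrow> of_real 1" for k
      using True unfolding f_def r_def
      by (intro tendsto_of_real) (cases "k = 0"; cases "k = 1"; cases "k = 2"; simp add: in_box_complex_iff)
    then have "(\<lambda>n. \<beta> n z) \<longlonglongrightarrow> of_real 1 * (of_real 1 * (of_real 1 * of_real 1))"
      unfolding \<beta>_def by (intro tendsto_mult)
    then show ?thesis using True by simp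
  qed (simp add: zero)
  have bU: "box a b \<subseteq> U" using sub box_subset_cbox by blast
  have gi: "integrable (leb U) (\<lambda>z. indicator (box a b) z * g z)"
  proof (rule L2_int[OF _ g])
    have "integrable lborel (\<lambda>z. indicator U z * indicator (box a b) z :: real)"
    proof -
      have "(\<lambda>z. indicator U z * indicator (box a b) z :: real) = indicator (box a b)"
        using bU by (auto simp: indicator_def fun_eq_iff)
      then show ?thesis using emeasure_lborel_box_finite[of a b] by simp
    qed
    moreover have "(cmod (indicator (box a b) z))\<^sup>2 = indicat_real (box a b) z" for z
      by (auto simp: indicator_def)
    ultimately show "(\<lambda>z. indicator (box a b) z) \<in> L2 (leb U)"
      using Ub by (simp add: L2_def integrable_leb borel_measurable_leb)
  qed
  note [measurable] = L2D(1)[OF g]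
  have "(\<lambda>n. LINT z|leb U. g z * \<beta> n z) \<longlonglongrightarrow> (LINT z|leb U. g z * indicator (box a b) z)"
  proof (rule integral_dominated_convergence[where w = "\<lambda>z. cmod (indicator (box a b) z * g z)"])
    show "(\<lambda>z. g z * indicator (box a b) z) \<in> borel_measurable (leb U)"
      using gi by (simp add: mult.commute)
    show "(\<lambda>z. g z * \<beta> n z) \<in> borel_measurable (leb U)" for n
      using borel_measurable_leb[OF test_measurable[OF \<beta>[of n]]] by simp
    show "integrable (leb U) (\<lambda>z. cmod (indicator (box a b) z * g z))" by (rule integrable_norm[OF gi])
    show "AE z in leb U. (\<lambda>n. g z * \<beta> n z) \<longlonglongrightarrow> g z * indicator (box a b) z"
      by (intro AE_I2 tendsto_mult tendsto_const lim)
    show "AE z in leb U. norm (g z * \<beta> n z) \<le> cmod (indicator (box a b) z * g z)" for n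
    proof (rule AE_I2)
      fix z show "norm (g z * \<beta> n z) \<le> cmod (indicator (box a b) z * g z)"
        using le[of n z] zero[of z n] by (cases "z \<in> box a b") (auto simp: norm_mult mult_left_le)
    qed
  qed
  moreover have "(LINT z|leb U. g z * \<beta> n z) = 0" for n by (rule test[OF \<beta>])
  ultimately have "(LINT z|leb U. g z * indicator (box a b) z) = 0"
    using LIMSEQ_unique[OF tendsto_const, of 0] by simp
  also have "(LINT z|leb U. g z * indicator (box a b) z) = (LINT z:box a b|lborel. g z)"
    unfolding integral_leb[OF Ub] set_lebesgue_integral_def
    by (intro Bochner_Integration.integral_cong) (use bU in \<open>auto simp: indicator_def\<close>)
  finally show ?thesis .
qed

text \<open>It yields uniqueness of weak derivatives. \<open>U\<close> is covered by countably many
  closed boxes; on the interior of each, \<open>g\<close> is integrable and its integral over every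
  sub-box vanishes.\<close>

lemma fundamental_lemma:
  fixes g :: cfun
  assumes U: "open U" and g: "g \<in> L2 (leb U)"
    and test: "\<And>\<phi>. \<phi> \<in> test_functions U \<Longrightarrow> (LINT z|leb U. g z * \<phi> z) = 0"
  shows "AE z in leb U. g z = 0"
proof -
  have Ub: "U \<in> sets borel" using U by simp
  obtain \<D> where \<D>: "countable \<D>" "\<D> \<subseteq> Pow U" "\<And>X. X \<in> \<D> \<Longrightarrow> \<exists>a b. X = cbox a b" "\<Union>\<D> = U"
    using open_countable_Union_open_cbox[OF U] by metis
  have "AE z in lborel. z \<in> X \<longrightarrow> g z = 0" if XD: "X \<in> \<D>" for X
  proof -
    obtain a b where X: "X = cbox a b" using \<D>(3)[OF XD] by blast
    have sub: "cbox a b \<subseteq> U" using \<D>(2) XD X by blast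
    define h where "h z = indicator (box a b) z *\<^sub>R g z" for z
    have fin: "finite_measure (leb (box a b))" by (rule finite_measure_leb) auto
    have "g \<in> L2 (leb (box a b))"
      by (rule L2_leb_mono[OF _ Ub _ g]) (use sub box_subset_cbox in auto)
    from L2_norm_1_le(1)[OF fin this] have h: "integrable lborel h"
      unfolding h_def by (subst (asm) integrable_leb) auto
    have "AE z in lborel. h z = 0"
    proof (rule set_integral_box_eq_0[OF h])
      show "(LINT z|lborel. h z) = 0"
        using set_integral_subbox_eq_0[OF U g test sub] unfolding h_def set_lebesgue_integral_def by simp
      fix c d
      let ?l = "\<Sum>i\<in>Basis. max (a\<bullet>i) (c\<bullet>i) *\<^sub>R i" and ?u = "\<Sum>i\<in>Basis. min (b\<bullet>i) (d\<bullet>i) *\<^sub>R i"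
      have "cbox ?l ?u \<subseteq> U" using sub Int_interval[of a b c d] by blast
      from set_integral_subbox_eq_0[OF U g test this]
      have "(LINT z:box a b \<inter> box c d|lborel. g z) = 0" by (simp add: box_Int_box)
      then show "(LINT z:box c d|lborel. h z) = 0"
        unfolding h_def set_lebesgue_integral_def
        by (simp add: indicator_inter_arith mult.commute)
    qed
    moreover have "AE z in lborel. z \<notin> cbox a b - box a b"
      by (rule AE_not_in[OF null_sets_cbox_Diff_box])
    ultimately show ?thesis unfolding X
      by eventually_elim (auto simp: h_def indicator_def split: if_splits)
  qed
  then have "AE z in lborel. \<forall>X\<in>\<D>. z \<in> X \<longrightarrow> g z = 0"
    by (subst AE_ball_countable[OF \<D>(1)]) blast
  then have "AE z in lborel. z \<in> U \<longrightarrow> g z = 0"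
    by eventually_elim (use \<D>(4) in blast)
  then show ?thesis by (simp add: AE_leb[OF Ub])
qed

section \<open>The two operators through the closure of the gradient\<close>

lemma inverse_norm_smooth: "smooth_on (\<lambda>z::complex. inverse ((cmod z)\<^sup>2)) (- {0})"
proof (rule smooth_on_inverse)
  show op: "open (- {0::complex})" by (simp add: open_Compl)
  have "smooth_on (\<lambda>z. Re z * Re z + Im z * Im z) (- {0})"
    by (intro smooth_on_add smooth_on_mult smooth_on_Re smooth_on_Im op)
  then show "smooth_on (\<lambda>z. (cmod z)\<^sup>2) (- {0})"
    by (simp add: cmod_power2 power2_eq_square[of "Re _"] power2_eq_square[of "Im _"])
qed auto

lemma smooth_on_A: "smooth_on A1 (- {0})" "smooth_on A2 (- {0})"
proof -
  have op: "open (- {0::complex})" by (simp add: open_Compl)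
  have *: "smooth_on (\<lambda>z. c * (f z * inverse ((cmod z)\<^sup>2))) (- {0})" if "smooth_on f (- {0})" for c and f :: "complex \<Rightarrow> real"
    by (rule smooth_on_mult[OF op smooth_on_const[OF op] smooth_on_mult[OF op that inverse_norm_smooth]])
  note *[OF smooth_on_Im[OF op], of "- (1/2)"] *[OF smooth_on_Re[OF op], of "1/2"]
  moreover have "A1 = (\<lambda>z. - (1/2) * (Im z * inverse ((cmod z)\<^sup>2)))" "A2 = (\<lambda>z. (1/2) * (Re z * inverse ((cmod z)\<^sup>2)))"
    by (intro ext; simp only: A1_def A2_def divide_inverse mult_minus_left mult_minus_right)+
  ultimately show "smooth_on A1 (- {0})" "smooth_on A2 (- {0})" by simp_all
qed

lemma test_DA:
  assumes "open V" "0 \<notin> V" "\<phi> \<in> test_functions V"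
  shows "DA1 \<phi> \<in> test_functions V" "DA2 \<phi> \<in> test_functions V"
proof -
  have "smooth_on (\<lambda>z. complex_of_real (A1 z)) V" "smooth_on (\<lambda>z. complex_of_real (A2 z)) V"
    using assms(2) by (auto intro!: smooth_on_of_real assms(1) smooth_on_subset[OF smooth_on_A(1)] smooth_on_subset[OF smooth_on_A(2)])
  then show "DA1 \<phi> \<in> test_functions V" "DA2 \<phi> \<in> test_functions V"
    unfolding DA1_def DA2_def using assms
    by (auto intro!: test_diff test_cmult test_uminus test_mult test_pd simp: Basis_complex)
qed

lemma DA_diff:
  assumes "\<phi> \<in> test_functions V" "\<psi> \<in> test_functions V"
  shows "DA1 (\<lambda>z. \<phi> z - \<psi> z) = (\<lambda>z. DA1 \<phi> z - DA1 \<psi> z)" "DA2 (\<lambda>z. \<phi> z - \<psi> z) = (\<lambda>z. DA2 \<phi> z - DA2 \<psi> z)"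
  using test_differentiable[OF assms(1)] test_differentiable[OF assms(2)]
  by (simp_all add: DA1_def DA2_def pd_diff algebra_simps)

lemma inner_leb_test:
  assumes "V \<in> sets borel" "\<psi> \<in> test_functions V"
  shows "L2_inner (leb V) \<phi> \<psi> = (LINT z|lborel. \<phi> z * cnj (\<psi> z))"
proof -
  have "\<psi> z = 0" if "z \<notin> V" for z
    by (rule test_compact[OF assms(2)]) (use that in blast)
  then show ?thesis unfolding L2_inner_def integral_leb[OF assms(1)]
    by (intro Bochner_Integration.integral_cong) (auto simp: indicator_def)
qed

text \<open>Integration by parts changes the sign, and conjugating the factor \<open>- i\<close>
  changes it back; the potential term is symmetric as \<open>A\<close> is real. The general
  \<open>A\<close> serves both components of the potential.\<close>

lemma D_symmetric:
  assumes V: "open V" "0 \<notin> V" and \<phi>: "\<phi> \<in> test_functions V" and \<psi>: "\<psi> \<in> test_functions V"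
    and e: "e \<in> Basis" and A: "smooth_on A V"
  shows "L2_inner (leb V) (\<lambda>z. - \<i> * pd e \<phi> z - of_real (A z) * \<phi> z) \<psi> =
     L2_inner (leb V) \<phi> (\<lambda>z. - \<i> * pd e \<psi> z - of_real (A z) * \<psi> z)"
proof -
  have Vb: "V \<in> sets borel" using V by simp
  have c\<psi>: "(\<lambda>z. cnj (\<psi> z)) \<in> test_functions V" by (rule test_cnj[OF V(1) \<psi>])
  have Am: "(\<lambda>z. of_real (A z) * \<phi> z) \<in> test_functions V"
    by (intro test_mult smooth_on_of_real V A \<phi>)
  have A\<psi>: "(\<lambda>z. of_real (A z) * \<psi> z) \<in> test_functions V"
    by (intro test_mult smooth_on_of_real V A \<psi>)
  note I = test_integrable[OF test_mult[OF V(1) test_smooth_on]]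
  have i1: "integrable lborel (\<lambda>z. pd e \<phi> z * cnj (\<psi> z))"
    by (rule I[OF test_pd[OF V(1) \<phi> e] c\<psi>])
  have i2: "integrable lborel (\<lambda>z. of_real (A z) * \<phi> z * cnj (\<psi> z))"
    by (rule I[OF Am c\<psi>])
  have i3: "integrable lborel (\<lambda>z. \<phi> z * cnj (pd e \<psi> z))"
    by (rule I[OF \<phi> test_cnj[OF V(1) test_pd[OF V(1) \<psi> e]]])
  have "L2_inner (leb V) (\<lambda>z. - \<i> * pd e \<phi> z - of_real (A z) * \<phi> z) \<psi> =
     (LINT z|lborel. - \<i> * (pd e \<phi> z * cnj (\<psi> z)) - of_real (A z) * \<phi> z * cnj (\<psi> z))"
    unfolding inner_leb_test[OF Vb \<psi>] by (simp add: algebra_simps)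
  also have "\<dots> = - \<i> * (LINT z|lborel. pd e \<phi> z * cnj (\<psi> z)) - (LINT z|lborel. of_real (A z) * \<phi> z * cnj (\<psi> z))"
    using i1 i2 by (subst Bochner_Integration.integral_diff) (auto intro: integrable_mult_right)
  also have "(LINT z|lborel. pd e \<phi> z * cnj (\<psi> z)) = - (LINT z|lborel. \<phi> z * cnj (pd e \<psi> z))"
    using integration_by_parts[OF \<phi> c\<psi> e] pd_cnj[OF test_differentiable[OF \<psi>]] by simp
  also have "- \<i> * - (LINT z|lborel. \<phi> z * cnj (pd e \<psi> z)) - (LINT z|lborel. of_real (A z) * \<phi> z * cnj (\<psi> z)) =
     (LINT z|lborel. \<i> * (\<phi> z * cnj (pd e \<psi> z)) - of_real (A z) * \<phi> z * cnj (\<psi> z))"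
    using i3 i2 by (subst Bochner_Integration.integral_diff) (auto intro: integrable_mult_right)
  also have "\<dots> = (LINT z|lborel. \<phi> z * cnj (- \<i> * pd e \<psi> z - of_real (A z) * \<psi> z))"
    by (simp add: algebra_simps)
  also have "\<dots> = L2_inner (leb V) \<phi> (\<lambda>z. - \<i> * pd e \<psi> z - of_real (A z) * \<psi> z)"
    by (rule inner_leb_test[OF Vb, symmetric]) (intro test_diff test_cmult test_pd V \<psi> e A\<psi>)
  finally show ?thesis .
qed

lemma DA_symmetric:
  assumes V: "open V" "0 \<notin> V" and \<phi>: "\<phi> \<in> test_functions V" and \<psi>: "\<psi> \<in> test_functions V"
  shows "L2_inner (leb V) (DA1 \<phi>) \<psi> = L2_inner (leb V) \<phi> (DA1 \<psi>)"
    "L2_inner (leb V) (DA2 \<phi>) \<psi> = L2_inner (leb V) \<phi> (DA2 \<psi>)"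
  using D_symmetric[OF V \<phi> \<psi>, of 1 A1] D_symmetric[OF V \<phi> \<psi>, of \<i> A2] V(2)
  by (auto simp: DA1_def DA2_def Basis_complex intro: smooth_on_subset[OF smooth_on_A(1)] smooth_on_subset[OF smooth_on_A(2)])

text \<open>One use of symmetry on each square turns the second-order expression into a first-order
  form, so that its closure is governed by the graph of \<open>(DA1, DA2)\<close>.\<close>

lemma AB_form:
  assumes V: "open V" "0 \<notin> V" and \<phi>: "\<phi> \<in> test_functions V" and \<psi>: "\<psi> \<in> test_functions V"
  shows "L2_inner (leb V) (AB_expr \<phi>) \<psi> = L2_inner (leb V) (DA1 \<phi>) (DA1 \<psi>) + L2_inner (leb V) (DA2 \<phi>) (DA2 \<psi>)"
proof -
  note T = test_DA[OF V]
  have L: "\<eta> \<in> L2 (leb V)" if "\<eta> \<in> test_functions V" for \<eta>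
    using test_L2[OF that, of V] V(1) by simp
  show ?thesis unfolding AB_expr_def
    by (simp add: L2_inner_add_left L T \<phi> \<psi> DA_symmetric[OF V T(1)[OF \<phi>] \<psi>] DA_symmetric[OF V T(2)[OF \<phi>] \<psi>])
qed

section \<open>Closure of the Aharonov-Bohm form\<close>

context
  fixes V :: "complex set" and M :: "complex measure" and D :: "cfun set"
    and t :: "cfun \<Rightarrow> cfun \<Rightarrow> complex"
  assumes V: "open V" "0 \<notin> V" "bounded V"
  defines "M \<equiv> leb V" and "D \<equiv> test_functions V" and "t \<equiv> (\<lambda>\<phi> \<psi>. L2_inner (leb V) (AB_expr \<phi>) \<psi>)"
begin

lemma test_in_L2: "\<eta> \<in> D \<Longrightarrow> \<eta> \<in> L2 M"
  unfolding D_def M_def using test_L2[of \<eta> V V] V(1) by simp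

lemma DA_in_D: "\<eta> \<in> D \<Longrightarrow> DA1 \<eta> \<in> D" "\<eta> \<in> D \<Longrightarrow> DA2 \<eta> \<in> D"
  unfolding D_def using test_DA[OF V(1,2)] by auto

lemma AB_form_eq: "\<phi> \<in> D \<Longrightarrow> \<psi> \<in> D \<Longrightarrow> t \<phi> \<psi> = L2_inner M (DA1 \<phi>) (DA1 \<psi>) + L2_inner M (DA2 \<phi>) (DA2 \<psi>)"
  unfolding t_def M_def D_def by (rule AB_form[OF V(1,2)])

lemma diff_in_D: "\<phi> \<in> D \<Longrightarrow> \<psi> \<in> D \<Longrightarrow> (\<lambda>z. \<phi> z - \<psi> z) \<in> D"
  unfolding D_def by (rule test_diff[OF V(1)])

lemma AB_form_diff: "\<phi> \<in> D \<Longrightarrow> \<psi> \<in> D \<Longrightarrow> t (\<lambda>z. \<phi> z - \<psi> z) (\<lambda>z. \<phi> z - \<psi> z) =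
    of_real ((L2_norm M (\<lambda>z. DA1 \<phi> z - DA1 \<psi> z))\<^sup>2 + (L2_norm M (\<lambda>z. DA2 \<phi> z - DA2 \<psi> z))\<^sup>2)"
  using DA_diff[of \<phi> V \<psi>] diff_in_D[of \<phi> \<psi>] by (simp add: AB_form_eq L2_inner_self D_def)

text \<open>On a difference the form is the sum of the squared norms of the differences of the
  magnetic derivatives. Cauchy for \<open>t\<close> thus means Cauchy for \<open>DA1\<close> and for
  \<open>DA2\<close>, and completeness supplies the limits.\<close>

lemma form_converges_iff:
  "form_converges M D t \<phi> u \<longleftrightarrow> (\<forall>n. \<phi> n \<in> D) \<and> u \<in> L2 M \<and> (\<lambda>n. L2_norm M (\<lambda>z. \<phi> n z - u z)) \<longlonglongrightarrow> 0 \<and>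
    (\<exists>g\<in>L2 M. \<exists>h\<in>L2 M. (\<lambda>n. L2_norm M (\<lambda>z. DA1 (\<phi> n) z - g z)) \<longlonglongrightarrow> 0 \<and>
       (\<lambda>n. L2_norm M (\<lambda>z. DA2 (\<phi> n) z - h z)) \<longlonglongrightarrow> 0)" (is "?L \<longleftrightarrow> ?R")
proof
  assume L: ?L
  then have D: "\<And>n. \<phi> n \<in> D" unfolding form_converges_def by blast
  have fin: "finite_measure M" unfolding M_def by (rule finite_measure_leb) (use V in auto)
  have C: "\<exists>N. \<forall>m\<ge>N. \<forall>n\<ge>N. (L2_norm M (\<lambda>z. DA1 (\<phi> m) z - DA1 (\<phi> n) z))\<^sup>2 +
      (L2_norm M (\<lambda>z. DA2 (\<phi> m) z - DA2 (\<phi> n) z))\<^sup>2 < e\<^sup>2" if "e > 0" for e :: real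
  proof -
    have "e\<^sup>2 > 0" using that by simp
    with L obtain N where N: "\<forall>m\<ge>N. \<forall>n\<ge>N. cmod (t (\<lambda>z. \<phi> m z - \<phi> n z) (\<lambda>z. \<phi> m z - \<phi> n z)) < e\<^sup>2"
      unfolding form_converges_def by blast
    then show ?thesis by (intro exI[of _ N]) (simp add: AB_form_diff[OF D D] del: of_real_add of_real_power)
  qed
  have C1: "\<exists>N. \<forall>m\<ge>N. \<forall>n\<ge>N. L2_norm M (\<lambda>z. DA1 (\<phi> m) z - DA1 (\<phi> n) z) < e"
   and C2: "\<exists>N. \<forall>m\<ge>N. \<forall>n\<ge>N. L2_norm M (\<lambda>z. DA2 (\<phi> m) z - DA2 (\<phi> n) z) < e" if "e > 0" for e :: real
  proof -
    have *: "a < e \<and> b < e" if "a\<^sup>2 + b\<^sup>2 < e\<^sup>2" for a b :: real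
    proof -
      have "a\<^sup>2 < e\<^sup>2" "b\<^sup>2 < e\<^sup>2" using that zero_le_power2[of a] zero_le_power2[of b] by linarith+
      then show ?thesis using \<open>e > 0\<close> by (auto intro: power2_less_imp_less)
    qed
    from C[OF that] obtain N where N: "\<forall>m\<ge>N. \<forall>n\<ge>N. (L2_norm M (\<lambda>z. DA1 (\<phi> m) z - DA1 (\<phi> n) z))\<^sup>2 +
      (L2_norm M (\<lambda>z. DA2 (\<phi> m) z - DA2 (\<phi> n) z))\<^sup>2 < e\<^sup>2" by blast
    show "\<exists>N. \<forall>m\<ge>N. \<forall>n\<ge>N. L2_norm M (\<lambda>z. DA1 (\<phi> m) z - DA1 (\<phi> n) z) < e"
      "\<exists>N. \<forall>m\<ge>N. \<forall>n\<ge>N. L2_norm M (\<lambda>z. DA2 (\<phi> m) z - DA2 (\<phi> n) z) < e"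
      using N * by blast+
  qed
  obtain g where "g \<in> L2 M" "(\<lambda>n. L2_norm M (\<lambda>z. DA1 (\<phi> n) z - g z)) \<longlonglongrightarrow> 0"
    by (rule L2_complete[OF fin test_in_L2[OF DA_in_D(1)[OF D]] C1])
  moreover obtain h where "h \<in> L2 M" "(\<lambda>n. L2_norm M (\<lambda>z. DA2 (\<phi> n) z - h z)) \<longlonglongrightarrow> 0"
    by (rule L2_complete[OF fin test_in_L2[OF DA_in_D(2)[OF D]] C2])
  ultimately show ?R using L unfolding form_converges_def by blast
next
  assume R: ?R
  then obtain g h where gh: "g \<in> L2 M" "h \<in> L2 M" "(\<lambda>n. L2_norm M (\<lambda>z. DA1 (\<phi> n) z - g z)) \<longlonglongrightarrow> 0"
       "(\<lambda>n. L2_norm M (\<lambda>z. DA2 (\<phi> n) z - h z)) \<longlonglongrightarrow> 0" by blast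
  have D: "\<And>n. \<phi> n \<in> D" using R by blast
  have tri: "L2_norm M (\<lambda>z. x z - y z) \<le> L2_norm M (\<lambda>z. x z - g z) + L2_norm M (\<lambda>z. y z - g z)"
    if "x \<in> L2 M" "y \<in> L2 M" "g \<in> L2 M" for x y g
    using L2_triangle_diff[OF that(1,3,2)] L2_norm_minus_commute[of M g y] by simp
  have "\<exists>N. \<forall>m\<ge>N. \<forall>n\<ge>N. cmod (t (\<lambda>z. \<phi> m z - \<phi> n z) (\<lambda>z. \<phi> m z - \<phi> n z)) < \<epsilon>" if "\<epsilon> > 0" for \<epsilon>
  proof -
    \<comment> \<open>Both norms will be below \<open>2 * e\<close>, and
      \<open>2 * (2 * e)^2 = \<epsilon>\<close>.\<close>
    define e where "e = sqrt (\<epsilon> / 2) / 2"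
    have "e > 0" using that by (simp add: e_def)
    have ee: "(2 * e)\<^sup>2 = \<epsilon> / 2" using that by (simp add: e_def)
    from order_tendstoD(2)[OF gh(3) \<open>e > 0\<close>] order_tendstoD(2)[OF gh(4) \<open>e > 0\<close>]
    obtain N where N: "\<And>n. n \<ge> N \<Longrightarrow> L2_norm M (\<lambda>z. DA1 (\<phi> n) z - g z) < e \<and> L2_norm M (\<lambda>z. DA2 (\<phi> n) z - h z) < e"
      unfolding eventually_sequentially by (metis le_trans linear)
    show ?thesis
    proof (intro exI[of _ N] allI impI)
      fix m n assume "m \<ge> N" "n \<ge> N"
      have "L2_norm M (\<lambda>z. DA1 (\<phi> m) z - DA1 (\<phi> n) z) < 2 * e"
        using tri[OF test_in_L2[OF DA_in_D(1)[OF D]] test_in_L2[OF DA_in_D(1)[OF D]] gh(1), of m n] N[OF \<open>m \<ge> N\<close>] N[OF \<open>n \<ge> N\<close>] by simp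
      moreover have "L2_norm M (\<lambda>z. DA2 (\<phi> m) z - DA2 (\<phi> n) z) < 2 * e"
        using tri[OF test_in_L2[OF DA_in_D(2)[OF D]] test_in_L2[OF DA_in_D(2)[OF D]] gh(2), of m n] N[OF \<open>m \<ge> N\<close>] N[OF \<open>n \<ge> N\<close>] by simp
      ultimately have "(L2_norm M (\<lambda>z. DA1 (\<phi> m) z - DA1 (\<phi> n) z))\<^sup>2 + (L2_norm M (\<lambda>z. DA2 (\<phi> m) z - DA2 (\<phi> n) z))\<^sup>2 < (2*e)\<^sup>2 + (2*e)\<^sup>2"
        by (intro add_strict_mono power_strict_mono) auto
      then show "cmod (t (\<lambda>z. \<phi> m z - \<phi> n z) (\<lambda>z. \<phi> m z - \<phi> n z)) < \<epsilon>"
        unfolding ee by (simp add: AB_form_diff[OF D D] del: of_real_add of_real_power)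
    qed
  qed
  then show ?L using R unfolding form_converges_def by blast
qed

text \<open>All derivatives are moved to a fixed \<open>\<phi> m\<close>. As \<open>\<phi> n\<close>
  tends to 0, the pair \<open>(g, h)\<close> is orthogonal to the magnetic gradient of every
  \<open>\<phi> m\<close>; these gradients tend to \<open>(g, h)\<close>, which is therefore
  orthogonal to itself.\<close>

lemma closable:
  assumes D: "\<And>n. \<phi> n \<in> D" and 0: "(\<lambda>n. L2_norm M (\<phi> n)) \<longlonglongrightarrow> 0"
    and gh: "g \<in> L2 M" "h \<in> L2 M" "(\<lambda>n. L2_norm M (\<lambda>z. DA1 (\<phi> n) z - g z)) \<longlonglongrightarrow> 0"
       "(\<lambda>n. L2_norm M (\<lambda>z. DA2 (\<phi> n) z - h z)) \<longlonglongrightarrow> 0"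
  shows "AE z in M. g z = 0" "AE z in M. h z = 0"
proof -
  note L = test_in_L2[OF D] test_in_L2[OF DA_in_D(1)[OF D]] test_in_L2[OF DA_in_D(2)[OF D]]
  have Z: "L2_inner M g (DA1 (\<phi> m)) + L2_inner M h (DA2 (\<phi> m)) = 0" for m
  proof -
    have "(\<lambda>n. L2_inner M (DA1 (\<phi> n)) (DA1 (\<phi> m)) + L2_inner M (DA2 (\<phi> n)) (DA2 (\<phi> m)))
       \<longlonglongrightarrow> L2_inner M g (DA1 (\<phi> m)) + L2_inner M h (DA2 (\<phi> m))"
      by (intro tendsto_add L2_inner_tendsto gh L) auto
    moreover have "L2_inner M (DA1 (\<phi> n)) (DA1 (\<phi> m)) + L2_inner M (DA2 (\<phi> n)) (DA2 (\<phi> m)) =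
       L2_inner M (\<phi> n) (DA1 (DA1 (\<phi> m))) + L2_inner M (\<phi> n) (DA2 (DA2 (\<phi> m)))" for n
      using DA_symmetric[OF V(1,2)] D DA_in_D unfolding M_def D_def by simp
    moreover have "(\<lambda>n. L2_inner M (\<phi> n) (DA1 (DA1 (\<phi> m))) + L2_inner M (\<phi> n) (DA2 (DA2 (\<phi> m))))
       \<longlonglongrightarrow> L2_inner M (\<lambda>z. 0) (DA1 (DA1 (\<phi> m))) + L2_inner M (\<lambda>z. 0) (DA2 (DA2 (\<phi> m)))"
      by (intro tendsto_add L2_inner_tendsto L L2_zero test_in_L2[OF DA_in_D(1)[OF DA_in_D(1)[OF D]]] test_in_L2[OF DA_in_D(2)[OF DA_in_D(2)[OF D]]])
        (use 0 in auto)
    ultimately show ?thesis using LIMSEQ_unique by (fastforce simp: L2_inner_def)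
  qed
  have "(\<lambda>m. L2_inner M g (DA1 (\<phi> m)) + L2_inner M h (DA2 (\<phi> m))) \<longlonglongrightarrow> L2_inner M g g + L2_inner M h h"
    by (intro tendsto_add L2_inner_tendsto gh L) auto
  then have "L2_inner M g g + L2_inner M h h = 0" unfolding Z by (simp add: LIMSEQ_const_iff)
  then have "complex_of_real ((L2_norm M g)\<^sup>2 + (L2_norm M h)\<^sup>2) = 0" by (simp only: L2_inner_self of_real_add)
  then have "L2_norm M g = 0" "L2_norm M h = 0" by (simp_all only: of_real_eq_0_iff sum_power2_eq_zero_iff)
  then show "AE z in M. g z = 0" "AE z in M. h z = 0" using gh by (simp_all add: L2_norm_eq_0)
qed

lemma form_closure_dom_iff: "u \<in> form_closure_dom M D t \<longleftrightarrow> (\<exists>g h. form_graph M D DA1 DA2 u g h)"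
proof
  assume "u \<in> form_closure_dom M D t"
  then obtain \<phi> where "form_converges M D t \<phi> u" by (auto simp: form_closure_dom_def)
  then obtain g h where "\<And>n. \<phi> n \<in> D" "u \<in> L2 M" "g \<in> L2 M" "h \<in> L2 M"
    "(\<lambda>n. L2_norm M (\<lambda>z. \<phi> n z - u z)) \<longlonglongrightarrow> 0"
    "(\<lambda>n. L2_norm M (\<lambda>z. DA1 (\<phi> n) z - g z)) \<longlonglongrightarrow> 0"
    "(\<lambda>n. L2_norm M (\<lambda>z. DA2 (\<phi> n) z - h z)) \<longlonglongrightarrow> 0"
    unfolding form_converges_iff by auto
  from form_graphI_seq[of \<phi>, OF this] show "\<exists>g h. form_graph M D DA1 DA2 u g h" by blast
next
  assume "\<exists>g h. form_graph M D DA1 DA2 u g h"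
  then obtain g h where g: "form_graph M D DA1 DA2 u g h" by blast
  from form_graph_seq[OF g] obtain \<phi> where "\<And>n. \<phi> n \<in> D"
    "(\<lambda>n. L2_norm M (\<lambda>z. \<phi> n z - u z)) \<longlonglongrightarrow> 0"
    "(\<lambda>n. L2_norm M (\<lambda>z. DA1 (\<phi> n) z - g z)) \<longlonglongrightarrow> 0"
    "(\<lambda>n. L2_norm M (\<lambda>z. DA2 (\<phi> n) z - h z)) \<longlonglongrightarrow> 0" by blast
  then have "form_converges M D t \<phi> u" unfolding form_converges_iff using form_graphD[OF g] by blast
  then show "u \<in> form_closure_dom M D t" by (auto simp: form_closure_dom_def)
qed

text \<open>The difference of two approximating sequences of \<open>u\<close> tends to 0, and
  closability applies to it.\<close>

lemma form_graph_limit_unique: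
  assumes g: "form_graph M D DA1 DA2 u g h" and c: "\<And>n. \<phi> n \<in> D" "(\<lambda>n. L2_norm M (\<lambda>z. \<phi> n z - u z)) \<longlonglongrightarrow> 0"
    and gh: "g' \<in> L2 M" "h' \<in> L2 M" "(\<lambda>n. L2_norm M (\<lambda>z. DA1 (\<phi> n) z - g' z)) \<longlonglongrightarrow> 0"
       "(\<lambda>n. L2_norm M (\<lambda>z. DA2 (\<phi> n) z - h' z)) \<longlonglongrightarrow> 0"
  shows "AE z in M. g' z = g z" "AE z in M. h' z = h z"
proof -
  note gL = form_graphD[OF g]
  from form_graph_seq[OF g] obtain \<psi> where \<psi>: "\<And>n. \<psi> n \<in> D"
    "(\<lambda>n. L2_norm M (\<lambda>z. \<psi> n z - u z)) \<longlonglongrightarrow> 0"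
    "(\<lambda>n. L2_norm M (\<lambda>z. DA1 (\<psi> n) z - g z)) \<longlonglongrightarrow> 0"
    "(\<lambda>n. L2_norm M (\<lambda>z. DA2 (\<psi> n) z - h z)) \<longlonglongrightarrow> 0" by blast
  have *: "(\<lambda>n. L2_norm M (\<lambda>z. (a n z - b n z) - (x z - y z))) \<longlonglongrightarrow> 0"
    if L: "\<And>n. a n \<in> L2 M" "\<And>n. b n \<in> L2 M" "x \<in> L2 M" "y \<in> L2 M"
      and l: "(\<lambda>n. L2_norm M (\<lambda>z. a n z - x z)) \<longlonglongrightarrow> 0" "(\<lambda>n. L2_norm M (\<lambda>z. b n z - y z)) \<longlonglongrightarrow> 0" for a b x y
  proof -
    have s: "(\<lambda>n. L2_norm M (\<lambda>z. a n z - x z) + L2_norm M (\<lambda>z. b n z - y z)) \<longlonglongrightarrow> 0"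
      using tendsto_add[OF l] by simp
    have le: "L2_norm M (\<lambda>z. (a n z - b n z) - (x z - y z)) \<le> L2_norm M (\<lambda>z. a n z - x z) + L2_norm M (\<lambda>z. b n z - y z)" for n
    proof -
      have e: "(\<lambda>z. (a n z - b n z) - (x z - y z)) = (\<lambda>z. (a n z - x z) + (y z - b n z))"
        by (simp add: fun_eq_iff)
      show ?thesis unfolding e L2_norm_minus_commute[of M "b n" y]
        by (rule L2_triangle[OF L2_diff[OF L(1,3)] L2_diff[OF L(4,2)]])
    qed
    show ?thesis
      by (rule Lim_null_comparison[OF always_eventually s]) (use le in simp)
  qed
  note dD = diff_in_D[OF c(1) \<psi>(1)]
  have e: "DA1 (\<lambda>z. \<phi> n z - \<psi> n z) = (\<lambda>z. DA1 (\<phi> n) z - DA1 (\<psi> n) z)"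
    "DA2 (\<lambda>z. \<phi> n z - \<psi> n z) = (\<lambda>z. DA2 (\<phi> n) z - DA2 (\<psi> n) z)" for n
    using DA_diff[of "\<phi> n" V "\<psi> n"] c(1) \<psi>(1) by (auto simp: D_def)
  have 0: "(\<lambda>n. L2_norm M (\<lambda>z. \<phi> n z - \<psi> n z)) \<longlonglongrightarrow> 0"
    using *[OF test_in_L2[OF c(1)] test_in_L2[OF \<psi>(1)] gL(1,1) c(2) \<psi>(2)] by simp
  have 1: "(\<lambda>n. L2_norm M (\<lambda>z. DA1 (\<lambda>z. \<phi> n z - \<psi> n z) z - (g' z - g z))) \<longlonglongrightarrow> 0"
    unfolding e by (rule *[OF test_in_L2[OF DA_in_D(1)[OF c(1)]] test_in_L2[OF DA_in_D(1)[OF \<psi>(1)]] gh(1) gL(2) gh(3) \<psi>(3)])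
  have 2: "(\<lambda>n. L2_norm M (\<lambda>z. DA2 (\<lambda>z. \<phi> n z - \<psi> n z) z - (h' z - h z))) \<longlonglongrightarrow> 0"
    unfolding e by (rule *[OF test_in_L2[OF DA_in_D(2)[OF c(1)]] test_in_L2[OF DA_in_D(2)[OF \<psi>(1)]] gh(2) gL(3) gh(4) \<psi>(4)])
  from closable[OF dD 0 L2_diff[OF gh(1) gL(2)] L2_diff[OF gh(2) gL(3)] 1 2]
  show "AE z in M. g' z = g z" "AE z in M. h' z = h z" by simp_all
qed

text \<open>Here the definite description in \<open>form_closure\<close> receives its value: all
  approximating sequences give the same limit, and as such sequences exist, no other number
  qualifies.\<close>

lemma form_closure_eq:
  assumes g: "form_graph M D DA1 DA2 u g h" and k: "form_graph M D DA1 DA2 v k l"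
  shows "form_closure M D t u v = L2_inner M g k + L2_inner M h l"
proof -
  have lim: "(\<lambda>n. t (\<phi> n) (\<psi> n)) \<longlonglongrightarrow> L2_inner M g k + L2_inner M h l"
    if "form_converges M D t \<phi> u" "form_converges M D t \<psi> v" for \<phi> \<psi>
  proof -
    from that(1)[unfolded form_converges_iff] obtain g' h' where 1: "\<And>n. \<phi> n \<in> D" "(\<lambda>n. L2_norm M (\<lambda>z. \<phi> n z - u z)) \<longlonglongrightarrow> 0"
       "g' \<in> L2 M" "h' \<in> L2 M" "(\<lambda>n. L2_norm M (\<lambda>z. DA1 (\<phi> n) z - g' z)) \<longlonglongrightarrow> 0"
       "(\<lambda>n. L2_norm M (\<lambda>z. DA2 (\<phi> n) z - h' z)) \<longlonglongrightarrow> 0" by blast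
    from that(2)[unfolded form_converges_iff] obtain k' l' where 2: "\<And>n. \<psi> n \<in> D" "(\<lambda>n. L2_norm M (\<lambda>z. \<psi> n z - v z)) \<longlonglongrightarrow> 0"
       "k' \<in> L2 M" "l' \<in> L2 M" "(\<lambda>n. L2_norm M (\<lambda>z. DA1 (\<psi> n) z - k' z)) \<longlonglongrightarrow> 0"
       "(\<lambda>n. L2_norm M (\<lambda>z. DA2 (\<psi> n) z - l' z)) \<longlonglongrightarrow> 0" by blast
    note L = test_in_L2[OF DA_in_D(1)[OF 1(1)]] test_in_L2[OF DA_in_D(2)[OF 1(1)]] test_in_L2[OF DA_in_D(1)[OF 2(1)]] test_in_L2[OF DA_in_D(2)[OF 2(1)]]
    have "(\<lambda>n. L2_inner M (DA1 (\<phi> n)) (DA1 (\<psi> n)) + L2_inner M (DA2 (\<phi> n)) (DA2 (\<psi> n))) \<longlonglongrightarrow> L2_inner M g' k' + L2_inner M h' l'"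
      by (intro tendsto_add L2_inner_tendsto L 1 2)
    moreover have "L2_inner M g' k' = L2_inner M g k" "L2_inner M h' l' = L2_inner M h l"
      using form_graph_limit_unique[OF g 1] form_graph_limit_unique[OF k 2] form_graphD[OF g] form_graphD[OF k] 1(3,4) 2(3,4)
      by (auto intro!: L2_inner_cong_AE dest: L2D(1))
    ultimately show ?thesis using 1(1) 2(1) by (simp add: AB_form_eq)
  qed
  obtain \<phi> \<psi> where e: "form_converges M D t \<phi> u" "form_converges M D t \<psi> v"
    using form_closure_dom_iff[of u] form_closure_dom_iff[of v] g k unfolding form_closure_dom_def by blast
  show ?thesis unfolding form_closure_def
  proof (rule the_equality)
    fix c assume "\<forall>\<phi> \<psi>. form_converges M D t \<phi> u \<longrightarrow> form_converges M D t \<psi> v \<longrightarrow> (\<lambda>n. t (\<phi> n) (\<psi> n)) \<longlonglongrightarrow> c"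
    with e have "(\<lambda>n. t (\<phi> n) (\<psi> n)) \<longlonglongrightarrow> c" by blast
    from LIMSEQ_unique[OF this lim[OF e]] show "c = L2_inner M g k + L2_inner M h l" .
  qed (use lim in blast)
qed

lemma friedrichs_iff:
  "friedrichs M D AB_expr u (\<lambda>z. \<mu> * u z) \<longleftrightarrow> weak_eigen M D DA1 DA2 \<mu> u"
proof -
  have T: "friedrichs M D AB_expr = form_operator M (form_closure_dom M D t) (form_closure M D t)"
    unfolding friedrichs_def Let_def t_def M_def ..
  show ?thesis
  proof
    assume "friedrichs M D AB_expr u (\<lambda>z. \<mu> * u z)"
    then have u: "u \<in> form_closure_dom M D t"
      and E: "\<And>v. v \<in> form_closure_dom M D t \<Longrightarrow> form_closure M D t u v = \<mu> * L2_inner M u v"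
      unfolding T form_operator_def by (auto simp: L2_inner_cmult_left)
    obtain g h where g: "form_graph M D DA1 DA2 u g h" using u unfolding form_closure_dom_iff by blast
    have "L2_inner M g g' + L2_inner M h h' = \<mu> * L2_inner M u v" if "form_graph M D DA1 DA2 v g' h'" for v g' h'
      using E[of v] form_closure_eq[OF g that] that unfolding form_closure_dom_iff by auto
    then show "weak_eigen M D DA1 DA2 \<mu> u" unfolding weak_eigen_def using g by blast
  next
    assume "weak_eigen M D DA1 DA2 \<mu> u"
    then obtain g h where g: "form_graph M D DA1 DA2 u g h"
      and E: "\<And>v g' h'. form_graph M D DA1 DA2 v g' h' \<Longrightarrow> L2_inner M g g' + L2_inner M h h' = \<mu> * L2_inner M u v"
      unfolding weak_eigen_def by blast
    have "form_closure M D t u v = L2_inner M (\<lambda>z. \<mu> * u z) v" if v: "v \<in> form_closure_dom M D t" for v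
    proof -
      obtain g' h' where "form_graph M D DA1 DA2 v g' h'" using v unfolding form_closure_dom_iff by blast
      from form_closure_eq[OF g this] E[OF this] show ?thesis by (simp add: L2_inner_cmult_left)
    qed
    then show "friedrichs M D AB_expr u (\<lambda>z. \<mu> * u z)"
      unfolding T form_operator_def using g form_graphD(1)[OF g] form_closure_dom_iff by (auto intro: L2_cmult)
  qed
qed

end

section \<open>Weak derivatives and the mixed Dirichlet-Neumann form\<close>

lemma form_graph_has_weak_pd:
  assumes U: "open U" and e: "e \<in> Basis" and \<phi>: "\<And>n. \<phi> n \<in> test_functions T" "open T"
    and L: "u \<in> L2 (leb U)" "g \<in> L2 (leb U)"
    and lim: "(\<lambda>n. L2_norm (leb U) (\<lambda>z. \<phi> n z - u z)) \<longlonglongrightarrow> 0"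
      "(\<lambda>n. L2_norm (leb U) (\<lambda>z. pd e (\<phi> n) z - g z)) \<longlonglongrightarrow> 0"
  shows "has_weak_pd U e u g"
  unfolding has_weak_pd_def
proof
  fix \<eta> assume \<eta>: "\<eta> \<in> test_functions U"
  have Ub: "U \<in> sets borel" using U by simp
  \<comment> \<open>\<open>L2_inner\<close> conjugates its second argument whereas weak derivatives
    are tested without conjugation, hence the conjugated test functions.\<close>
  let ?M = "leb U" and ?c = "\<lambda>z. cnj (\<eta> z)" and ?d = "\<lambda>z. cnj (pd e \<eta> z)"
  have c: "?c \<in> test_functions U" and d: "?d \<in> test_functions U"
    by (intro test_cnj test_pd U \<eta> e)+
  have cL: "?c \<in> L2 ?M" "?d \<in> L2 ?M" using test_L2[OF c Ub] test_L2[OF d Ub] .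
  have \<phi>L: "\<phi> n \<in> L2 ?M" "pd e (\<phi> n) \<in> L2 ?M" for n
    using test_L2[OF \<phi>(1) Ub] test_L2[OF test_pd[OF \<phi>(2,1) e] Ub] .
  have z: "(\<lambda>n::nat. L2_norm ?M (\<lambda>z. f z - f z)) \<longlonglongrightarrow> 0" for f by simp
  have "L2_inner ?M (\<phi> n) ?d = - L2_inner ?M (pd e (\<phi> n)) ?c" for n
    using integration_by_parts[OF \<phi>(1) \<eta> e, of n] by (simp add: inner_leb_test[OF Ub c] inner_leb_test[OF Ub d])
  moreover have "(\<lambda>n. L2_inner ?M (\<phi> n) ?d) \<longlonglongrightarrow> L2_inner ?M u ?d"
    by (rule L2_inner_tendsto[OF \<phi>L(1) L(1) lim(1) cL(2) cL(2) z])
  moreover have "(\<lambda>n. - L2_inner ?M (pd e (\<phi> n)) ?c) \<longlonglongrightarrow> - L2_inner ?M g ?c"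
    by (rule tendsto_minus[OF L2_inner_tendsto[OF \<phi>L(2) L(2) lim(2) cL(1) cL(1) z]])
  ultimately have "L2_inner ?M u ?d = - L2_inner ?M g ?c" using LIMSEQ_unique by fastforce
  then show "(LINT z|?M. u z * pd e \<eta> z) = - (LINT z|?M. g z * \<eta> z)" by (simp add: L2_inner_def)
qed

lemma weak_pd_unique:
  assumes U: "open U" and g: "g \<in> L2 (leb U)" "has_weak_pd U e w g" and h: "h \<in> L2 (leb U)" "has_weak_pd U e w h"
  shows "AE z in leb U. g z = h z"
proof -
  have "AE z in leb U. g z - h z = 0"
  proof (rule fundamental_lemma[OF U L2_diff[OF g(1) h(1)]])
    fix \<phi> assume \<phi>: "\<phi> \<in> test_functions U"
    have L: "\<phi> \<in> L2 (leb U)" using test_L2[OF \<phi>] U by simp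
    have "- (LINT z|leb U. g z * \<phi> z) = - (LINT z|leb U. h z * \<phi> z)"
      using bspec[OF g(2)[unfolded has_weak_pd_def] \<phi>] bspec[OF h(2)[unfolded has_weak_pd_def] \<phi>] by (rule trans[OF sym])
    then show "(LINT z|leb U. (g z - h z) * \<phi> z) = 0"
      using L2_int[OF g(1) L] L2_int[OF h(1) L] by (simp add: left_diff_distrib)
  qed
  then show ?thesis by simp
qed

text \<open>The derivative selected by \<open>weak_pd\<close> agrees almost everywhere with any
  explicit one, so the choice never has to be inspected.\<close>

lemma weak_pd_eq:
  assumes U: "open U" and g: "g \<in> L2 (leb U)" "has_weak_pd U e w g"
  shows "weak_pd U e w \<in> L2 (leb U)" "AE z in leb U. weak_pd U e w z = g z"
proof -
  have "weak_pd U e w \<in> L2 (leb U) \<and> has_weak_pd U e w (weak_pd U e w)"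
    unfolding weak_pd_def by (rule someI[of _ g]) (use g in simp)
  then show "weak_pd U e w \<in> L2 (leb U)" "AE z in leb U. weak_pd U e w z = g z"
    using weak_pd_unique[OF U _ _ g] by auto
qed

lemma form_graph_gradient:
  assumes U: "open U" and T: "open T" and gc: "form_graph (leb U) (test_functions T) (pd 1) (pd \<i>) u g h"
  shows "u \<in> H1 U"
    and "weak_pd U 1 u \<in> L2 (leb U)" "AE z in leb U. weak_pd U 1 u z = g z"
    and "weak_pd U \<i> u \<in> L2 (leb U)" "AE z in leb U. weak_pd U \<i> u z = h z"
proof -
  note L = form_graphD[OF gc]
  from form_graph_seq[OF gc] obtain \<phi> where \<phi>: "\<And>n. \<phi> n \<in> test_functions T"
    "(\<lambda>n. L2_norm (leb U) (\<lambda>z. \<phi> n z - u z)) \<longlonglongrightarrow> 0"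
    "(\<lambda>n. L2_norm (leb U) (\<lambda>z. pd 1 (\<phi> n) z - g z)) \<longlonglongrightarrow> 0"
    "(\<lambda>n. L2_norm (leb U) (\<lambda>z. pd \<i> (\<phi> n) z - h z)) \<longlonglongrightarrow> 0" by blast
  have w: "has_weak_pd U 1 u g" "has_weak_pd U \<i> u h"
    using form_graph_has_weak_pd[OF U _ \<phi>(1) T L(1,2) \<phi>(2,3)] form_graph_has_weak_pd[OF U _ \<phi>(1) T L(1,3) \<phi>(2,4)]
    by (auto simp: Basis_complex)
  show "u \<in> H1 U" using L w by (auto simp: H1_def Basis_complex)
  show "weak_pd U 1 u \<in> L2 (leb U)" "AE z in leb U. weak_pd U 1 u z = g z"
    "weak_pd U \<i> u \<in> L2 (leb U)" "AE z in leb U. weak_pd U \<i> u z = h z"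
    using weak_pd_eq[OF U L(2) w(1)] weak_pd_eq[OF U L(3) w(2)] by auto
qed

lemma gradient_form_eq:
  assumes U: "open U" and T: "open T" and gc: "form_graph (leb U) (test_functions T) (pd 1) (pd \<i>) u g h"
    and gc': "form_graph (leb U) (test_functions T) (pd 1) (pd \<i>) v g' h'"
  shows "gradient_form U u v = L2_inner (leb U) g g' + L2_inner (leb U) h h'"
proof -
  note 1 = form_graph_gradient[OF U T gc] and 2 = form_graph_gradient[OF U T gc']
  have "L2_inner (leb U) (weak_pd U 1 u) (weak_pd U 1 v) = L2_inner (leb U) g g'"
    "L2_inner (leb U) (weak_pd U \<i> u) (weak_pd U \<i> v) = L2_inner (leb U) h h'"
    using 1 2 form_graphD[OF gc] form_graphD[OF gc'] by (auto intro!: L2_inner_cong_AE dest: L2D(1))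
  moreover have "(1::complex) \<noteq> \<i>" by (simp add: complex_eq_iff)
  ultimately show ?thesis by (simp add: gradient_form_def Basis_complex)
qed

text \<open>In the definition the derivatives converge to the chosen \<open>weak_pd\<close>. A limit
  pair \<open>(g, h)\<close> obtained otherwise consists of weak derivatives as well, and so agrees
  with it almost everywhere.\<close>

lemma H1_vanishing_iff:
  assumes U: "open U" and C: "closed C"
  shows "u \<in> H1_vanishing U C \<longleftrightarrow> (\<exists>g h. form_graph (leb U) (test_functions (- C)) (pd 1) (pd \<i>) u g h)"
proof
  assume u: "u \<in> H1_vanishing U C"
  then have "u \<in> L2 (leb U)" by (simp add: H1_vanishing_def H1_def)
  moreover have "weak_pd U e u \<in> L2 (leb U)" if "e \<in> Basis" for e
    using u that weak_pd_eq(1)[OF U] unfolding H1_vanishing_def H1_def by blast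
  moreover obtain \<phi> where "\<And>n. \<phi> n \<in> test_functions (- C)" "(\<lambda>n. L2_norm (leb U) (\<lambda>z. \<phi> n z - u z)) \<longlonglongrightarrow> 0"
     "\<And>e. e \<in> Basis \<Longrightarrow> (\<lambda>n. L2_norm (leb U) (\<lambda>z. pd e (\<phi> n) z - weak_pd U e u z)) \<longlonglongrightarrow> 0"
    using u unfolding H1_vanishing_def by blast
  ultimately have "form_graph (leb U) (test_functions (- C)) (pd 1) (pd \<i>) u (weak_pd U 1 u) (weak_pd U \<i> u)"
    by (intro form_graphI_seq[of \<phi>]) (simp_all add: Basis_complex)
  then show "\<exists>g h. form_graph (leb U) (test_functions (- C)) (pd 1) (pd \<i>) u g h" by blast
next
  assume "\<exists>g h. form_graph (leb U) (test_functions (- C)) (pd 1) (pd \<i>) u g h"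
  then obtain g h where gc: "form_graph (leb U) (test_functions (- C)) (pd 1) (pd \<i>) u g h" by blast
  have T: "open (- C)" using C by (simp add: open_Compl)
  have Ub: "U \<in> sets borel" using U by simp
  note G = form_graph_gradient[OF U T gc]
  have gc': "form_graph (leb U) (test_functions (- C)) (pd 1) (pd \<i>) u (weak_pd U 1 u) (weak_pd U \<i> u)"
  proof (rule form_graph_cong_AE[OF gc _ _ G(2) G(4)])
    show "AE z in leb U. g z = weak_pd U 1 u z" "AE z in leb U. h z = weak_pd U \<i> u z" using G(3,5) by auto
    show "\<phi> \<in> L2 (leb U) \<and> pd 1 \<phi> \<in> L2 (leb U) \<and> pd \<i> \<phi> \<in> L2 (leb U)" if "\<phi> \<in> test_functions (- C)" for \<phi>
      using test_L2[OF that Ub] test_L2[OF test_pd[OF T that] Ub] by (simp add: Basis_complex)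
  qed
  from form_graph_seq[OF gc'] obtain \<phi> where "\<And>n. \<phi> n \<in> test_functions (- C)"
    "(\<lambda>n. L2_norm (leb U) (\<lambda>z. \<phi> n z - u z)) \<longlonglongrightarrow> 0"
    "(\<lambda>n. L2_norm (leb U) (\<lambda>z. pd 1 (\<phi> n) z - weak_pd U 1 u z)) \<longlonglongrightarrow> 0"
    "(\<lambda>n. L2_norm (leb U) (\<lambda>z. pd \<i> (\<phi> n) z - weak_pd U \<i> u z)) \<longlonglongrightarrow> 0" by blast
  then show "u \<in> H1_vanishing U C" unfolding H1_vanishing_def using G(1) by (auto simp: Basis_complex)
qed

lemma DN_iff:
  assumes U: "open U" and C: "closed C"
  shows "form_operator (leb U) (H1_vanishing U C) (gradient_form U) u (\<lambda>z. \<mu> * u z) \<longleftrightarrow>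
    weak_eigen (leb U) (test_functions (- C)) (pd 1) (pd \<i>) \<mu> u" (is "?L \<longleftrightarrow> ?R")
proof -
  have T: "open (- C)" using C by (simp add: open_Compl)
  note eq = gradient_form_eq[OF U T] and iff = H1_vanishing_iff[OF U C]
  show ?thesis
  proof
    assume L: ?L
    then obtain g h where g: "form_graph (leb U) (test_functions (- C)) (pd 1) (pd \<i>) u g h"
      unfolding form_operator_def iff by blast
    have "L2_inner (leb U) g g' + L2_inner (leb U) h h' = \<mu> * L2_inner (leb U) u v"
      if "form_graph (leb U) (test_functions (- C)) (pd 1) (pd \<i>) v g' h'" for v g' h'
    proof -
      have "v \<in> H1_vanishing U C" using that iff by blast
      then have "gradient_form U u v = L2_inner (leb U) (\<lambda>z. \<mu> * u z) v" using L unfolding form_operator_def by blast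
      then show ?thesis using eq[OF g that] by (simp add: L2_inner_cmult_left)
    qed
    with g show ?R unfolding weak_eigen_def by blast
  next
    assume ?R
    then obtain g h where g: "form_graph (leb U) (test_functions (- C)) (pd 1) (pd \<i>) u g h"
      and E: "\<And>v g' h'. form_graph (leb U) (test_functions (- C)) (pd 1) (pd \<i>) v g' h' \<Longrightarrow>
        L2_inner (leb U) g g' + L2_inner (leb U) h h' = \<mu> * L2_inner (leb U) u v"
      unfolding weak_eigen_def by blast
    have "gradient_form U u v = L2_inner (leb U) (\<lambda>z. \<mu> * u z) v" if v: "v \<in> H1_vanishing U C" for v
    proof -
      obtain g' h' where v: "form_graph (leb U) (test_functions (- C)) (pd 1) (pd \<i>) v g' h'" using v iff by blast
      show ?thesis using eq[OF g v] E[OF v] by (simp add: L2_inner_cmult_left)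
    qed
    moreover have "u \<in> H1_vanishing U C" using g iff by blast
    ultimately show ?L unfolding form_operator_def using L2_cmult[OF form_graphD(1)[OF g]] by blast
  qed
qed

section \<open>Symmetries\<close>

lemma weak_eigen_L2: "weak_eigen M D P Q \<mu> u \<Longrightarrow> u \<in> L2 M"
  unfolding weak_eigen_def by (blast dest: form_graphD)

text \<open>The equation of \<open>u\<close> is tested with \<open>J' v\<close>, where
  \<open>J'\<close> is adjoint to \<open>J\<close>, also on gradients. Antilinearity conjugates the
  eigenvalue.\<close>

lemma weak_eigen_antilinear:
  assumes "weak_eigen M D P Q \<mu> u"
    and T: "\<And>u g h. form_graph M D P Q u g h \<Longrightarrow> form_graph M' D' P' Q' (J u) (A g h) (B g h)"
    and T': "\<And>v k l. form_graph M' D' P' Q' v k l \<Longrightarrow> form_graph M D P Q (J' v) (A' k l) (B' k l)"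
    and ip: "\<And>u v. u \<in> L2 M \<Longrightarrow> v \<in> L2 M' \<Longrightarrow> L2_inner M' (J u) v = cnj (L2_inner M u (J' v))"
    and ip': "\<And>g h k l. g \<in> L2 M \<Longrightarrow> h \<in> L2 M \<Longrightarrow> k \<in> L2 M' \<Longrightarrow> l \<in> L2 M' \<Longrightarrow>
      L2_inner M' (A g h) k + L2_inner M' (B g h) l = cnj (L2_inner M g (A' k l) + L2_inner M h (B' k l))"
  shows "weak_eigen M' D' P' Q' (cnj \<mu>) (J u)"
proof -
  obtain g h where g: "form_graph M D P Q u g h"
    and E: "\<And>v g' h'. form_graph M D P Q v g' h' \<Longrightarrow> L2_inner M g g' + L2_inner M h h' = \<mu> * L2_inner M u v"
    using assms(1) unfolding weak_eigen_def by blast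
  note gL = form_graphD[OF g]
  have "L2_inner M' (A g h) k + L2_inner M' (B g h) l = cnj \<mu> * L2_inner M' (J u) v"
    if v: "form_graph M' D' P' Q' v k l" for v k l
    using E[OF T'[OF v]] form_graphD[OF v] gL by (simp only: ip ip' complex_cnj_mult)
  then show ?thesis unfolding weak_eigen_def using T[OF g] by blast
qed

text \<open>An adjoint \<open>J'\<close> that respects the form domains, with gradient maps adjoint
  to each other, carries the equation over. Whether \<open>J u\<close> is nonzero is a separate
  question.\<close>

lemma weak_eigen_linear:
  assumes "weak_eigen M D P Q \<mu> u"
    and T: "\<And>u g h. form_graph M D P Q u g h \<Longrightarrow> form_graph M' D' P' Q' (J u) (A g h) (B g h)"
    and T': "\<And>v k l. form_graph M' D' P' Q' v k l \<Longrightarrow> form_graph M D P Q (J' v) (A' k l) (B' k l)"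
    and ip: "\<And>u v. u \<in> L2 M \<Longrightarrow> v \<in> L2 M' \<Longrightarrow> L2_inner M' (J u) v = L2_inner M u (J' v)"
    and ip': "\<And>g h k l. g \<in> L2 M \<Longrightarrow> h \<in> L2 M \<Longrightarrow> k \<in> L2 M' \<Longrightarrow> l \<in> L2 M' \<Longrightarrow>
      L2_inner M' (A g h) k + L2_inner M' (B g h) l = L2_inner M g (A' k l) + L2_inner M h (B' k l)"
  shows "weak_eigen M' D' P' Q' \<mu> (J u)"
proof -
  obtain g h where g: "form_graph M D P Q u g h"
    and E: "\<And>v g' h'. form_graph M D P Q v g' h' \<Longrightarrow> L2_inner M g g' + L2_inner M h h' = \<mu> * L2_inner M u v"
    using assms(1) unfolding weak_eigen_def by blast
  note gL = form_graphD[OF g]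
  have "L2_inner M' (A g h) k + L2_inner M' (B g h) l = \<mu> * L2_inner M' (J u) v"
    if v: "form_graph M' D' P' Q' v k l" for v k l
    using E[OF T'[OF v]] form_graphD[OF v] gL by (simp only: ip ip')
  then show ?thesis unfolding weak_eigen_def using T[OF g] by blast
qed

text \<open>Tested with \<open>u\<close> itself, the equation has a real left side and a positive
  factor at \<open>\<mu>\<close>.\<close>

lemma weak_eigen_real:
  assumes "weak_eigen M D P Q \<mu> u" "\<not> (AE z in M. u z = 0)"
  shows "cnj \<mu> = \<mu>"
proof -
  obtain g h where g: "form_graph M D P Q u g h"
    and E: "\<And>v g' h'. form_graph M D P Q v g' h' \<Longrightarrow> L2_inner M g g' + L2_inner M h h' = \<mu> * L2_inner M u v"
    using assms(1) unfolding weak_eigen_def by blast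
  have n: "(L2_norm M u)\<^sup>2 \<noteq> 0" using L2_norm_eq_0[OF form_graphD(1)[OF g]] assms(2) by simp
  have "complex_of_real ((L2_norm M g)\<^sup>2 + (L2_norm M h)\<^sup>2) = \<mu> * of_real ((L2_norm M u)\<^sup>2)"
    using E[OF g] by (simp only: L2_inner_self of_real_add)
  then have "\<mu> = of_real ((L2_norm M g)\<^sup>2 + (L2_norm M h)\<^sup>2) / of_real ((L2_norm M u)\<^sup>2)"
    using n by (simp add: eq_divide_eq)
  then have "\<mu> = of_real (((L2_norm M g)\<^sup>2 + (L2_norm M h)\<^sup>2) / (L2_norm M u)\<^sup>2)"
    by (simp only: of_real_divide)
  then show ?thesis by (simp only: complex_cnj_complex_of_real)
qed

lemma weak_eigen_add:
  assumes D: "\<And>\<phi> \<psi>. \<phi> \<in> D \<Longrightarrow> \<psi> \<in> D \<Longrightarrow> (\<lambda>z. \<phi> z + \<psi> z) \<in> D \<and> P (\<lambda>z. \<phi> z + \<psi> z) = (\<lambda>z. P \<phi> z + P \<psi> z) \<and>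
      Q (\<lambda>z. \<phi> z + \<psi> z) = (\<lambda>z. Q \<phi> z + Q \<psi> z)"
    and L: "\<And>\<phi>. \<phi> \<in> D \<Longrightarrow> \<phi> \<in> L2 M \<and> P \<phi> \<in> L2 M \<and> Q \<phi> \<in> L2 M"
    and u: "weak_eigen M D P Q \<mu> u" and v: "weak_eigen M D P Q \<mu> v"
  shows "weak_eigen M D P Q \<mu> (\<lambda>z. u z + v z)"
proof -
  obtain g h where g: "form_graph M D P Q u g h"
    and E: "\<And>v g' h'. form_graph M D P Q v g' h' \<Longrightarrow> L2_inner M g g' + L2_inner M h h' = \<mu> * L2_inner M u v"
    using u unfolding weak_eigen_def by blast
  obtain k l where k: "form_graph M D P Q v k l"
    and F: "\<And>w g' h'. form_graph M D P Q w g' h' \<Longrightarrow> L2_inner M k g' + L2_inner M l h' = \<mu> * L2_inner M v w"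
    using v unfolding weak_eigen_def by blast
  note gL = form_graphD[OF g] and kL = form_graphD[OF k]
  have tri: "L2_norm M (\<lambda>z. (a z + b z) - (x z + y z)) < e"
    if "L2_norm M (\<lambda>z. a z - x z) < e / 2" "L2_norm M (\<lambda>z. b z - y z) < e / 2"
      "a \<in> L2 M" "b \<in> L2 M" "x \<in> L2 M" "y \<in> L2 M" for a b x y e
    using L2_triangle[OF L2_diff[OF that(3,5)] L2_diff[OF that(4,6)]] that(1,2) by (simp add: algebra_simps)
  have "form_graph M D P Q (\<lambda>z. u z + v z) (\<lambda>z. g z + k z) (\<lambda>z. h z + l z)"
    unfolding form_graph_def
  proof (intro conjI allI impI L2_add gL kL)
    fix e :: real assume "e > 0"
    then have e2: "e / 2 > 0" by simp
    obtain \<phi> where \<phi>: "\<phi> \<in> D" "L2_norm M (\<lambda>z. \<phi> z - u z) < e / 2" "L2_norm M (\<lambda>z. P \<phi> z - g z) < e / 2" "L2_norm M (\<lambda>z. Q \<phi> z - h z) < e / 2"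
      using g e2 unfolding form_graph_def by blast
    obtain \<psi> where \<psi>: "\<psi> \<in> D" "L2_norm M (\<lambda>z. \<psi> z - v z) < e / 2" "L2_norm M (\<lambda>z. P \<psi> z - k z) < e / 2" "L2_norm M (\<lambda>z. Q \<psi> z - l z) < e / 2"
      using k e2 unfolding form_graph_def by blast
    show "\<exists>\<eta>\<in>D. L2_norm M (\<lambda>z. \<eta> z - (u z + v z)) < e \<and> L2_norm M (\<lambda>z. P \<eta> z - (g z + k z)) < e \<and> L2_norm M (\<lambda>z. Q \<eta> z - (h z + l z)) < e"
      using D[OF \<phi>(1) \<psi>(1)] L[OF \<phi>(1)] L[OF \<psi>(1)] gL kL \<phi> \<psi>
      by (intro bexI[of _ "\<lambda>z. \<phi> z + \<psi> z"] conjI) (simp_all add: tri)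
  qed
  moreover have "L2_inner M (\<lambda>z. g z + k z) g' + L2_inner M (\<lambda>z. h z + l z) h' = \<mu> * L2_inner M (\<lambda>z. u z + v z) w"
    if w: "form_graph M D P Q w g' h'" for w g' h'
    using E[OF w] F[OF w] gL kL form_graphD[OF w] by (simp add: L2_inner_add_left algebra_simps)
  ultimately show ?thesis unfolding weak_eigen_def by blast
qed

lemma weak_eigen_cmult:
  assumes D: "\<And>\<phi>. \<phi> \<in> D \<Longrightarrow> (\<lambda>z. c * \<phi> z) \<in> D \<and> P (\<lambda>z. c * \<phi> z) = (\<lambda>z. c * P \<phi> z) \<and> Q (\<lambda>z. c * \<phi> z) = (\<lambda>z. c * Q \<phi> z)"
    and L: "\<And>\<phi>. \<phi> \<in> D \<Longrightarrow> \<phi> \<in> L2 M \<and> P \<phi> \<in> L2 M \<and> Q \<phi> \<in> L2 M"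
    and u: "weak_eigen M D P Q \<mu> u"
  shows "weak_eigen M D P Q \<mu> (\<lambda>z. c * u z)"
proof -
  obtain g h where g: "form_graph M D P Q u g h"
    and E: "\<And>v g' h'. form_graph M D P Q v g' h' \<Longrightarrow> L2_inner M g g' + L2_inner M h h' = \<mu> * L2_inner M u v"
    using u unfolding weak_eigen_def by blast
  have n: "L2_norm M (\<lambda>z. c * f z - c * f' z) = cmod c * L2_norm M (\<lambda>z. f z - f' z)" for f f'
    unfolding right_diff_distrib[symmetric] by (rule L2_norm_cmult)
  have "form_graph M D P Q (\<lambda>z. c * u z) (\<lambda>z. c * g z) (\<lambda>z. c * h z)"
  proof (rule form_graph_transfer[OF g L L, where J = "\<lambda>u z. c * u z" and A = "\<lambda>g h z. c * g z" and B = "\<lambda>g h z. c * h z" and c = "cmod c"])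
    fix \<phi> assume "\<phi> \<in> D"
    then show "form_graph M D P Q (\<lambda>z. c * \<phi> z) (\<lambda>z. c * P \<phi> z) (\<lambda>z. c * Q \<phi> z)"
      using form_graphI_core[of "\<lambda>z. c * \<phi> z" D M P Q] D[of \<phi>] L[of "\<lambda>z. c * \<phi> z"] by simp
  qed (auto simp: n L2_cmult mult_left_mono)
  moreover have "L2_inner M (\<lambda>z. c * g z) g' + L2_inner M (\<lambda>z. c * h z) h' = \<mu> * L2_inner M (\<lambda>z. c * u z) w"
    if w: "form_graph M D P Q w g' h'" for w g' h'
    using E[OF w] by (simp add: L2_inner_cmult_left algebra_simps flip: distrib_left)
  ultimately show ?thesis unfolding weak_eigen_def by blast
qed

text \<open>A reflection reverses the circulation of the potential and turns the operator for
  \<open>A\<close> into the one for \<open>-A\<close>; so does complex conjugation. Only their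
  combination is a symmetry, and it is antilinear.\<close>

definition conj_refl :: "complex \<Rightarrow> cfun \<Rightarrow> cfun"
  where "conj_refl a u = (\<lambda>z. cnj (u (reflect a z)))"

text \<open>The action of the reflection \<^term>\<open>reflect a\<close> on gradients; the sign is \<open>1\<close> for the gradient and
  \<open>- 1\<close> for the magnetic gradient, whose definition contains a factor \<open>- \<i>\<close>.\<close>

definition refl_grad1 :: "complex \<Rightarrow> complex \<Rightarrow> cfun \<Rightarrow> cfun \<Rightarrow> cfun"
  where "refl_grad1 s a g h = (\<lambda>z. s * cnj (of_real (Re a) * g (reflect a z) + of_real (Im a) * h (reflect a z)))"

definition refl_grad2 :: "complex \<Rightarrow> complex \<Rightarrow> cfun \<Rightarrow> cfun \<Rightarrow> cfun"
  where "refl_grad2 s a g h = (\<lambda>z. s * cnj (of_real (Im a) * g (reflect a z) - of_real (Re a) * h (reflect a z)))"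

lemma reflect_vimage_borel: "V \<in> sets borel \<Longrightarrow> {z. reflect a z \<in> V} \<in> sets borel"
  using measurable_sets_borel[OF reflect_measurable] by (simp add: vimage_def)

lemma preserves_reflect':
  assumes a: "cmod a = 1" and V: "V \<in> sets borel"
  shows "preserves (leb V) (leb {z. reflect a z \<in> V}) (reflect a)"
  using preserves_reflect[OF a reflect_vimage_borel[OF V, of a]] a by simp

lemma L2_norm_cnj [simp]: "L2_norm M (\<lambda>z. cnj (u z)) = L2_norm M u"
  by (simp add: L2_norm_def)

text \<open>The common shape of three maps: coefficients \<open>(1, 0)\<close> give
  \<open>conj_refl\<close>, and the rows of the reflection matrix, with entries of modulus at most
  1, give the two components of the gradient.\<close>

lemma refl_bound:
  assumes p: "preserves M' M T" and s: "cmod s = 1" and x: "\<bar>x\<bar> \<le> 1" and y: "\<bar>y\<bar> \<le> 1"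
    and L: "f \<in> L2 M" "f' \<in> L2 M" "k \<in> L2 M" "k' \<in> L2 M"
  shows "(\<lambda>z. s * cnj (of_real x * f (T z) + of_real y * k (T z))) \<in> L2 M' \<and>
    L2_norm M' (\<lambda>z. s * cnj (of_real x * f (T z) + of_real y * k (T z)) - s * cnj (of_real x * f' (T z) + of_real y * k' (T z)))
      \<le> 1 * (L2_norm M (\<lambda>z. f z - f' z) + L2_norm M (\<lambda>z. k z - k' z))"
proof
  show "(\<lambda>z. s * cnj (of_real x * f (T z) + of_real y * k (T z))) \<in> L2 M'"
    by (intro L2_intros preserves_L2[OF p] L)
  let ?F = "\<lambda>z. f z - f' z" and ?K = "\<lambda>z. k z - k' z"
  have F: "?F \<in> L2 M" and K: "?K \<in> L2 M" using L by (auto intro: L2_diff)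
  have e: "(\<lambda>z. s * cnj (of_real x * f (T z) + of_real y * k (T z)) - s * cnj (of_real x * f' (T z) + of_real y * k' (T z))) =
     (\<lambda>z. s * cnj (of_real x * ?F (T z) + of_real y * ?K (T z)))"
    by (auto simp: algebra_simps)
  have "L2_norm M' (\<lambda>z. s * cnj (of_real x * ?F (T z) + of_real y * ?K (T z))) =
     L2_norm M' (\<lambda>z. of_real x * ?F (T z) + of_real y * ?K (T z))"
    unfolding L2_norm_cmult s L2_norm_cnj by simp
  also have "\<dots> \<le> L2_norm M' (\<lambda>z. of_real x * ?F (T z)) + L2_norm M' (\<lambda>z. of_real y * ?K (T z))"
    using preserves_L2[OF p F] preserves_L2[OF p K] by (intro L2_triangle L2_cmult)
  also have "\<dots> = \<bar>x\<bar> * L2_norm M ?F + \<bar>y\<bar> * L2_norm M ?K"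
    unfolding L2_norm_cmult norm_of_real using preserves_L2_norm[OF p L2D(1)[OF F]] preserves_L2_norm[OF p L2D(1)[OF K]] by simp
  also have "\<dots> \<le> 1 * L2_norm M ?F + 1 * L2_norm M ?K"
    by (intro add_mono mult_right_mono x y) auto
  finally show "L2_norm M' (\<lambda>z. s * cnj (of_real x * f (T z) + of_real y * k (T z)) - s * cnj (of_real x * f' (T z) + of_real y * k' (T z)))
      \<le> 1 * (L2_norm M ?F + L2_norm M ?K)" unfolding e by simp
qed

lemma refl_gclos:
  assumes a: "cmod a = 1" and s: "cmod s = 1" and V: "V \<in> sets borel"
    and gc: "form_graph (leb V) D P Q u g h"
    and D: "\<And>\<phi>. \<phi> \<in> D \<Longrightarrow> \<phi> \<in> L2 (leb V) \<and> P \<phi> \<in> L2 (leb V) \<and> Q \<phi> \<in> L2 (leb V)"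
    and D': "\<And>\<phi>. \<phi> \<in> D' \<Longrightarrow> \<phi> \<in> L2 (leb {z. reflect a z \<in> V}) \<and> P' \<phi> \<in> L2 (leb {z. reflect a z \<in> V}) \<and> Q' \<phi> \<in> L2 (leb {z. reflect a z \<in> V})"
    and core: "\<And>\<phi>. \<phi> \<in> D \<Longrightarrow> conj_refl a \<phi> \<in> D' \<and> P' (conj_refl a \<phi>) = refl_grad1 s a (P \<phi>) (Q \<phi>) \<and> Q' (conj_refl a \<phi>) = refl_grad2 s a (P \<phi>) (Q \<phi>)"
  shows "form_graph (leb {z. reflect a z \<in> V}) D' P' Q' (conj_refl a u) (refl_grad1 s a g h) (refl_grad2 s a g h)"
proof (rule form_graph_transfer[OF gc D D', where J = "conj_refl a" and A = "refl_grad1 s a" and B = "refl_grad2 s a" and c = 1])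
  note p = preserves_reflect[OF a V]
  have R: "\<bar>Re a\<bar> \<le> 1" "\<bar>Im a\<bar> \<le> 1" "\<bar>- Re a\<bar> \<le> 1" "\<bar>0::real\<bar> \<le> 1" "\<bar>1::real\<bar> \<le> 1"
    using abs_Re_le_cmod[of a] abs_Im_le_cmod[of a] a by auto
  show "conj_refl a f \<in> L2 (leb {z. reflect a z \<in> V}) \<and> L2_norm (leb {z. reflect a z \<in> V}) (\<lambda>z. conj_refl a f z - conj_refl a f' z) \<le> 1 * L2_norm (leb V) (\<lambda>z. f z - f' z)"
    if "f \<in> L2 (leb V)" "f' \<in> L2 (leb V)" for f f'
    using refl_bound[OF p _ R(5) R(4) that L2_zero L2_zero, of 1] by (simp add: conj_refl_def)
  show "refl_grad1 s a f k \<in> L2 (leb {z. reflect a z \<in> V}) \<and> L2_norm (leb {z. reflect a z \<in> V}) (\<lambda>z. refl_grad1 s a f k z - refl_grad1 s a f' k' z)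
      \<le> 1 * (L2_norm (leb V) (\<lambda>z. f z - f' z) + L2_norm (leb V) (\<lambda>z. k z - k' z))"
    if "f \<in> L2 (leb V)" "f' \<in> L2 (leb V)" "k \<in> L2 (leb V)" "k' \<in> L2 (leb V)" for f f' k k'
    using refl_bound[OF p s R(1,2) that] by (simp only: refl_grad1_def)
  show "refl_grad2 s a f k \<in> L2 (leb {z. reflect a z \<in> V}) \<and> L2_norm (leb {z. reflect a z \<in> V}) (\<lambda>z. refl_grad2 s a f k z - refl_grad2 s a f' k' z)
      \<le> 1 * (L2_norm (leb V) (\<lambda>z. f z - f' z) + L2_norm (leb V) (\<lambda>z. k z - k' z))"
    if "f \<in> L2 (leb V)" "f' \<in> L2 (leb V)" "k \<in> L2 (leb V)" "k' \<in> L2 (leb V)" for f f' k k'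
    using refl_bound[OF p s R(2,3) that] by (simp only: refl_grad2_def of_real_minus mult_minus_left add_uminus_conv_diff)
  show "form_graph (leb {z. reflect a z \<in> V}) D' P' Q' (conj_refl a \<phi>) (refl_grad1 s a (P \<phi>) (Q \<phi>)) (refl_grad2 s a (P \<phi>) (Q \<phi>))" if "\<phi> \<in> D" for \<phi>
    using core[OF that] form_graphI_core[of "conj_refl a \<phi>" D' _ P' Q'] D'[of "conj_refl a \<phi>"] by simp
qed

lemma conj_refl_L2: "cmod a = 1 \<Longrightarrow> V \<in> sets borel \<Longrightarrow> u \<in> L2 (leb V) \<Longrightarrow> conj_refl a u \<in> L2 (leb {z. reflect a z \<in> V})"
  unfolding conj_refl_def by (intro L2_cnj preserves_L2[OF preserves_reflect])

lemma conj_refl_L2': "cmod a = 1 \<Longrightarrow> V \<in> sets borel \<Longrightarrow> u \<in> L2 (leb {z. reflect a z \<in> V}) \<Longrightarrow> conj_refl a u \<in> L2 (leb V)"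
  unfolding conj_refl_def by (intro L2_cnj preserves_L2[OF preserves_reflect'])

lemma conj_refl_inner:
  assumes a: "cmod a = 1" and V: "V \<in> sets borel" and u: "u \<in> L2 (leb V)" and v: "v \<in> L2 (leb {z. reflect a z \<in> V})"
  shows "L2_inner (leb {z. reflect a z \<in> V}) (conj_refl a u) v = cnj (L2_inner (leb V) u (conj_refl a v))"
proof -
  have "L2_inner (leb {z. reflect a z \<in> V}) (conj_refl a u) v = (LINT z|leb {z. reflect a z \<in> V}. (\<lambda>w. cnj (u w) * cnj (v (reflect a w))) (reflect a z))"
    using a by (simp add: L2_inner_def conj_refl_def)
  also have "\<dots> = (LINT w|leb V. cnj (u w) * cnj (v (reflect a w)))"
    by (rule preserves_integral[OF preserves_reflect[OF a V]])
      (intro borel_measurable_times borel_measurable_cnj L2D(1)[OF u] preserves_measurable[OF preserves_reflect'[OF a V] L2D(1)[OF v]])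
  also have "\<dots> = cnj (LINT w|leb V. u w * v (reflect a w))"
    by (simp flip: Bochner_Integration.integral_cnj)
  finally show ?thesis by (simp add: L2_inner_def conj_refl_def)
qed

lemma refl_grad_eq: "refl_grad1 s a g h = (\<lambda>z. s * (of_real (Re a) * conj_refl a g z + of_real (Im a) * conj_refl a h z))"
  "refl_grad2 s a g h = (\<lambda>z. s * (of_real (Im a) * conj_refl a g z - of_real (Re a) * conj_refl a h z))"
  by (auto simp: refl_grad1_def refl_grad2_def conj_refl_def)

text \<open>The matrix with rows \<open>(Re a, Im a)\<close> and \<open>(Im a, - Re a)\<close> is
  symmetric and \<open>s\<close> is real, so the action on gradients is its own adjoint in the
  antilinear sense.\<close>

lemma refl_grad_inner:
  assumes a: "cmod a = 1" and V: "V \<in> sets borel" and s: "cnj s = s"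
    and L: "g \<in> L2 (leb V)" "h \<in> L2 (leb V)" "k \<in> L2 (leb {z. reflect a z \<in> V})" "l \<in> L2 (leb {z. reflect a z \<in> V})"
  shows "L2_inner (leb {z. reflect a z \<in> V}) (refl_grad1 s a g h) k + L2_inner (leb {z. reflect a z \<in> V}) (refl_grad2 s a g h) l =
    cnj (L2_inner (leb V) g (refl_grad1 s a k l) + L2_inner (leb V) h (refl_grad2 s a k l))"
proof -
  let ?M = "leb V" and ?N = "leb {z. reflect a z \<in> V}"
  note C = conj_refl_L2[OF a V L(1)] conj_refl_L2[OF a V L(2)] conj_refl_L2'[OF a V L(3)] conj_refl_L2'[OF a V L(4)]
  have 1: "L2_inner ?N (refl_grad1 s a g h) k = s * (of_real (Re a) * L2_inner ?N (conj_refl a g) k + of_real (Im a) * L2_inner ?N (conj_refl a h) k)"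
    "L2_inner ?N (refl_grad2 s a g h) l = s * (of_real (Im a) * L2_inner ?N (conj_refl a g) l - of_real (Re a) * L2_inner ?N (conj_refl a h) l)"
    unfolding refl_grad_eq using C L by (simp_all add: L2_inner_cmult_left L2_inner_add_left L2_inner_diff_left L2_cmult)
  have 2: "L2_inner ?M g (refl_grad1 s a k l) = cnj (L2_inner ?M (refl_grad1 s a k l) g)" "L2_inner ?M h (refl_grad2 s a k l) = cnj (L2_inner ?M (refl_grad2 s a k l) h)"
    by (rule L2_inner_cnj)+
  have 3: "L2_inner ?M (refl_grad1 s a k l) g = s * (of_real (Re a) * L2_inner ?M (conj_refl a k) g + of_real (Im a) * L2_inner ?M (conj_refl a l) g)"
    "L2_inner ?M (refl_grad2 s a k l) h = s * (of_real (Im a) * L2_inner ?M (conj_refl a k) h - of_real (Re a) * L2_inner ?M (conj_refl a l) h)"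
    unfolding refl_grad_eq using C L by (simp_all add: L2_inner_cmult_left L2_inner_add_left L2_inner_diff_left L2_cmult)
  have 4: "L2_inner ?N (conj_refl a x) y = L2_inner ?M (conj_refl a y) x" if "x \<in> L2 ?M" "y \<in> L2 ?N" for x y
    unfolding conj_refl_inner[OF a V that] by (rule L2_inner_cnj[symmetric])
  show ?thesis unfolding 1 2 complex_cnj_add complex_cnj_cnj 3
    using L by (simp add: 4 algebra_simps)
qed

lemma refl_geig:
  assumes a: "cmod a = 1" and s: "s = 1 \<or> s = -1" and V: "V \<in> sets borel"
    and D: "\<And>\<phi>. \<phi> \<in> D \<Longrightarrow> \<phi> \<in> L2 (leb V) \<and> P \<phi> \<in> L2 (leb V) \<and> Q \<phi> \<in> L2 (leb V)"
    and D': "\<And>\<phi>. \<phi> \<in> D' \<Longrightarrow> \<phi> \<in> L2 (leb {z. reflect a z \<in> V}) \<and> P \<phi> \<in> L2 (leb {z. reflect a z \<in> V}) \<and> Q \<phi> \<in> L2 (leb {z. reflect a z \<in> V})"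
    and core: "\<And>\<phi>. \<phi> \<in> D \<Longrightarrow> conj_refl a \<phi> \<in> D' \<and> P (conj_refl a \<phi>) = refl_grad1 s a (P \<phi>) (Q \<phi>) \<and> Q (conj_refl a \<phi>) = refl_grad2 s a (P \<phi>) (Q \<phi>)"
    and core': "\<And>\<phi>. \<phi> \<in> D' \<Longrightarrow> conj_refl a \<phi> \<in> D \<and> P (conj_refl a \<phi>) = refl_grad1 s a (P \<phi>) (Q \<phi>) \<and> Q (conj_refl a \<phi>) = refl_grad2 s a (P \<phi>) (Q \<phi>)"
    and e: "weak_eigen (leb V) D P Q \<mu> u"
  shows "weak_eigen (leb {z. reflect a z \<in> V}) D' P Q (cnj \<mu>) (conj_refl a u)"
proof (rule weak_eigen_antilinear[OF e, where J = "conj_refl a" and A = "refl_grad1 s a" and B = "refl_grad2 s a" and J' = "conj_refl a" and A' = "refl_grad1 s a" and B' = "refl_grad2 s a"])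
  have s': "cmod s = 1" "cnj s = s" using s by auto
  have VV: "{z. reflect a z \<in> {z. reflect a z \<in> V}} = V" using a by simp
  show "form_graph (leb {z. reflect a z \<in> V}) D' P Q (conj_refl a u) (refl_grad1 s a g h) (refl_grad2 s a g h)" if "form_graph (leb V) D P Q u g h" for u g h
    by (rule refl_gclos[OF a s'(1) V that D D' core])
  show "form_graph (leb V) D P Q (conj_refl a v) (refl_grad1 s a k l) (refl_grad2 s a k l)" if "form_graph (leb {z. reflect a z \<in> V}) D' P Q v k l" for v k l
    using refl_gclos[OF a s'(1) reflect_vimage_borel[OF V] that D', of D P Q] D core' unfolding VV by blast
qed (use conj_refl_inner[OF a V] refl_grad_inner[OF a V] s in auto)

lemma reflect_has_derivative: "(reflect a has_derivative reflect a) (at z)"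
  unfolding reflect_def by (auto intro!: derivative_eq_intros)

lemma bounded_linear_reflect: "bounded_linear (reflect a)"
  using reflect_has_derivative has_derivative_bounded_linear by blast

lemma conj_refl_pd:
  assumes "\<phi> \<in> test_functions V"
  shows "pd 1 (conj_refl a \<phi>) = refl_grad1 1 a (pd 1 \<phi>) (pd \<i> \<phi>)" "pd \<i> (conj_refl a \<phi>) = refl_grad2 1 a (pd 1 \<phi>) (pd \<i> \<phi>)"
proof -
  have lin: "pd e \<phi> z = of_real (Re e) * pd 1 \<phi> z + of_real (Im e) * pd \<i> \<phi> z" for e z
  proof -
    interpret linear "\<lambda>e. pd e \<phi> z" by (rule has_derivative_linear[OF test_has_derivative[OF assms]])
    have e: "e = Re e *\<^sub>R 1 + Im e *\<^sub>R \<i>" by (simp add: complex_eq_iff)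
    have "pd e \<phi> z = Re e *\<^sub>R pd 1 \<phi> z + Im e *\<^sub>R pd \<i> \<phi> z"
      by (subst e, subst add, simp only: scale)
    then show ?thesis by (simp add: scaleR_conv_of_real)
  qed
  have D: "(conj_refl a \<phi> has_derivative (\<lambda>e. cnj (pd (reflect a e) \<phi> (reflect a z)))) (at z)" for z
    unfolding conj_refl_def
    by (intro has_derivative_cnj has_derivative_compose[OF reflect_has_derivative test_has_derivative[OF assms]])
  have r: "reflect a 1 = a" "Re (reflect a \<i>) = Im a" "Im (reflect a \<i>) = - Re a" by (simp_all add: reflect_def)
  show "pd 1 (conj_refl a \<phi>) = refl_grad1 1 a (pd 1 \<phi>) (pd \<i> \<phi>)"
    using pd_eqI[OF D, of 1] by (auto simp: fun_eq_iff refl_grad1_def r lin[of a])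
  show "pd \<i> (conj_refl a \<phi>) = refl_grad2 1 a (pd 1 \<phi>) (pd \<i> \<phi>)"
    using pd_eqI[OF D, of \<i>] by (auto simp: fun_eq_iff refl_grad2_def r lin[of "reflect a \<i>"])
qed

lemma conj_refl_test:
  assumes a: "cmod a = 1" and V: "open V" and \<phi>: "\<phi> \<in> test_functions V"
  shows "conj_refl a \<phi> \<in> test_functions {z. reflect a z \<in> V}"
proof -
  have V': "open {z. reflect a z \<in> V}"
    using open_vimage[OF V, of "reflect a"] continuous_on_reflect[OF continuous_on_id, of UNIV a] by (simp add: vimage_def)
  obtain K where K: "compact K" "K \<subseteq> V" "\<And>z. z \<notin> K \<Longrightarrow> \<phi> z = 0" by (rule test_compact[OF \<phi>]) blast
  have "(\<lambda>z. \<phi> (reflect a z)) \<in> test_functions {z. reflect a z \<in> V}"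
  proof (rule test_compose[OF V V' \<phi> smooth_on_ident_linear[OF bounded_linear_reflect V'], of "reflect a ` K"])
    show "compact (reflect a ` K)" by (intro compact_continuous_image K continuous_on_reflect continuous_on_id)
    show "reflect a ` K \<subseteq> {z. reflect a z \<in> V}" using K(2) a by auto
    show "\<phi> (reflect a z) = 0" if "z \<notin> reflect a ` K" for z
      using that a by (intro K(3)) (metis image_eqI reflect_rf)
  qed
  then show ?thesis unfolding conj_refl_def by (rule test_cnj[OF V'])
qed

text \<open>The potential is half the angular field, \<open>(-y, x) / (2 r^2)\<close>. A reflection
  reverses rotations, so the transported field changes sign.\<close>

lemma A_reflect:
  assumes a: "cmod a = 1"
  shows "Re a * A1 (reflect a z) + Im a * A2 (reflect a z) = - A1 z" "Im a * A1 (reflect a z) - Re a * A2 (reflect a z) = - A2 z"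
proof -
  have a2: "Re a * Re a + Im a * Im a = 1" using a by (metis cmod_power2 one_power2 power2_eq_square)
  have n: "cmod (reflect a z) = cmod z" using a by simp
  have r: "Re (reflect a z) = Re a * Re z + Im a * Im z" "Im (reflect a z) = Im a * Re z - Re a * Im z"
    by (simp_all add: reflect_def)
  have "Re a * (- Im (reflect a z)) + Im a * Re (reflect a z) = (Re a * Re a + Im a * Im a) * Im z"
    unfolding r by (simp add: algebra_simps)
  then have 1: "Re a * (- Im (reflect a z)) + Im a * Re (reflect a z) = Im z" by (simp only: a2 mult_1)
  have "Im a * (- Im (reflect a z)) - Re a * Re (reflect a z) = - (Re a * Re a + Im a * Im a) * Re z"
    unfolding r by (simp add: algebra_simps)
  then have 2: "Im a * (- Im (reflect a z)) - Re a * Re (reflect a z) = - Re z" unfolding a2 by simp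
  show "Re a * A1 (reflect a z) + Im a * A2 (reflect a z) = - A1 z"
    unfolding A1_def A2_def n using arg_cong[OF 1, of "\<lambda>t. 1/2 * (t / (cmod z)\<^sup>2)"]
    by (simp add: add_divide_distrib distrib_left diff_divide_distrib right_diff_distrib)
  show "Im a * A1 (reflect a z) - Re a * A2 (reflect a z) = - A2 z"
    unfolding A1_def A2_def n using arg_cong[OF 2, of "\<lambda>t. 1/2 * (t / (cmod z)\<^sup>2)"]
    by (simp add: add_divide_distrib distrib_left diff_divide_distrib right_diff_distrib)
qed

lemma conj_refl_DA:
  assumes a: "cmod a = 1" and \<phi>: "\<phi> \<in> test_functions V"
  shows "DA1 (conj_refl a \<phi>) = refl_grad1 (-1) a (DA1 \<phi>) (DA2 \<phi>)" "DA2 (conj_refl a \<phi>) = refl_grad2 (-1) a (DA1 \<phi>) (DA2 \<phi>)"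
proof -
  have 1: "complex_of_real (A1 z) = - (of_real (Re a) * of_real (A1 (reflect a z)) + of_real (Im a) * of_real (A2 (reflect a z)))"
    and 2: "complex_of_real (A2 z) = - (of_real (Im a) * of_real (A1 (reflect a z)) - of_real (Re a) * of_real (A2 (reflect a z)))" for z
  proof -
    have "A1 z = - (Re a * A1 (reflect a z) + Im a * A2 (reflect a z))" "A2 z = - (Im a * A1 (reflect a z) - Re a * A2 (reflect a z))"
      using A_reflect[OF a, of z] by linarith+
    then show "complex_of_real (A1 z) = - (of_real (Re a) * of_real (A1 (reflect a z)) + of_real (Im a) * of_real (A2 (reflect a z)))"
      "complex_of_real (A2 z) = - (of_real (Im a) * of_real (A1 (reflect a z)) - of_real (Re a) * of_real (A2 (reflect a z)))"
      by (simp_all only: of_real_minus of_real_add of_real_diff of_real_mult)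
  qed
  show "DA1 (conj_refl a \<phi>) = refl_grad1 (-1) a (DA1 \<phi>) (DA2 \<phi>)"
    unfolding DA1_def conj_refl_pd[OF \<phi>] 
  proof (rule ext)
    fix z
    show "- \<i> * refl_grad1 1 a (pd 1 \<phi>) (pd \<i> \<phi>) z - complex_of_real (A1 z) * conj_refl a \<phi> z = refl_grad1 (- 1) a (\<lambda>z. - \<i> * pd 1 \<phi> z - complex_of_real (A1 z) * \<phi> z) (DA2 \<phi>) z"
      by (simp add: refl_grad1_def conj_refl_def DA2_def 1[of z] algebra_simps)
  qed
  show "DA2 (conj_refl a \<phi>) = refl_grad2 (-1) a (DA1 \<phi>) (DA2 \<phi>)"
    unfolding DA2_def conj_refl_pd[OF \<phi>] 
  proof (rule ext)
    fix z
    show "- \<i> * refl_grad2 1 a (pd 1 \<phi>) (pd \<i> \<phi>) z - complex_of_real (A2 z) * conj_refl a \<phi> z = refl_grad2 (- 1) a (DA1 \<phi>) (\<lambda>z. - \<i> * pd \<i> \<phi> z - complex_of_real (A2 z) * \<phi> z) z"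
      by (simp add: refl_grad2_def conj_refl_def DA1_def 2[of z] algebra_simps)
  qed
qed

abbreviation ABcl :: "complex set \<Rightarrow> cfun \<Rightarrow> cfun \<Rightarrow> cfun \<Rightarrow> bool"
  where "ABcl V \<equiv> form_graph (leb V) (test_functions V) DA1 DA2"

abbreviation ABeig :: "complex set \<Rightarrow> complex \<Rightarrow> cfun \<Rightarrow> bool"
  where "ABeig V \<equiv> weak_eigen (leb V) (test_functions V) DA1 DA2"

abbreviation DNcl :: "complex set \<Rightarrow> complex set \<Rightarrow> cfun \<Rightarrow> cfun \<Rightarrow> cfun \<Rightarrow> bool"
  where "DNcl U C \<equiv> form_graph (leb U) (test_functions (- C)) (pd 1) (pd \<i>)"

abbreviation DNeig :: "complex set \<Rightarrow> complex set \<Rightarrow> complex \<Rightarrow> cfun \<Rightarrow> bool"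
  where "DNeig U C \<equiv> weak_eigen (leb U) (test_functions (- C)) (pd 1) (pd \<i>)"

lemma AB_test_L2:
  assumes "open V" "0 \<notin> V" "\<phi> \<in> test_functions V"
  shows "\<phi> \<in> L2 (leb V) \<and> DA1 \<phi> \<in> L2 (leb V) \<and> DA2 \<phi> \<in> L2 (leb V)"
  using test_L2[OF assms(3), of V] test_L2[OF test_DA(1)[OF assms], of V] test_L2[OF test_DA(2)[OF assms], of V] assms(1)
  by simp

lemma DN_test_L2:
  assumes "open U" "closed C" "\<phi> \<in> test_functions (- C)"
  shows "\<phi> \<in> L2 (leb U) \<and> pd 1 \<phi> \<in> L2 (leb U) \<and> pd \<i> \<phi> \<in> L2 (leb U)"
  using test_L2[OF assms(3), of U] test_L2[OF test_pd[OF _ assms(3), of 1], of U] test_L2[OF test_pd[OF _ assms(3), of \<i>], of U] assms(1,2)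
  by (simp add: Basis_complex open_Compl)

lemma open_reflect_vimage: "open V \<Longrightarrow> open {z. reflect a z \<in> V}"
  using open_vimage[of V "reflect a"] continuous_on_reflect[OF continuous_on_id, of UNIV a] by (simp add: vimage_def)

lemma AB_refl:
  assumes a: "cmod a = 1" and V: "open V" "0 \<notin> V" and e: "ABeig V \<mu> u"
  shows "ABeig {z. reflect a z \<in> V} (cnj \<mu>) (conj_refl a u)"
proof (rule refl_geig[OF a, where s = "-1"])
  have V': "open {z. reflect a z \<in> V}" "0 \<notin> {z. reflect a z \<in> V}" using V open_reflect_vimage by (auto simp: reflect_def)
  have VV: "{z. reflect a z \<in> {z. reflect a z \<in> V}} = V" using a by simp
  show "conj_refl a \<phi> \<in> test_functions V \<and> DA1 (conj_refl a \<phi>) = refl_grad1 (- 1) a (DA1 \<phi>) (DA2 \<phi>) \<and> DA2 (conj_refl a \<phi>) = refl_grad2 (- 1) a (DA1 \<phi>) (DA2 \<phi>)"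
    if "\<phi> \<in> test_functions {z. reflect a z \<in> V}" for \<phi>
    using conj_refl_test[OF a V'(1) that] conj_refl_DA[OF a that] unfolding VV by simp
qed (use conj_refl_test[OF a V(1)] conj_refl_DA[OF a] AB_test_L2[OF V] AB_test_L2[of "{z. reflect a z \<in> V}"] V open_reflect_vimage e in \<open>auto simp: reflect_def\<close>)

lemma DN_refl:
  assumes a: "cmod a = 1" and U: "open U" and C: "closed C" and e: "DNeig U C \<mu> u"
  shows "DNeig {z. reflect a z \<in> U} {z. reflect a z \<in> C} (cnj \<mu>) (conj_refl a u)"
proof (rule refl_geig[OF a, where s = 1])
  have T: "open (- C)" using C by (simp add: open_Compl)
  have Tc: "- {z. reflect a z \<in> C} = {z. reflect a z \<in> - C}" by auto
  have T': "open (- {z. reflect a z \<in> C})" unfolding Tc by (rule open_reflect_vimage[OF T])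
  have TT: "{z. reflect a z \<in> {z. reflect a z \<in> - C}} = - C" using a by auto
  show "conj_refl a \<phi> \<in> test_functions (- {z. reflect a z \<in> C}) \<and> pd 1 (conj_refl a \<phi>) = refl_grad1 1 a (pd 1 \<phi>) (pd \<i> \<phi>) \<and> pd \<i> (conj_refl a \<phi>) = refl_grad2 1 a (pd 1 \<phi>) (pd \<i> \<phi>)"
    if "\<phi> \<in> test_functions (- C)" for \<phi>
    using conj_refl_test[OF a T that] conj_refl_pd[OF that] unfolding Tc by simp
  show "conj_refl a \<phi> \<in> test_functions (- C) \<and> pd 1 (conj_refl a \<phi>) = refl_grad1 1 a (pd 1 \<phi>) (pd \<i> \<phi>) \<and> pd \<i> (conj_refl a \<phi>) = refl_grad2 1 a (pd 1 \<phi>) (pd \<i> \<phi>)"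
    if "\<phi> \<in> test_functions (- {z. reflect a z \<in> C})" for \<phi>
    using conj_refl_test[OF a T' that] conj_refl_pd[OF that] unfolding Tc TT by simp
  show "\<phi> \<in> L2 (leb {z. reflect a z \<in> U}) \<and> pd 1 \<phi> \<in> L2 (leb {z. reflect a z \<in> U}) \<and> pd \<i> \<phi> \<in> L2 (leb {z. reflect a z \<in> U})"
    if "\<phi> \<in> test_functions (- {z. reflect a z \<in> C})" for \<phi>
    by (rule DN_test_L2[OF open_reflect_vimage[OF U] _ that]) (use T' in \<open>simp add: closed_def\<close>)
qed (use DN_test_L2[OF U C] U e in auto)

section \<open>The antilinear symmetry K\<close>

definition phase :: "complex \<Rightarrow> complex"
  where "phase z = cis (Arg z)"

lemma norm_phase [simp]: "cmod (phase z) = 1"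
  by (simp add: phase_def)

lemma phase_eq: "z \<noteq> 0 \<Longrightarrow> phase z = z * of_real (inverse (cmod z))"
  by (simp add: phase_def cis_Arg sgn_div_norm scaleR_conv_of_real mult.commute)

lemma phase_measurable [measurable]: "phase \<in> borel_measurable borel"
proof -
  have "phase = (\<lambda>z. if z = 0 then phase 0 else z * of_real (inverse (cmod z)))"
    by (auto simp: phase_eq)
  also have "\<dots> \<in> borel_measurable borel" by measurable
  finally show ?thesis .
qed

text \<open>The gradient of theta is twice the potential; this is where the factor 1/2 in the
  potential matters. The computation uses \<open>z / |z|\<close>, which has no branch cut.\<close>

lemma phase_has_derivative:
  assumes "z \<noteq> 0"
  shows "(phase has_derivative (\<lambda>e. 2 * \<i> * of_real (Re e * A1 z + Im e * A2 z) * phase z)) (at z)"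
proof -
  have "((\<lambda>z. z * complex_of_real (inverse (cmod z))) has_derivative
     (\<lambda>e. z * of_real (- (inverse (cmod z) * (e \<bullet> sgn z) * inverse (cmod z))) + e * of_real (inverse (cmod z)))) (at z)"
    using assms by (auto intro!: derivative_eq_intros has_derivative_norm simp: inner_commute)
  then have "(phase has_derivative
     (\<lambda>e. z * of_real (- (inverse (cmod z) * (e \<bullet> sgn z) * inverse (cmod z))) + e * of_real (inverse (cmod z)))) (at z)"
    by (rule has_derivative_transform_within_open[of _ _ _ _ "- {0}"]) (use assms in \<open>auto simp: phase_eq open_Compl\<close>)
  moreover have "z * of_real (- (inverse (cmod z) * (e \<bullet> sgn z) * inverse (cmod z))) + e * of_real (inverse (cmod z)) =
     2 * \<i> * of_real (Re e * A1 z + Im e * A2 z) * phase z" for e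
  proof -
    define r where "r = cmod z"
    have r: "r \<noteq> 0" "Re z * Re z + Im z * Im z = r * r"
      using assms by (simp_all add: r_def cmod_power2[symmetric] flip: power2_eq_square) 
    have "e \<bullet> sgn z = (Re e * Re z + Im e * Im z) / r"
      by (simp add: inner_complex_def sgn_div_norm r_def divide_inverse algebra_simps)
    moreover have "A1 z = - (Im z / (2 * (r * r)))" "A2 z = Re z / (2 * (r * r))"
      by (simp_all add: A1_def A2_def r_def power2_eq_square)
    moreover have "phase z = z * of_real (1 / r)" using assms by (simp add: phase_eq r_def inverse_eq_divide)
    ultimately have 1: "?thesis \<longleftrightarrow> z * of_real (- (1 / r * ((Re e * Re z + Im e * Im z) / r) * (1 / r))) + e * of_real (1 / r) =
      2 * \<i> * of_real (Re e * (- (Im z / (2 * (r * r)))) + Im e * (Re z / (2 * (r * r)))) * (z * of_real (1 / r))"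
      unfolding r_def[symmetric] by (simp add: inverse_eq_divide)
    show ?thesis unfolding 1 using r(1)
      by (simp add: complex_eq_iff field_simps) (intro conjI; use r(2) in algebra)
  qed
  ultimately show ?thesis by simp
qed

lemma smooth_on_phase:
  assumes "open S" "0 \<notin> S" shows "smooth_on phase S"
proof (rule smooth_on_bootstrap[OF assms(1) phase_has_derivative])
  fix k and e :: complex assume e: "e \<in> Basis" and k: "Ck_on k phase S"
  have A: "Ck_on k A1 S" "Ck_on k A2 S"
    using smooth_on_subset[OF smooth_on_A(1), of S] smooth_on_subset[OF smooth_on_A(2), of S] assms(2)
    by (auto simp: smooth_on_def)
  show "Ck_on k (\<lambda>z. 2 * \<i> * of_real (Re e * A1 z + Im e * A2 z) * phase z) S"
    by (intro Ck_on_bilinear[OF bounded_bilinear_mult] Ck_on_const Ck_on_linear[OF bounded_linear_of_real] Ck_on_add A k assms(1))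
qed (use assms in auto)

lemma Kop_eq: "Kop u = (\<lambda>z. phase z * cnj (u z))"
  by (simp add: Kop_def Gam_def phase_def)

lemma Kop_test: "open V \<Longrightarrow> 0 \<notin> V \<Longrightarrow> \<phi> \<in> test_functions V \<Longrightarrow> Kop \<phi> \<in> test_functions V"
  unfolding Kop_eq by (intro test_mult smooth_on_phase test_cnj)

text \<open>Conjugation turns the magnetic derivative for \<open>A\<close> into minus the one for
  \<open>-A\<close>, and the factor \<open>exp (i theta)\<close> shifts \<open>-A\<close> by
  \<open>2 * A\<close>, back to \<open>A\<close>. The point 0, where \<open>phase\<close> is not
  differentiable, lies outside the domains used.\<close>

lemma Kop_DA:
  assumes "\<phi> \<in> test_functions V" "z \<noteq> 0"
  shows "DA1 (Kop \<phi>) z = - Kop (DA1 \<phi>) z" "DA2 (Kop \<phi>) z = - Kop (DA2 \<phi>) z"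
proof -
  have D: "(Kop \<phi> has_derivative (\<lambda>e. phase z * cnj (pd e \<phi> z) + 2 * \<i> * of_real (Re e * A1 z + Im e * A2 z) * phase z * cnj (\<phi> z))) (at z)"
    unfolding Kop_eq using assms
    by (intro has_derivative_mult phase_has_derivative has_derivative_cnj test_has_derivative)
  show "DA1 (Kop \<phi>) z = - Kop (DA1 \<phi>) z" "DA2 (Kop \<phi>) z = - Kop (DA2 \<phi>) z"
    unfolding DA1_def DA2_def pd_eqI[OF D] by (simp_all add: Kop_eq algebra_simps)
qed

lemma Kop_L2:
  assumes "u \<in> L2 (leb V)" shows "Kop u \<in> L2 (leb V)"
  unfolding Kop_eq by (rule L2_mult_bounded[where B = 1, OF L2_cnj[OF assms]]) (auto intro: borel_measurable_leb)

lemma Kop_norm: "L2_norm M (Kop u) = L2_norm M u"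
  by (simp add: L2_norm_def Kop_eq norm_mult)

lemma Kop_diff: "(\<lambda>z. Kop f z - Kop f' z) = Kop (\<lambda>z. f z - f' z)"
  by (auto simp: Kop_eq algebra_simps)

lemma Kop_cl:
  assumes V: "open V" "0 \<notin> V" and g: "ABcl V u g h"
  shows "ABcl V (Kop u) (\<lambda>z. - Kop g z) (\<lambda>z. - Kop h z)"
proof (rule form_graph_transfer[OF g AB_test_L2[OF V] AB_test_L2[OF V], where J = Kop and A = "\<lambda>g h z. - Kop g z" and B = "\<lambda>g h z. - Kop h z" and c = 1])
  have d: "L2_norm (leb V) (\<lambda>z. - Kop f z - - Kop f' z) = L2_norm (leb V) (\<lambda>z. f z - f' z)" for f f'
    using Kop_diff[of f' f] Kop_norm[of "leb V" "\<lambda>z. f' z - f z"] L2_norm_minus_commute[of "leb V" f f'] by simp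
  show "(\<lambda>z. - Kop f z) \<in> L2 (leb V) \<and> L2_norm (leb V) (\<lambda>z. - Kop f z - - Kop f' z) \<le> 1 * (L2_norm (leb V) (\<lambda>z. f z - f' z) + L2_norm (leb V) (\<lambda>z. k z - k' z))"
    if "f \<in> L2 (leb V)" for f f' k k' using that unfolding d by (auto intro: L2_uminus Kop_L2)
  show "(\<lambda>z. - Kop k z) \<in> L2 (leb V) \<and> L2_norm (leb V) (\<lambda>z. - Kop k z - - Kop k' z) \<le> 1 * (L2_norm (leb V) (\<lambda>z. f z - f' z) + L2_norm (leb V) (\<lambda>z. k z - k' z))"
    if "k \<in> L2 (leb V)" for f f' k k' using that unfolding d by (auto intro: L2_uminus Kop_L2)
  show "Kop f \<in> L2 (leb V) \<and> L2_norm (leb V) (\<lambda>z. Kop f z - Kop f' z) \<le> 1 * L2_norm (leb V) (\<lambda>z. f z - f' z)"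
    if "f \<in> L2 (leb V)" for f f' using that unfolding Kop_diff Kop_norm by (auto intro: Kop_L2)
  fix \<phi> assume \<phi>: "\<phi> \<in> test_functions V"
  have K: "Kop \<phi> \<in> test_functions V" by (rule Kop_test[OF V \<phi>])
  show "ABcl V (Kop \<phi>) (\<lambda>z. - Kop (DA1 \<phi>) z) (\<lambda>z. - Kop (DA2 \<phi>) z)"
  proof (rule form_graph_cong_AE[OF form_graphI_core[OF K] _ _ _ _ AB_test_L2[OF V]])
    show "AE z in leb V. DA1 (Kop \<phi>) z = - Kop (DA1 \<phi>) z" "AE z in leb V. DA2 (Kop \<phi>) z = - Kop (DA2 \<phi>) z"
      using Kop_DA[OF \<phi>] V(2) by (intro AE_I2; metis space_leb)+
  qed (use AB_test_L2[OF V K] AB_test_L2[OF V \<phi>] in \<open>auto intro: L2_uminus Kop_L2\<close>)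
qed

lemma Kop_inner: "L2_inner M (Kop u) v = cnj (L2_inner M u (Kop v))"
proof -
  have "(\<lambda>z. Kop u z * cnj (v z)) = (\<lambda>z. cnj (u z * cnj (Kop v z)))" by (auto simp: Kop_eq algebra_simps)
  then show ?thesis unfolding L2_inner_def by (simp only: Bochner_Integration.integral_cnj)
qed

lemma L2_inner_uminus: "L2_inner M (\<lambda>z. - u z) v = - L2_inner M u v" "L2_inner M v (\<lambda>z. - u z) = - L2_inner M v u"
  by (simp_all add: L2_inner_def)

lemma AB_Kop:
  assumes V: "open V" "0 \<notin> V" and e: "ABeig V \<mu> u"
  shows "ABeig V (cnj \<mu>) (Kop u)"
proof (rule weak_eigen_antilinear[OF e, where J = Kop and A = "\<lambda>g h z. - Kop g z" and B = "\<lambda>g h z. - Kop h z"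
      and J' = Kop and A' = "\<lambda>g h z. - Kop g z" and B' = "\<lambda>g h z. - Kop h z"])
  show "L2_inner (leb V) (\<lambda>z. - Kop g z) k + L2_inner (leb V) (\<lambda>z. - Kop h z) l =
       cnj (L2_inner (leb V) g (\<lambda>z. - Kop k z) + L2_inner (leb V) h (\<lambda>z. - Kop l z))" for g h k l
    by (simp add: L2_inner_uminus Kop_inner)
qed (use Kop_cl[OF V] Kop_inner in auto)

lemma AB_add:
  assumes V: "open V" "0 \<notin> V" and "ABeig V \<mu> u" "ABeig V \<mu> v"
  shows "ABeig V \<mu> (\<lambda>z. u z + v z)"
proof (rule weak_eigen_add[OF _ AB_test_L2[OF V] assms(3,4)])
  show "(\<lambda>z. \<phi> z + \<psi> z) \<in> test_functions V \<and> DA1 (\<lambda>z. \<phi> z + \<psi> z) = (\<lambda>z. DA1 \<phi> z + DA1 \<psi> z) \<and> DA2 (\<lambda>z. \<phi> z + \<psi> z) = (\<lambda>z. DA2 \<phi> z + DA2 \<psi> z)"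
    if "\<phi> \<in> test_functions V" "\<psi> \<in> test_functions V" for \<phi> \<psi>
    using test_add[OF V(1) that] test_differentiable[OF that(1)] test_differentiable[OF that(2)]
    by (simp add: DA1_def DA2_def pd_add algebra_simps)
qed

lemma AB_cmult:
  assumes V: "open V" "0 \<notin> V" and "ABeig V \<mu> u"
  shows "ABeig V \<mu> (\<lambda>z. c * u z)"
proof (rule weak_eigen_cmult[OF _ AB_test_L2[OF V] assms(3)])
  show "(\<lambda>z. c * \<phi> z) \<in> test_functions V \<and> DA1 (\<lambda>z. c * \<phi> z) = (\<lambda>z. c * DA1 \<phi> z) \<and> DA2 (\<lambda>z. c * \<phi> z) = (\<lambda>z. c * DA2 \<phi> z)"
    if "\<phi> \<in> test_functions V" for \<phi>
    using test_cmult[OF V(1) that] test_differentiable[OF that]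
    by (simp add: DA1_def DA2_def pd_cmult algebra_simps)
qed

section \<open>Unfolding along the real axis\<close>

text \<open>The slit plane, not the slit: the complement of the closed negative real axis. The ray
  left out will carry the Dirichlet condition.\<close>

definition slit :: "complex set"
  where "slit = {z. Im z \<noteq> 0 \<or> 0 < Re z}"

lemma open_slit: "open slit"
proof -
  have "slit = - {z. Im z = 0} \<union> {z. 0 < Re z}" by (auto simp: slit_def)
  moreover have "closed {z. Im z = 0}" by (intro closed_Collect_eq continuous_intros)
  moreover have "open {z. 0 < Re z}" by (intro open_Collect_less continuous_intros)
  ultimately show ?thesis by (metis open_Un open_Compl)
qed

lemma slit_iff: "z \<in> slit \<longleftrightarrow> z \<notin> \<real>\<^sub>\<le>\<^sub>0"
  by (auto simp: slit_def complex_nonpos_Reals_iff)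

lemma slit_nonzero: "z \<in> slit \<Longrightarrow> z \<noteq> 0"
  by (auto simp: slit_def)

definition half_phase :: "complex \<Rightarrow> complex"
  where "half_phase z = cis (Arg z / 2)"

lemma norm_half_phase [simp]: "cmod (half_phase z) = 1"
  by (simp add: half_phase_def)

lemma half_phase_cnj_mult [simp]: "half_phase z * cnj (half_phase z) = 1" "cnj (half_phase z) * half_phase z = 1"
  using complex_norm_square[of "half_phase z"] by (simp_all add: mult.commute)

lemma half_phase_square: "half_phase z * half_phase z = phase z"
  by (simp add: half_phase_def phase_def cis_mult)

text \<open>\<open>Arg\<close> is odd under conjugation off the negative axis. On that axis
  \<open>half_phase\<close> is \<open>i\<close> although \<open>cnj z = z\<close>, and the identity
  fails.\<close>

lemma half_phase_cnj: "z \<in> slit \<Longrightarrow> half_phase (cnj z) = cnj (half_phase z)"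
proof -
  assume z: "z \<in> slit"
  have "Arg (cnj z) = - Arg z"
  proof (cases "z \<in> \<real>")
    case True
    with z have "Re z > 0" "z = of_real (Re z)" by (auto simp: slit_def complex_is_Real_iff complex_eq_iff)
    then show ?thesis by (metis Arg_of_real complex_cnj_complex_of_real minus_zero not_less_iff_gr_or_eq)
  next
    case False
    then show ?thesis by (simp add: Arg_cnj)
  qed
  then show ?thesis by (simp add: half_phase_def cis_cnj)
qed

text \<open>The gradient of \<open>theta / 2\<close> is the potential itself, so multiplication by
  \<open>half_phase\<close> gauges the potential away wherever a branch of theta is smooth. The
  derivative comes from that of \<open>Ln\<close>, whose imaginary part is theta.\<close>

lemma half_phase_has_derivative:
  assumes "z \<in> slit"
  shows "(half_phase has_derivative (\<lambda>e. \<i> * of_real (Re e * A1 z + Im e * A2 z) * half_phase z)) (at z)"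
proof -
  have nz: "z \<noteq> 0" "z \<notin> \<real>\<^sub>\<le>\<^sub>0" using assms by (auto simp: slit_iff)
  have 1: "(Ln has_derivative (\<lambda>e. inverse z * e)) (at z)"
    using has_field_derivative_Ln[OF nz(2)] by (simp add: has_field_derivative_def mult.commute[of _ "inverse z"])
  have 2: "((\<lambda>z. \<i> * complex_of_real (Im (Ln z) / 2)) has_derivative (\<lambda>e. \<i> * complex_of_real (Im (inverse z * e) / 2))) (at z)"
    by (intro bounded_linear.has_derivative[OF bounded_linear_mult_right] bounded_linear.has_derivative[OF bounded_linear_of_real]
         bounded_linear.has_derivative[OF bounded_linear_divide] bounded_linear.has_derivative[OF bounded_linear_Im] 1)
  have "((\<lambda>z. exp (\<i> * of_real (Im (Ln z) / 2))) has_derivative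
      (\<lambda>e. \<i> * of_real (Im (inverse z * e) / 2) * exp (\<i> * of_real (Im (Ln z) / 2)))) (at z)"
    using has_derivative_compose[OF 2 DERIV_exp[unfolded has_field_derivative_def]] by (simp add: mult.commute)
  then have "(half_phase has_derivative (\<lambda>e. \<i> * of_real (Im (inverse z * e) / 2) * exp (\<i> * of_real (Im (Ln z) / 2)))) (at z)"
  proof (rule has_derivative_transform_within_open[OF _ open_slit assms])
    fix x assume "x \<in> slit"
    then show "exp (\<i> * of_real (Im (Ln x) / 2)) = half_phase x"
      using slit_nonzero by (simp add: half_phase_def cis_conv_exp Arg_eq_Im_Ln)
  qed
  moreover have "\<i> * of_real (Im (inverse z * e) / 2) * exp (\<i> * of_real (Im (Ln z) / 2)) =
      \<i> * of_real (Re e * A1 z + Im e * A2 z) * half_phase z" for e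
  proof -
    have inv: "inverse z = cnj z * of_real (inverse ((cmod z)\<^sup>2))"
      using nz(1) complex_norm_square[of z] by (simp add: field_simps)
    define q where "q = inverse ((cmod z)\<^sup>2)"
    have I: "Im (inverse z * e) = (Im e * Re z - Re e * Im z) * q"
      unfolding inv q_def[symmetric] by (simp add: algebra_simps)
    have A: "A1 z = 1/2 * (- (Im z * q))" "A2 z = 1/2 * (Re z * q)"
      by (simp_all only: A1_def A2_def divide_inverse q_def)
    have "Im (inverse z * e) / 2 = Re e * A1 z + Im e * A2 z"
      unfolding I A by (simp add: algebra_simps add_divide_distrib diff_divide_distrib)
    moreover have "exp (\<i> * of_real (Im (Ln z) / 2)) = half_phase z"
      using nz(1) by (simp add: half_phase_def cis_conv_exp Arg_eq_Im_Ln)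
    ultimately show ?thesis by simp
  qed
  ultimately show ?thesis by (simp only:)
qed

lemma smooth_on_half_phase:
  assumes "open S" "S \<subseteq> slit" shows "smooth_on half_phase S"
proof (rule smooth_on_bootstrap[OF assms(1) half_phase_has_derivative])
  fix k and e :: complex assume e: "e \<in> Basis" and k: "Ck_on k half_phase S"
  have A: "Ck_on k A1 S" "Ck_on k A2 S"
    using smooth_on_subset[OF smooth_on_A(1), of S] smooth_on_subset[OF smooth_on_A(2), of S] assms(2) slit_nonzero
    by (auto simp: smooth_on_def)
  show "Ck_on k (\<lambda>z. \<i> * of_real (Re e * A1 z + Im e * A2 z) * half_phase z) S"
    by (intro Ck_on_bilinear[OF bounded_bilinear_mult] Ck_on_const Ck_on_linear[OF bounded_linear_of_real] Ck_on_add A k assms(1))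
qed (use assms in auto)

lemma half_phase_measurable [measurable]: "half_phase \<in> borel_measurable borel"
proof -
  have [measurable]: "slit \<in> sets borel" using open_slit by simp
  have [measurable]: "(\<lambda>z. indicator slit z *\<^sub>R half_phase z) \<in> borel_measurable borel"
    by (rule borel_measurable_continuous_on_indicator)
      (use smooth_on_continuous[OF smooth_on_half_phase[OF open_slit order_refl]] in auto)
  \<comment> \<open>Three pieces: the slit plane, where the function is continuous, the origin,
    where \<open>Arg\<close> is 0, and the open negative axis, where \<open>Arg\<close> is
    pi.\<close>
  have eq: "half_phase z = indicator slit z *\<^sub>R half_phase z + indicator {0} z *\<^sub>R 1 + indicator (- slit - {0}) z *\<^sub>R \<i>" for z
  proof (cases "z \<in> slit \<or> z = 0")
    case True
    then show ?thesis using slit_nonzero by (auto simp: half_phase_def indicator_def Arg_zero)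
  next
    case False
    then have "Arg z = pi" by (auto simp: slit_def Arg_eq_pi complex_eq_iff not_less le_less)
    then have "half_phase z = \<i>" by (simp add: half_phase_def complex_eq_iff)
    then show ?thesis using False by (simp add: indicator_def)
  qed
  have "(\<lambda>z. indicator slit z *\<^sub>R half_phase z + indicator {0} z *\<^sub>R 1 + indicator (- slit - {0}) z *\<^sub>R \<i>) \<in> borel_measurable borel"
    by measurable
  then show ?thesis unfolding eq[symmetric] .
qed

lemma AE_Im_nonzero: "AE z in lborel. Im z \<noteq> 0"
proof -
  have "negligible {z. \<i> \<bullet> z = 0}" by (rule negligible_hyperplane) simp
  then have "{z. Im z = 0} \<in> null_sets lebesgue"
    by (simp add: negligible_iff_null_sets inner_complex_def)
  then have "AE z in lebesgue. z \<notin> {z. Im z = 0}" by (rule AE_not_in)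
  then have "AE z in completion lborel. Im z \<noteq> 0" by simp
  then show ?thesis by (simp add: AE_completion_iff)
qed

lemma reflect_1: "reflect 1 z = cnj z"
  by (simp add: reflect_def)

text \<open>Reflection, followed by the gauge factor. With \<open>s = 1\<close> it extends a
  function and its derivative along the axis evenly, with \<open>s = -1\<close> the derivative
  across the axis oddly.\<close>

definition sym_ext :: "complex set \<Rightarrow> complex \<Rightarrow> cfun \<Rightarrow> cfun"
  where "sym_ext U s w = (\<lambda>z. half_phase z * (indicator U z *\<^sub>R w z + s * (indicator U (cnj z) *\<^sub>R w (cnj z))))"

text \<open>The adjoint of \<open>sym_ext U s\<close> for \<open>s = 1\<close> and
  \<open>s = -1\<close>; values from below the axis carry the conjugate gauge factor of
  \<open>cnj z\<close>, which is \<open>half_phase z\<close>.\<close>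

definition fold_up :: "complex \<Rightarrow> cfun \<Rightarrow> cfun"
  where "fold_up s v = (\<lambda>z. cnj (half_phase z) * v z + s * (half_phase z * v (cnj z)))"

section \<open>Splitting integrals into the two half-planes; norm bounds and adjointness\<close>

context
  fixes V U :: "complex set"
  assumes Vb: "V \<in> sets borel" and sym: "\<And>z. z \<in> V \<Longrightarrow> cnj z \<in> V"
  defines "U \<equiv> {z \<in> V. 0 < Im z}"
begin

lemma Ub: "U \<in> sets borel"
proof -
  have "U = V \<inter> {z. 0 < Im z}" by (auto simp: U_def)
  moreover have "{z. 0 < Im z} \<in> sets borel" by (intro borel_open open_Collect_less continuous_intros)
  ultimately show ?thesis using Vb by simp
qed

lemma lower_eq: "{z. reflect 1 z \<in> U} = {z \<in> V. Im z < 0}"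
  using sym[of "cnj _"] sym by (force simp: U_def reflect_1)

lemma lower_borel: "{z \<in> V. Im z < 0} \<in> sets borel"
  using reflect_vimage_borel[OF Ub, of 1] unfolding lower_eq .

lemma preserves_cnj: "preserves (leb U) (leb {z \<in> V. Im z < 0}) cnj"
  using preserves_reflect'[of 1, OF _ Ub] unfolding lower_eq by (simp add: reflect_1[abs_def])

lemma split_eq:
  fixes F :: "complex \<Rightarrow> 'b::{banach, second_countable_topology}"
  shows "AE z in lborel. indicator V z *\<^sub>R F z = indicator U z *\<^sub>R F z + indicator {z \<in> V. Im z < 0} z *\<^sub>R F z"
  using AE_Im_nonzero by eventually_elim (auto simp: indicator_def U_def)

lemma integrable_split:
  fixes F :: "complex \<Rightarrow> 'b::{banach, second_countable_topology}"
  assumes F: "F \<in> borel_measurable (leb V)"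
  shows "integrable (leb V) F \<longleftrightarrow> integrable (leb U) F \<and> integrable (leb U) (\<lambda>z. F (cnj z))"
proof -
  let ?L = "{z \<in> V. Im z < 0}"
  have FV: "(\<lambda>z. indicator V z *\<^sub>R F z) \<in> borel_measurable lborel"
    using F Vb borel_measurable_restrict_space_iff[of V lborel F] unfolding leb_def by simp
  have UV: "U \<subseteq> V" "?L \<subseteq> V" by (auto simp: U_def)
  have FL: "F \<in> borel_measurable (leb ?L)" by (rule measurable_leb_mono[OF UV(2) F])
  have 1: "integrable (leb U) (\<lambda>z. F (cnj z)) \<longleftrightarrow> integrable (leb ?L) F"
    by (rule preserves_integrable[OF preserves_cnj FL])
  show ?thesis
  proof
    assume I: "integrable (leb V) F"
    have "integrable lborel (\<lambda>z. indicator A z *\<^sub>R (indicator V z *\<^sub>R F z))" if "A \<in> sets borel" for A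
      by (rule integrable_mult_indicator[OF _ I[unfolded integrable_leb[OF Vb]]]) (use that in simp)
    moreover have "(\<lambda>z. indicator A z *\<^sub>R (indicator V z *\<^sub>R F z)) = (\<lambda>z. indicator A z *\<^sub>R F z)" if "A \<subseteq> V" for A
      using that by (auto simp: fun_eq_iff indicator_def)
    ultimately have "integrable (leb A) F" if "A \<in> sets borel" "A \<subseteq> V" for A
      unfolding integrable_leb[OF that(1)] using that by metis
    then show "integrable (leb U) F \<and> integrable (leb U) (\<lambda>z. F (cnj z))"
      unfolding 1 using UV Ub lower_borel by blast
  next
    assume "integrable (leb U) F \<and> integrable (leb U) (\<lambda>z. F (cnj z))"
    then have s: "integrable lborel (\<lambda>z. indicator U z *\<^sub>R F z + indicator ?L z *\<^sub>R F z)"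
      unfolding 1 integrable_leb[OF Ub] integrable_leb[OF lower_borel] by simp
    show "integrable (leb V) F" unfolding integrable_leb[OF Vb]
      by (rule iffD1[OF integrable_cong_AE s]) (use split_eq[of F] FV s in \<open>auto simp: eq_commute\<close>)
  qed
qed

text \<open>The real axis is a null set, and conjugation carries the lower half to the upper one
  preserving the measure.\<close>

lemma integral_split:
  fixes F :: "complex \<Rightarrow> 'b::{banach, second_countable_topology}"
  assumes F: "integrable (leb V) F"
  shows "(LINT z|leb V. F z) = (LINT z|leb U. F z + F (cnj z))"
proof -
  let ?L = "{z \<in> V. Im z < 0}"
  have Fm: "F \<in> borel_measurable (leb V)" using F by simp
  have UV: "U \<subseteq> V" "?L \<subseteq> V" by (auto simp: U_def)
  have FL: "F \<in> borel_measurable (leb ?L)" by (rule measurable_leb_mono[OF UV(2) Fm])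
  have I: "integrable (leb U) F" "integrable (leb U) (\<lambda>z. F (cnj z))" using F integrable_split[OF Fm] by auto
  have IL: "integrable (leb ?L) F" using I(2) preserves_integrable[OF preserves_cnj FL] by simp
  have "(LINT z|leb V. F z) = (LINT z|lborel. indicator U z *\<^sub>R F z + indicator ?L z *\<^sub>R F z)"
    unfolding integral_leb[OF Vb]
    using split_eq[of F] F I(1) IL unfolding integrable_leb[OF Vb] integrable_leb[OF Ub] integrable_leb[OF lower_borel]
    by (intro integral_cong_AE) auto
  also have "\<dots> = (LINT z|leb U. F z) + (LINT z|leb ?L. F z)"
    using I(1) IL unfolding integrable_leb[OF Ub] integrable_leb[OF lower_borel] integral_leb[OF Ub] integral_leb[OF lower_borel]
    by simp
  also have "(LINT z|leb ?L. F z) = (LINT z|leb U. F (cnj z))"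
    by (rule preserves_integral[OF preserves_cnj FL, symmetric])
  finally show ?thesis using I by simp
qed

lemma sym_ext_upper: "z \<in> U \<Longrightarrow> sym_ext U s w z = half_phase z * w z"
  by (simp add: sym_ext_def U_def)

lemma sym_ext_lower: "z \<in> U \<Longrightarrow> sym_ext U s w (cnj z) = s * cnj (half_phase z) * w z"
  using half_phase_cnj[of z] by (simp add: sym_ext_def U_def slit_def)

lemma sym_ext_measurable:
  assumes "w \<in> borel_measurable (leb U)" shows "sym_ext U s w \<in> borel_measurable borel"
proof -
  define w0 where "w0 = (\<lambda>z. indicator U z *\<^sub>R w z)"
  have [measurable]: "w0 \<in> borel_measurable borel"
    using assms Ub borel_measurable_restrict_space_iff[of U lborel w] unfolding leb_def w0_def by simp
  have "sym_ext U s w = (\<lambda>z. half_phase z * (w0 z + s * w0 (cnj z)))" by (simp add: sym_ext_def w0_def)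
  also have "\<dots> \<in> borel_measurable borel" by measurable
  finally show ?thesis .
qed

lemma sym_ext_L2:
  assumes s: "cmod s = 1" and w: "w \<in> L2 (leb U)"
  shows "sym_ext U s w \<in> L2 (leb V)" "(L2_norm (leb V) (sym_ext U s w))\<^sup>2 = 2 * (L2_norm (leb U) w)\<^sup>2"
proof -
  note m = borel_measurable_leb[OF sym_ext_measurable[OF L2D(1)[OF w]], of s V]
  let ?F = "\<lambda>z. (cmod (sym_ext U s w z))\<^sup>2"
  have Fm: "?F \<in> borel_measurable (leb V)" using m by simp
  have e: "?F z = (cmod (w z))\<^sup>2" "?F (cnj z) = (cmod (w z))\<^sup>2" if "z \<in> U" for z
    using that s by (simp_all add: sym_ext_upper sym_ext_lower norm_mult)
  have I: "integrable (leb U) ?F" "integrable (leb U) (\<lambda>z. ?F (cnj z))"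
    using L2D(2)[OF w] e
      Bochner_Integration.integrable_cong[OF refl, of "leb U" ?F "\<lambda>z. (cmod (w z))\<^sup>2"]
      Bochner_Integration.integrable_cong[OF refl, of "leb U" "\<lambda>z. ?F (cnj z)" "\<lambda>z. (cmod (w z))\<^sup>2"]
    by simp_all
  then have IV: "integrable (leb V) ?F" by (simp add: integrable_split[OF Fm])
  then show "sym_ext U s w \<in> L2 (leb V)" using m by (simp add: L2_def)
  have "(LINT z|leb V. ?F z) = (LINT z|leb U. ?F z + ?F (cnj z))" by (rule integral_split[OF IV])
  also have "\<dots> = (LINT z|leb U. 2 * (cmod (w z))\<^sup>2)"
    by (rule Bochner_Integration.integral_cong) (simp_all add: e)
  finally show "(L2_norm (leb V) (sym_ext U s w))\<^sup>2 = 2 * (L2_norm (leb U) w)\<^sup>2"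
    by (simp add: L2_norm_sq)
qed

lemma sym_ext_diff: "(\<lambda>z. sym_ext U s f z - sym_ext U s f' z) = sym_ext U s (\<lambda>z. f z - f' z)"
  by (auto simp: sym_ext_def algebra_simps)

lemma sym_ext_bound:
  assumes s: "cmod s = 1" and w: "w \<in> L2 (leb U)"
  shows "L2_norm (leb V) (sym_ext U s w) \<le> 2 * L2_norm (leb U) w"
proof (rule power2_le_imp_le)
  show "(L2_norm (leb V) (sym_ext U s w))\<^sup>2 \<le> (2 * L2_norm (leb U) w)\<^sup>2"
    unfolding sym_ext_L2(2)[OF s w] by (simp add: power_mult_distrib)
qed simp

lemma L2_norm_leb_mono:
  assumes "A \<in> sets borel" "B \<in> sets borel" "A \<subseteq> B" "u \<in> L2 (leb B)"
  shows "L2_norm (leb A) u \<le> L2_norm (leb B) u"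
proof -
  have "integrable lborel (\<lambda>z. indicator A z *\<^sub>R (cmod (u z))\<^sup>2)" "integrable lborel (\<lambda>z. indicator B z *\<^sub>R (cmod (u z))\<^sup>2)"
    using L2D(2)[OF L2_leb_mono[OF assms]] L2D(2)[OF assms(4)] assms(1,2) by (simp_all add: integrable_leb)
  then have "(LINT z|lborel. indicator A z *\<^sub>R (cmod (u z))\<^sup>2) \<le> (LINT z|lborel. indicator B z *\<^sub>R (cmod (u z))\<^sup>2)"
    by (rule integral_mono) (use assms(3) in \<open>auto simp: indicator_def\<close>)
  then show ?thesis unfolding L2_norm_def integral_leb[OF assms(1)] integral_leb[OF assms(2)] by simp
qed

lemma fold_up_L2:
  assumes s: "cmod s = 1" and v: "v \<in> L2 (leb V)"
  shows "fold_up s v \<in> L2 (leb U)" "L2_norm (leb U) (fold_up s v) \<le> 2 * L2_norm (leb V) v"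
proof -
  let ?L = "{z \<in> V. Im z < 0}"
  have UV: "U \<subseteq> V" "?L \<subseteq> V" by (auto simp: U_def)
  have vU: "v \<in> L2 (leb U)" by (rule L2_leb_mono[OF Ub Vb UV(1) v])
  have vL: "v \<in> L2 (leb ?L)" by (rule L2_leb_mono[OF lower_borel Vb UV(2) v])
  have vc: "(\<lambda>z. v (cnj z)) \<in> L2 (leb U)" by (rule preserves_L2[OF preserves_cnj vL])
  have hm: "half_phase \<in> borel_measurable (leb U)" by (intro borel_measurable_leb half_phase_measurable)
  have 1: "(\<lambda>z. cnj (half_phase z) * v z) \<in> L2 (leb U)"
    by (rule L2_mult_bounded[OF vU, where B = 1]) (use hm in auto)
  have 2: "(\<lambda>z. half_phase z * v (cnj z)) \<in> L2 (leb U)"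
    by (rule L2_mult_bounded[OF vc, where B = 1]) (use hm in auto)
  show "fold_up s v \<in> L2 (leb U)" unfolding fold_up_def by (intro L2_add L2_cmult 1 2)
  have "L2_norm (leb U) (fold_up s v) \<le> L2_norm (leb U) (\<lambda>z. cnj (half_phase z) * v z) + L2_norm (leb U) (\<lambda>z. s * (half_phase z * v (cnj z)))"
    unfolding fold_up_def by (rule L2_triangle[OF 1 L2_cmult[OF 2]])
  also have "L2_norm (leb U) (\<lambda>z. cnj (half_phase z) * v z) = L2_norm (leb U) v" by (simp add: L2_norm_def norm_mult)
  also have "L2_norm (leb U) (\<lambda>z. s * (half_phase z * v (cnj z))) = L2_norm (leb U) (\<lambda>z. v (cnj z))" by (simp add: L2_norm_def norm_mult s)
  also have "\<dots> = L2_norm (leb ?L) v" by (rule preserves_L2_norm[OF preserves_cnj L2D(1)[OF vL]])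
  also have "L2_norm (leb U) v + L2_norm (leb ?L) v \<le> L2_norm (leb V) v + L2_norm (leb V) v"
    by (intro add_mono L2_norm_leb_mono Ub Vb lower_borel UV v)
  finally show "L2_norm (leb U) (fold_up s v) \<le> 2 * L2_norm (leb V) v" by simp
qed

lemma sym_ext_Rs_adjoint:
  assumes s: "cmod s = 1" "cnj s = s" and w: "w \<in> L2 (leb U)" and v: "v \<in> L2 (leb V)"
  shows "L2_inner (leb V) (sym_ext U s w) v = L2_inner (leb U) w (fold_up s v)"
proof -
  have "L2_inner (leb V) (sym_ext U s w) v = (LINT z|leb U. sym_ext U s w z * cnj (v z) + sym_ext U s w (cnj z) * cnj (v (cnj z)))"
    unfolding L2_inner_def by (rule integral_split[OF L2_int_cnj[OF sym_ext_L2(1)[OF s(1) w] v]])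
  also have "\<dots> = (LINT z|leb U. w z * cnj (fold_up s v z))"
    by (rule Bochner_Integration.integral_cong) (simp_all add: sym_ext_upper sym_ext_lower fold_up_def s algebra_simps)
  finally show ?thesis by (simp add: L2_inner_def)
qed

end

text \<open>Meant for \<open>t = n * slit_dist z - 1\<close>, where \<open>t + 1\<close> is the
  scaled distance: the product then bounds the derivative of the cutoff times a function of the size
  of the distance. Since \<open>t * flat 2 t = flat 1 t\<close>, it is at most
  \<open>1! + 2! = 3\<close>.\<close>

lemma flat_Suc_le: "(t + 1) * flat 2 t \<le> 3" "0 \<le> (t + 1) * flat 2 t"
proof -
  have "(t + 1) * flat 2 t = flat 1 t + flat 2 t \<and> (t + 1) * flat 2 t \<ge> 0"
  proof (cases "t > 0")
    case True
    then show ?thesis using flat_Suc[of t 1] by (simp add: algebra_simps numeral_2_eq_2)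
  qed simp
  then show "(t + 1) * flat 2 t \<le> 3" "0 \<le> (t + 1) * flat 2 t"
    using flat_le_fact[of 1 t] flat_le_fact[of 2 t] by (auto simp: numeral_2_eq_2)
qed

lemma flat_Suc_tendsto: "((\<lambda>t. (t + 1) * flat 2 t) \<longlongrightarrow> 0) at_top"
proof -
  have "((\<lambda>t. flat 1 t + flat 2 t) \<longlongrightarrow> 0 + 0) at_top"
    using flat_Suc_at_top[of 0] flat_Suc_at_top[of 1] by (intro tendsto_add) (simp_all add: numeral_2_eq_2)
  then have "((\<lambda>t. flat 1 t + flat 2 t) \<longlongrightarrow> 0) at_top" by simp
  then show ?thesis
  proof (rule Lim_transform_eventually)
    show "\<forall>\<^sub>F t in at_top. flat 1 t + flat 2 t = (t + 1) * flat 2 t"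
      using eventually_gt_at_top[of 0]
    proof eventually_elim
      case (elim t)
      then show ?case using flat_Suc[of t 1] by (simp add: algebra_simps numeral_2_eq_2)
    qed
  qed
qed

section \<open>Gauging in the slit plane and smoothed folding maps\<close>

lemma test_pd_eq_0:
  assumes "open S" "\<phi> \<in> test_functions S" "e \<in> Basis" "z \<notin> S"
  shows "\<phi> z = 0" "pd e \<phi> z = 0"
  by (rule test_compact[OF assms(2)], use assms(4) in blast,
      rule test_compact[OF test_pd[OF assms(1-3)]], use assms(4) in blast)

text \<open>The derivative of \<open>half_phase\<close> cancels the potential term. Outside
  \<open>S\<close>, where \<open>half_phase\<close> may jump, both sides are 0, so the formulas hold
  on the whole plane.\<close>

lemma half_phase_gauge:
  assumes S: "open S" "S \<subseteq> slit" and \<eta>: "\<eta> \<in> test_functions S"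
  shows "(\<lambda>z. half_phase z * \<eta> z) \<in> test_functions S"
    and "DA1 (\<lambda>z. half_phase z * \<eta> z) = (\<lambda>z. - \<i> * (half_phase z * pd 1 \<eta> z))"
    and "DA2 (\<lambda>z. half_phase z * \<eta> z) = (\<lambda>z. - \<i> * (half_phase z * pd \<i> \<eta> z))"
proof -
  show t: "(\<lambda>z. half_phase z * \<eta> z) \<in> test_functions S" by (intro test_mult smooth_on_half_phase S \<eta>)
  have *: "pd e (\<lambda>z. half_phase z * \<eta> z) z = half_phase z * pd e \<eta> z + \<i> * of_real (Re e * A1 z + Im e * A2 z) * half_phase z * \<eta> z"
    if e: "e \<in> Basis" for e z
  proof (cases "z \<in> S")
    case True
    then show ?thesis
      using S(2) by (intro pd_eqI has_derivative_mult half_phase_has_derivative test_has_derivative[OF \<eta>]) auto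
  next
    case False
    then show ?thesis using test_pd_eq_0[OF S(1) t e] test_pd_eq_0[OF S(1) \<eta> e] by simp
  qed
  show "DA1 (\<lambda>z. half_phase z * \<eta> z) = (\<lambda>z. - \<i> * (half_phase z * pd 1 \<eta> z))"
    "DA2 (\<lambda>z. half_phase z * \<eta> z) = (\<lambda>z. - \<i> * (half_phase z * pd \<i> \<eta> z))"
    unfolding DA1_def DA2_def using *[of 1] *[of \<i>] by (auto simp: fun_eq_iff Basis_complex algebra_simps)
qed

lemma L2_dominated_const:
  assumes fin: "finite_measure M" and f: "\<And>n. f n \<in> borel_measurable M" "u \<in> borel_measurable M"
    and B: "\<And>n. AE z in M. cmod (f n z - u z) \<le> B" and lim: "AE z in M. (\<lambda>n. f n z) \<longlonglongrightarrow> u z"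
  shows "(\<lambda>n. L2_norm M (\<lambda>z. f n z - u z)) \<longlonglongrightarrow> 0"
proof (rule L2_dominated[OF f _ B lim])
  interpret finite_measure M by fact
  show "integrable M (\<lambda>z. B\<^sup>2)" by simp
qed

text \<open>A smooth substitute for the folding map \<open>x + i * y -> x + i * |y|\<close>, which
  has a kink on the axis. For \<open>\<epsilon> > 0\<close> its values lie in the open upper
  half-plane, at distance at most \<open>\<epsilon>\<close> from the fold.\<close>

definition smooth_fold :: "real \<Rightarrow> complex \<Rightarrow> complex"
  where "smooth_fold \<epsilon> z = of_real (Re z) + \<i> * of_real (sqrt ((Im z)\<^sup>2 + \<epsilon>\<^sup>2))"

text \<open>The derivative of \<open>sqrt (y^2 + \<epsilon>^2)\<close> in \<open>y\<close>, a
  smoothed sign of \<open>y\<close>.\<close>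

definition fold_slope :: "real \<Rightarrow> complex \<Rightarrow> real"
  where "fold_slope \<epsilon> z = Im z / sqrt ((Im z)\<^sup>2 + \<epsilon>\<^sup>2)"

text \<open>Test functions of the mixed problem may live beyond the domain, since they only avoid
  \<open>C\<close>. Restricting to \<open>W\<close> removes that part; for small
  \<open>\<epsilon>\<close> this makes no jump, as they vanish near the outer boundary of
  \<open>U\<close>, which belongs to \<open>C\<close>.\<close>

definition cutoff_ext :: "complex set \<Rightarrow> real \<Rightarrow> cfun \<Rightarrow> cfun"
  where "cutoff_ext W \<epsilon> \<phi> = (\<lambda>z. if z \<in> W then \<phi> (smooth_fold \<epsilon> z) else 0)"

lemma smooth_on_smooth_fold: "\<epsilon> > 0 \<Longrightarrow> open S \<Longrightarrow> smooth_on (smooth_fold \<epsilon>) S"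
proof -
  assume e: "\<epsilon> > 0" and S: "open S"
  have "smooth_on (\<lambda>z. Im z * Im z + \<epsilon>\<^sup>2) S" by (intro smooth_on_add smooth_on_mult smooth_on_Im smooth_on_const S)
  then have "smooth_on (\<lambda>z. (Im z)\<^sup>2 + \<epsilon>\<^sup>2) S" by (simp add: power2_eq_square)
  then have "smooth_on (\<lambda>z. sqrt ((Im z)\<^sup>2 + \<epsilon>\<^sup>2)) S"
    by (rule smooth_on_sqrt[OF S, rotated]) (use e in \<open>auto intro: add_nonneg_pos\<close>)
  then show ?thesis unfolding smooth_fold_def
    by (intro smooth_on_add[OF S] smooth_on_mult[OF S] smooth_on_of_real[OF S] smooth_on_Re[OF S] smooth_on_const[OF S])
qed

lemma smooth_fold_has_derivative:
  assumes "\<epsilon> > 0"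
  shows "(smooth_fold \<epsilon> has_derivative (\<lambda>e. of_real (Re e) + \<i> * of_real (Im e * fold_slope \<epsilon> z))) (at z)"
proof -
  have p: "0 < (Im z)\<^sup>2 + \<epsilon>\<^sup>2" using assms by (auto intro: add_nonneg_pos)
  have i: "((\<lambda>z. (Im z)\<^sup>2 + \<epsilon>\<^sup>2) has_derivative (\<lambda>e. 2 * Im e * Im z)) (at z)"
    unfolding power2_eq_square
    by (rule derivative_eq_intros bounded_linear_imp_has_derivative[OF bounded_linear_Im] refl)+ (simp add: fun_eq_iff)
  have "((\<lambda>z. sqrt ((Im z)\<^sup>2 + \<epsilon>\<^sup>2)) has_derivative (\<lambda>e. (2 * Im e * Im z) * (inverse (sqrt ((Im z)\<^sup>2 + \<epsilon>\<^sup>2)) / 2))) (at z)"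
    by (rule DERIV_compose_FDERIV[OF DERIV_real_sqrt[OF p] i])
  also have "(\<lambda>e. (2 * Im e * Im z) * (inverse (sqrt ((Im z)\<^sup>2 + \<epsilon>\<^sup>2)) / 2)) = (\<lambda>e. Im e * fold_slope \<epsilon> z)"
    by (rule ext) (simp add: fold_slope_def inverse_eq_divide)
  finally show ?thesis unfolding smooth_fold_def
    by (intro has_derivative_add bounded_linear.has_derivative[OF bounded_linear_mult_right]
       bounded_linear.has_derivative[OF bounded_linear_of_real] bounded_linear_imp_has_derivative[OF bounded_linear_Re])
qed

lemma smooth_fold_pd:
  assumes "\<epsilon> > 0" "\<phi> \<in> test_functions T"
  shows "pd 1 (\<lambda>z. \<phi> (smooth_fold \<epsilon> z)) z = pd 1 \<phi> (smooth_fold \<epsilon> z)" "pd \<i> (\<lambda>z. \<phi> (smooth_fold \<epsilon> z)) z = of_real (fold_slope \<epsilon> z) * pd \<i> \<phi> (smooth_fold \<epsilon> z)"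
proof -
  note D = has_derivative_compose[OF smooth_fold_has_derivative[OF assms(1)] test_has_derivative[OF assms(2)]]
  show "pd 1 (\<lambda>z. \<phi> (smooth_fold \<epsilon> z)) z = pd 1 \<phi> (smooth_fold \<epsilon> z)" using pd_eqI[OF D, of 1] by simp
  interpret linear "\<lambda>e. pd e \<phi> (smooth_fold \<epsilon> z)" by (rule has_derivative_linear[OF test_has_derivative[OF assms(2)]])
  have e: "\<i> * of_real (fold_slope \<epsilon> z) = fold_slope \<epsilon> z *\<^sub>R \<i>" by (simp add: scaleR_conv_of_real)
  have "pd (\<i> * of_real (fold_slope \<epsilon> z)) \<phi> (smooth_fold \<epsilon> z) = fold_slope \<epsilon> z *\<^sub>R pd \<i> \<phi> (smooth_fold \<epsilon> z)" unfolding e by (rule scale)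
  then show "pd \<i> (\<lambda>z. \<phi> (smooth_fold \<epsilon> z)) z = of_real (fold_slope \<epsilon> z) * pd \<i> \<phi> (smooth_fold \<epsilon> z)"
    using pd_eqI[OF D, of \<i>] by (simp add: scaleR_conv_of_real)
qed

lemma smooth_fold_dist: "\<epsilon> \<ge> 0 \<Longrightarrow> cmod (smooth_fold \<epsilon> z - Complex (Re z) \<bar>Im z\<bar>) \<le> \<epsilon>"
proof -
  assume e: "\<epsilon> \<ge> 0"
  have "smooth_fold \<epsilon> z - Complex (Re z) \<bar>Im z\<bar> = \<i> * of_real (sqrt ((Im z)\<^sup>2 + \<epsilon>\<^sup>2) - \<bar>Im z\<bar>)"
    by (simp add: smooth_fold_def complex_eq_iff)
  moreover have "sqrt ((Im z)\<^sup>2 + \<epsilon>\<^sup>2) \<le> \<bar>Im z\<bar> + \<epsilon>"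
    using sqrt_add_le_add_sqrt[of "(Im z)\<^sup>2" "\<epsilon>\<^sup>2"] e by simp
  moreover have "\<bar>Im z\<bar> \<le> sqrt ((Im z)\<^sup>2 + \<epsilon>\<^sup>2)" by (rule real_le_rsqrt) simp
  ultimately show ?thesis by (simp add: norm_mult del: of_real_diff)
qed

lemma fold_slope_le: "\<bar>fold_slope \<epsilon> z\<bar> \<le> 1"
proof (cases "(Im z)\<^sup>2 + \<epsilon>\<^sup>2 = 0")
  case False
  then have "0 < (Im z)\<^sup>2 + \<epsilon>\<^sup>2" using sum_power2_ge_zero[of "Im z" \<epsilon>] by linarith
  moreover have "\<bar>Im z\<bar> \<le> sqrt ((Im z)\<^sup>2 + \<epsilon>\<^sup>2)" by (rule real_le_rsqrt) simp
  ultimately show ?thesis by (simp add: fold_slope_def divide_le_eq)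
qed (simp add: fold_slope_def)

text \<open>The normal form of a half-domain: the symmetry line on the real axis, the Neumann part
  on its positive half, and everything else on the boundary in \<open>C\<close>, including the
  origin.\<close>

locale sym_domain =
  fixes W V U N C :: "complex set"
  assumes W: "open W" "bounded W" "0 \<in> W" and symW: "\<And>z. z \<in> W \<Longrightarrow> cnj z \<in> W"
    and V_def: "V = punctured W" and U_def: "U = {z \<in> punctured W. 0 < Im z}"
    and N_def: "N = {z \<in> W. Im z = 0 \<and> 0 < Re z}" and C_eq: "C = frontier U - N"
begin

lemma V_open: "open V" "0 \<notin> V" "V \<in> sets borel" "bounded V"
  using W(1,2) by (auto simp: V_def punctured_def intro: bounded_subset)

lemma V_sym: "z \<in> V \<Longrightarrow> cnj z \<in> V"
  using symW by (auto simp: V_def punctured_def)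

lemma U_eq: "U = {z \<in> V. 0 < Im z}" "U = W \<inter> {z. 0 < Im z}"
  by (auto simp: U_def V_def punctured_def)

lemma U_open: "open U"
  unfolding U_eq(2) by (intro open_Int W open_Collect_less continuous_intros)

text \<open>Inside \<open>W\<close> the boundary of \<open>U\<close> lies on the real axis, so
  removing \<open>N\<close> from it amounts to removing the open set of points of \<open>W\<close>
  with positive real part.\<close>

lemma C_closed: "closed C"
proof -
  have "N = W \<inter> {z. 0 < Re z} \<inter> {z. Im z = 0}" by (auto simp: N_def)
  moreover have fr: "frontier U \<inter> W \<subseteq> {z. Im z = 0}"
  proof
    fix z assume z: "z \<in> frontier U \<inter> W"
    have cl: "closed {z. 0 \<le> Im z}" by (intro closed_Collect_le continuous_intros)
    have "closure U \<subseteq> {z. 0 \<le> Im z}" by (rule closure_minimal[OF _ cl]) (auto simp: U_eq)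
    with z have "0 \<le> Im z" by (auto simp: frontier_def)
    moreover have "z \<notin> U" using z U_open by (auto simp: frontier_def interior_open)
    ultimately show "z \<in> {z. Im z = 0}" using z by (auto simp: U_eq(2))
  qed
  ultimately have "C = frontier U - (W \<inter> {z. 0 < Re z})" unfolding C_eq by auto
  moreover have "open (W \<inter> {z. 0 < Re z})" by (intro open_Int W open_Collect_less continuous_intros)
  ultimately show ?thesis by (simp add: closed_Diff)
qed

text \<open>A point of \<open>W\<close> near \<open>z\<close> can be reflected into the closed upper
  half-plane without moving away from \<open>z\<close>, and then lifted slightly into the open
  one.\<close>

lemma closure_upper:
  assumes "z \<in> closure W" "0 \<le> Im z" shows "z \<in> closure U"
  unfolding closure_approachable
proof (intro allI impI)
  fix e :: real assume e: "0 < e"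
  obtain y where y: "y \<in> W" "dist y z < e / 2" using assms(1) e unfolding closure_approachable by (meson half_gt_zero)
  obtain x where x: "x \<in> W" "0 \<le> Im x" "dist x z < e / 2"
  proof (cases "0 \<le> Im y")
    case True then show ?thesis using that[of y] y by blast
  next
    case False
    have "cmod (cnj y - z) \<le> cmod (y - z)"
      unfolding cmod_def using False assms(2)
      using mult_nonpos_nonneg[of "Im y" "Im z"]
      by (intro real_sqrt_le_mono add_mono order_refl) (simp_all add: power2_eq_square algebra_simps)
    then show ?thesis using that[of "cnj y"] symW[OF y(1)] y(2) False by (simp add: dist_norm)
  qed
  obtain d where d: "d > 0" "ball x d \<subseteq> W" using W(1) x(1) open_contains_ball by blast
  define m where "m = min (d / 2) (e / 2)"
  have m: "0 < m" "m < d" "m \<le> e / 2" using d e by (auto simp: m_def)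
  have "dist x (x + \<i> * of_real m) = m" using m by (simp add: dist_norm norm_mult)
  then have "x + \<i> * of_real m \<in> W" using d m by auto
  then have "x + \<i> * of_real m \<in> U" using x(2) m by (simp add: U_eq(2))
  moreover have "dist (x + \<i> * of_real m) z < e"
    using dist_triangle[of "x + \<i> * of_real m" z x] \<open>dist x _ = m\<close> m x(3) by (simp add: dist_commute)
  ultimately show "\<exists>y\<in>U. dist y z < e" by blast
qed

lemma in_C: "z \<in> closure W \<Longrightarrow> 0 \<le> Im z \<Longrightarrow> z \<notin> U \<Longrightarrow> z \<notin> N \<Longrightarrow> z \<in> C"
  using closure_upper U_open by (auto simp: C_eq frontier_def interior_open)

lemma C_slit: "W \<inter> slit \<subseteq> - C"
proof
  fix z assume z: "z \<in> W \<inter> slit"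
  show "z \<in> - C"
  proof
    assume "z \<in> C"
    then have fr: "z \<in> closure U" "z \<notin> U" "z \<notin> N" using U_open by (auto simp: C_eq frontier_def interior_open)
    have cl: "closed {z. 0 \<le> Im z}" by (intro closed_Collect_le continuous_intros)
    have "closure U \<subseteq> {z. 0 \<le> Im z}" by (rule closure_minimal[OF _ cl]) (auto simp: U_eq)
    with fr z show False by (auto simp: U_eq(2) N_def slit_def)
  qed
qed

lemma S_open: "open (W \<inter> slit)" "W \<inter> slit \<subseteq> slit" "W \<inter> slit \<subseteq> V"
  using W(1) open_slit slit_nonzero by (auto simp: V_def punctured_def)

text \<open>\<open>\<delta>\<close> separates the support \<open>K\<close> from \<open>C\<close>. If
  the smoothed fold of \<open>z\<close> lies in \<open>K\<close>, the true fold is within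
  \<open>\<epsilon> < \<delta>\<close> of it and avoids \<open>C\<close>; so it lies in
  \<open>U\<close> or on the Neumann ray, and \<open>z\<close> lies in \<open>W\<close> off the
  Dirichlet ray.\<close>

lemma cutoff_ext_test:
  assumes \<phi>: "\<phi> \<in> test_functions (- C)"
  obtains \<delta> where "\<delta> > 0" "\<And>\<epsilon>. 0 < \<epsilon> \<Longrightarrow> \<epsilon> < \<delta> \<Longrightarrow> cutoff_ext W \<epsilon> \<phi> \<in> test_functions (W \<inter> slit)"
proof -
  obtain K where K: "compact K" "K \<subseteq> - C" "\<And>z. z \<notin> K \<Longrightarrow> \<phi> z = 0" by (rule test_compact[OF \<phi>]) blast
  obtain \<delta> where \<delta>: "\<delta> > 0" "\<And>x y. x \<in> K \<Longrightarrow> y \<in> C \<Longrightarrow> \<delta> \<le> dist x y"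
    using separate_compact_closed[OF K(1) C_closed] K(2) by blast
  have "cutoff_ext W \<epsilon> \<phi> \<in> test_functions (W \<inter> slit)" if e: "0 < \<epsilon>" "\<epsilon> < \<delta>" for \<epsilon>
  proof (rule test_functionsI[OF S_open(1), where K = "closure W \<inter> smooth_fold \<epsilon> -` K"])
    have sm: "smooth_on (smooth_fold \<epsilon>) UNIV" by (rule smooth_on_smooth_fold[OF e(1) open_UNIV])
    have "smooth_on (\<lambda>z. \<phi> (smooth_fold \<epsilon> z)) (W \<inter> slit)"
      by (rule smooth_on_compose[OF S_open(1) smooth_on_subset[OF sm] test_smooth_on[OF \<phi>]]) simp
    then show "smooth_on (cutoff_ext W \<epsilon> \<phi>) (W \<inter> slit)"
      by (rule smooth_on_cong[OF S_open(1), rotated]) (simp add: cutoff_ext_def)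
    have "closed (smooth_fold \<epsilon> -` K)"
      by (rule closed_vimage[OF compact_imp_closed[OF K(1)] smooth_on_continuous[OF sm]])
    moreover have "compact (closure W)" using W(2) by (simp add: compact_closure)
    ultimately show "compact (closure W \<inter> smooth_fold \<epsilon> -` K)" by (rule compact_Int_closed[rotated])
    show "closure W \<inter> smooth_fold \<epsilon> -` K \<subseteq> W \<inter> slit"
    proof
      fix z assume z: "z \<in> closure W \<inter> smooth_fold \<epsilon> -` K"
      let ?p = "Complex (Re z) \<bar>Im z\<bar>"
      have pz: "?p = z \<or> ?p = cnj z" by (auto simp: complex_eq_iff abs_if)
      have "dist (smooth_fold \<epsilon> z) ?p \<le> \<epsilon>" using smooth_fold_dist[of \<epsilon> z] e by (simp add: dist_norm)
      then have pC: "?p \<notin> C" using \<delta>(2)[of "smooth_fold \<epsilon> z" ?p] z e by force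
      have "cnj ` closure W \<subseteq> closure W"
      proof (rule image_closure_subset)
        show "continuous_on (closure W) cnj" by (intro continuous_intros)
        show "cnj ` W \<subseteq> closure W" using symW closure_subset[of W] by blast
      qed simp
      then have "?p \<in> closure W" using pz z by auto
      with pC have pUN: "?p \<in> U \<or> ?p \<in> N" using in_C[of ?p] by auto
      then have pW: "?p \<in> W" by (auto simp: U_eq(2) N_def)
      then have "z \<in> W" using pz symW[of "cnj z"] by auto
      moreover have "z \<in> slit"
        using pUN by (auto simp: slit_def U_eq(2) N_def)
      ultimately show "z \<in> W \<inter> slit" by simp
    qed
    show "cutoff_ext W \<epsilon> \<phi> z = 0" if "z \<notin> closure W \<inter> smooth_fold \<epsilon> -` K" for z
      using that K(3)[of "smooth_fold \<epsilon> z"] closure_subset[of W] by (auto simp: cutoff_ext_def)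
  qed
  then show ?thesis using that \<delta>(1) by blast
qed

lemma sym_ext_upper_lower: "z \<in> V \<Longrightarrow> Im z \<noteq> 0 \<Longrightarrow> sym_ext U s w z = (if 0 < Im z then 1 else s) * half_phase z * w (Complex (Re z) \<bar>Im z\<bar>)"
proof -
  assume z: "z \<in> V" "Im z \<noteq> 0"
  show ?thesis
  proof (cases "0 < Im z")
    case True
    then have "Complex (Re z) \<bar>Im z\<bar> = z" by (simp add: complex_eq_iff)
    then show ?thesis using True z by (simp add: sym_ext_def U_eq(1))
  next
    case False
    then have "Complex (Re z) \<bar>Im z\<bar> = cnj z" by (simp add: complex_eq_iff)
    then show ?thesis using False z V_sym[OF z(1)] by (simp add: sym_ext_def U_eq(1))
  qed
qed

lemma pd_cutoff_ext:
  assumes e: "\<epsilon> > 0" and \<phi>: "\<phi> \<in> test_functions T" and z: "z \<in> W"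
  shows "pd 1 (cutoff_ext W \<epsilon> \<phi>) z = pd 1 \<phi> (smooth_fold \<epsilon> z)" "pd \<i> (cutoff_ext W \<epsilon> \<phi>) z = of_real (fold_slope \<epsilon> z) * pd \<i> \<phi> (smooth_fold \<epsilon> z)"
proof -
  have d: "(\<lambda>z. \<phi> (smooth_fold \<epsilon> z)) differentiable (at z)"
    by (rule differentiableI_at[OF has_derivative_compose[OF smooth_fold_has_derivative[OF e] test_has_derivative[OF \<phi>]]])
  have "(cutoff_ext W \<epsilon> \<phi> has_derivative (\<lambda>e. pd e (\<lambda>z. \<phi> (smooth_fold \<epsilon> z)) z)) (at z)"
    by (rule has_derivative_transform_within_open[OF has_derivative_pd[OF d] W(1) z]) (simp add: cutoff_ext_def)
  from pd_eqI[OF this] show "pd 1 (cutoff_ext W \<epsilon> \<phi>) z = pd 1 \<phi> (smooth_fold \<epsilon> z)"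
    "pd \<i> (cutoff_ext W \<epsilon> \<phi>) z = of_real (fold_slope \<epsilon> z) * pd \<i> \<phi> (smooth_fold \<epsilon> z)"
    by (simp_all add: smooth_fold_pd[OF e \<phi>])
qed

text \<open>The approximants are \<open>half_phase\<close> times
  \<open>cutoff_ext W \<epsilon> \<phi>\<close>, smooth across the Neumann ray. Functions and
  derivatives are bounded uniformly in \<open>\<epsilon>\<close> and the domain has finite measure,
  so limits at points off the axis suffice.\<close>

lemma sym_ext_core:
  assumes \<phi>: "\<phi> \<in> test_functions (- C)"
  shows "ABcl V (sym_ext U 1 \<phi>) (\<lambda>z. - \<i> * sym_ext U 1 (pd 1 \<phi>) z) (\<lambda>z. - \<i> * sym_ext U (-1) (pd \<i> \<phi>) z)"
proof -
  have fin: "finite_measure (leb V)" by (rule finite_measure_leb[OF V_open(3,4)])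
  have T: "open (- C)" using C_closed by (simp add: open_Compl)
  have p1: "pd 1 \<phi> \<in> test_functions (- C)" and p2: "pd \<i> \<phi> \<in> test_functions (- C)"
    by (auto intro!: test_pd T \<phi> simp: Basis_complex)
  obtain B0 where B0: "B0 \<ge> 0" "\<And>z. cmod (\<phi> z) \<le> B0" by (rule test_bounded[OF \<phi>]) blast
  obtain B1 where B1: "B1 \<ge> 0" "\<And>z. cmod (pd 1 \<phi> z) \<le> B1" by (rule test_bounded[OF p1]) blast
  obtain B2 where B2: "B2 \<ge> 0" "\<And>z. cmod (pd \<i> \<phi> z) \<le> B2" by (rule test_bounded[OF p2]) blast
  obtain \<delta> where \<delta>: "\<delta> > 0" "\<And>\<epsilon>. 0 < \<epsilon> \<Longrightarrow> \<epsilon> < \<delta> \<Longrightarrow> cutoff_ext W \<epsilon> \<phi> \<in> test_functions (W \<inter> slit)"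
    by (rule cutoff_ext_test[OF \<phi>]) blast
  \<comment> \<open>The offset 2 keeps \<open>\<epsilon> n\<close> strictly below
    \<open>\<delta>\<close> already for \<open>n = 0\<close>.\<close>
  define \<epsilon> where "\<epsilon> n = \<delta> / real (n + 2)" for n
  have \<epsilon>: "0 < \<epsilon> n" "\<epsilon> n < \<delta>" for n
    using \<delta>(1) mult_strict_left_mono[of 1 "real (n + 2)" \<delta>] by (simp_all add: \<epsilon>_def pos_divide_less_eq)
  have \<epsilon>0: "\<epsilon> \<longlonglongrightarrow> 0"
    unfolding \<epsilon>_def using LIMSEQ_ignore_initial_segment[OF lim_const_over_n, of \<delta> 2] by simp
  define \<eta> where "\<eta> n = cutoff_ext W (\<epsilon> n) \<phi>" for n
  have \<eta>: "\<eta> n \<in> test_functions (W \<inter> slit)" for n unfolding \<eta>_def by (rule \<delta>(2)[OF \<epsilon>])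
  note gauge = half_phase_gauge[OF S_open(1,2) \<eta>]
  have gt: "(\<lambda>z. half_phase z * \<eta> n z) \<in> test_functions V" for n by (rule test_mono[OF gauge(1) S_open(3)])
  have VW: "z \<in> V \<Longrightarrow> z \<in> W" for z by (auto simp: V_def punctured_def)
  let ?p = "\<lambda>z. Complex (Re z) \<bar>Im z\<bar>"
  have smooth_fold_lim: "(\<lambda>n. smooth_fold (\<epsilon> n) z) \<longlonglongrightarrow> ?p z" for z
  proof (rule Lim_null_comparison[OF always_eventually \<epsilon>0, THEN LIM_zero_cancel])
    show "\<forall>n. norm (smooth_fold (\<epsilon> n) z - ?p z) \<le> \<epsilon> n" using smooth_fold_dist \<epsilon>(1) less_imp_le by blast
  qed
  have lim: "(\<lambda>n. \<psi> (smooth_fold (\<epsilon> n) z)) \<longlonglongrightarrow> \<psi> (?p z)" if "\<psi> \<in> test_functions (- C)" for \<psi> z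
    by (rule isCont_tendsto_compose[OF _ smooth_fold_lim])
      (use test_continuous[OF that, of UNIV] in \<open>simp add: continuous_on_eq_continuous_at\<close>)
  \<comment> \<open>The smoothed sign tends to the sign of \<open>Im z\<close>; hence the value
    \<open>s = -1\<close> for the derivative across the axis.\<close>
  have fold_slope_lim: "(\<lambda>n. fold_slope (\<epsilon> n) z) \<longlonglongrightarrow> (if 0 < Im z then 1 else -1)" if "Im z \<noteq> 0" for z
  proof -
    have "(\<lambda>n. Im z / sqrt ((Im z)\<^sup>2 + (\<epsilon> n)\<^sup>2)) \<longlonglongrightarrow> Im z / sqrt ((Im z)\<^sup>2 + 0\<^sup>2)"
      by (intro tendsto_intros \<epsilon>0) (use that in simp)
    then show ?thesis using that by (auto simp: fold_slope_def)
  qed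
  have AEV: "AE z in leb V. z \<in> V \<and> Im z \<noteq> 0"
    unfolding AE_leb[OF V_open(3)] using AE_Im_nonzero by eventually_elim simp
  have L: "\<phi> \<in> L2 (leb U)" "pd 1 \<phi> \<in> L2 (leb U)" "pd \<i> \<phi> \<in> L2 (leb U)"
    using DN_test_L2[OF U_open C_closed \<phi>] by auto
  have EL: "sym_ext U s w \<in> L2 (leb V)" if "s = 1 \<or> s = -1" "w \<in> L2 (leb U)" for s w
    using sym_ext_L2(1)[OF V_open(3) V_sym, of s w] that unfolding U_eq(1) by auto
  note gL = AB_test_L2[OF V_open(1,2) gt]
  show ?thesis
  proof (rule form_graphI_seq[of "\<lambda>n z. half_phase z * \<eta> n z", OF gt])
    show "sym_ext U 1 \<phi> \<in> L2 (leb V)" "(\<lambda>z. - \<i> * sym_ext U 1 (pd 1 \<phi>) z) \<in> L2 (leb V)" "(\<lambda>z. - \<i> * sym_ext U (- 1) (pd \<i> \<phi>) z) \<in> L2 (leb V)"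
      by (intro L2_cmult EL L; simp)+
    then have m: "sym_ext U 1 \<phi> \<in> borel_measurable (leb V)" "(\<lambda>z. - \<i> * sym_ext U 1 (pd 1 \<phi>) z) \<in> borel_measurable (leb V)"
      "(\<lambda>z. - \<i> * sym_ext U (- 1) (pd \<i> \<phi>) z) \<in> borel_measurable (leb V)" by (auto dest: L2D(1))
    have bd: "cmod (x - y) \<le> B + B" if "cmod x \<le> B" "cmod y \<le> B" for x y B
      using norm_triangle_ineq4[of x y] that by linarith
    show "(\<lambda>n. L2_norm (leb V) (\<lambda>z. half_phase z * \<eta> n z - sym_ext U 1 \<phi> z)) \<longlonglongrightarrow> 0"
    proof (rule L2_dominated_const[OF fin _ m(1), where B = "B0 + B0"])
      show "AE z in leb V. cmod (half_phase z * \<eta> n z - sym_ext U 1 \<phi> z) \<le> B0 + B0" for n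
        using AEV by eventually_elim (intro bd, use B0 in \<open>auto simp: sym_ext_upper_lower norm_mult \<eta>_def cutoff_ext_def\<close>)
      show "AE z in leb V. (\<lambda>n. half_phase z * \<eta> n z) \<longlonglongrightarrow> sym_ext U 1 \<phi> z"
        using AEV
      proof eventually_elim
        case (elim z)
        then show ?case
          using tendsto_mult[OF tendsto_const lim[OF \<phi>], of "half_phase z" z] VW[of z] by (auto simp: sym_ext_upper_lower \<eta>_def cutoff_ext_def)
      qed
    qed (use gL in \<open>auto dest: L2D(1)\<close>)
    show "(\<lambda>n. L2_norm (leb V) (\<lambda>z. DA1 (\<lambda>z. half_phase z * \<eta> n z) z - - \<i> * sym_ext U 1 (pd 1 \<phi>) z)) \<longlonglongrightarrow> 0"
    proof (rule L2_dominated_const[OF fin _ m(2), where B = "B1 + B1"])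
      show "AE z in leb V. cmod (DA1 (\<lambda>z. half_phase z * \<eta> n z) z - - \<i> * sym_ext U 1 (pd 1 \<phi>) z) \<le> B1 + B1" for n
        unfolding gauge(2) using AEV
        by eventually_elim (intro bd, use B1 VW in \<open>auto simp: sym_ext_upper_lower norm_mult \<eta>_def pd_cutoff_ext[OF \<epsilon>(1) \<phi>]\<close>)
      show "AE z in leb V. (\<lambda>n. DA1 (\<lambda>z. half_phase z * \<eta> n z) z) \<longlonglongrightarrow> - \<i> * sym_ext U 1 (pd 1 \<phi>) z"
        unfolding gauge(2) using AEV
      proof eventually_elim
        case (elim z)
        then show ?case
          using tendsto_mult[OF tendsto_const lim[OF p1], of "- \<i> * half_phase z" z] VW[of z]
          by (auto simp: sym_ext_upper_lower \<eta>_def pd_cutoff_ext[OF \<epsilon>(1) \<phi>] mult.assoc)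
      qed
    qed (use gL in \<open>auto dest: L2D(1)\<close>)
    show "(\<lambda>n. L2_norm (leb V) (\<lambda>z. DA2 (\<lambda>z. half_phase z * \<eta> n z) z - - \<i> * sym_ext U (-1) (pd \<i> \<phi>) z)) \<longlonglongrightarrow> 0"
    proof (rule L2_dominated_const[OF fin _ m(3), where B = "B2 + B2"])
      have le: "\<bar>fold_slope \<epsilon> z\<bar> * cmod (pd \<i> \<phi> w) \<le> B2" for \<epsilon> z w
        using mult_mono[OF fold_slope_le[of \<epsilon> z] B2(2)[of w]] by simp
      show "AE z in leb V. cmod (DA2 (\<lambda>z. half_phase z * \<eta> n z) z - - \<i> * sym_ext U (-1) (pd \<i> \<phi>) z) \<le> B2 + B2" for n
        unfolding gauge(3) using AEV
        by eventually_elim (intro bd, use B2 VW le in \<open>auto simp: sym_ext_upper_lower norm_mult \<eta>_def pd_cutoff_ext[OF \<epsilon>(1) \<phi>]\<close>)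
      show "AE z in leb V. (\<lambda>n. DA2 (\<lambda>z. half_phase z * \<eta> n z) z) \<longlonglongrightarrow> - \<i> * sym_ext U (-1) (pd \<i> \<phi>) z"
        unfolding gauge(3) using AEV
      proof eventually_elim
        case (elim z)
        then have "(\<lambda>n. - \<i> * half_phase z * (of_real (fold_slope (\<epsilon> n) z) * pd \<i> \<phi> (smooth_fold (\<epsilon> n) z))) \<longlonglongrightarrow>
           - \<i> * half_phase z * (of_real (if 0 < Im z then 1 else -1) * pd \<i> \<phi> (?p z))"
          by (intro tendsto_mult tendsto_const tendsto_of_real fold_slope_lim lim[OF p2]) simp
        then show ?case using elim VW[of z]
          by (auto simp: sym_ext_upper_lower \<eta>_def pd_cutoff_ext[OF \<epsilon>(1) \<phi>] mult.assoc split: if_splits)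
      qed
    qed (use gL in \<open>auto dest: L2D(1)\<close>)
  qed
qed

lemma sym_ext_cl:
  assumes "DNcl U C w k l"
  shows "ABcl V (sym_ext U 1 w) (\<lambda>z. - \<i> * sym_ext U 1 k z) (\<lambda>z. - \<i> * sym_ext U (-1) l z)"
proof (rule form_graph_transfer[OF assms DN_test_L2[OF U_open C_closed] AB_test_L2[OF V_open(1,2)],
    where J = "sym_ext U 1" and A = "\<lambda>k l z. - \<i> * sym_ext U 1 k z" and B = "\<lambda>k l z. - \<i> * sym_ext U (-1) l z" and c = 2])
  have *: "sym_ext U s f \<in> L2 (leb V) \<and> L2_norm (leb V) (\<lambda>z. sym_ext U s f z - sym_ext U s f' z) \<le> 2 * L2_norm (leb U) (\<lambda>z. f z - f' z)"
    if "s = 1 \<or> s = -1" "f \<in> L2 (leb U)" "f' \<in> L2 (leb U)" for s f f'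
  proof -
    have s: "cmod s = 1" using that(1) by auto
    have 1: "sym_ext U s f \<in> L2 (leb V)" using sym_ext_L2(1)[OF V_open(3) V_sym s, folded U_eq(1), OF _ that(2)] by blast
    have 2: "L2_norm (leb V) (sym_ext U s (\<lambda>z. f z - f' z)) \<le> 2 * L2_norm (leb U) (\<lambda>z. f z - f' z)"
      using sym_ext_bound[OF V_open(3) V_sym s, folded U_eq(1), OF _ L2_diff[OF that(2,3)]] by blast
    have 3: "(\<lambda>z. sym_ext U s f z - sym_ext U s f' z) = sym_ext U s (\<lambda>z. f z - f' z)"
      using sym_ext_diff[OF V_open(3) V_sym, folded U_eq(1)] by blast
    show ?thesis unfolding 3 using 1 2 by blast
  qed
  have n: "L2_norm (leb V) (\<lambda>z. - \<i> * f z - - \<i> * f' z) = L2_norm (leb V) (\<lambda>z. f z - f' z)" for f f'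
    using L2_norm_cmult[of "leb V" "- \<i>" "\<lambda>z. f z - f' z"] by (simp add: right_diff_distrib)
  have up: "a \<le> 2 * (b + c)" "a \<le> 2 * (c + b)" if "a \<le> 2 * b" "0 \<le> c" for a b c :: real
    using that by simp_all
  show "sym_ext U 1 f \<in> L2 (leb V) \<and> L2_norm (leb V) (\<lambda>z. sym_ext U 1 f z - sym_ext U 1 f' z) \<le> 2 * L2_norm (leb U) (\<lambda>z. f z - f' z)"
    if "f \<in> L2 (leb U)" "f' \<in> L2 (leb U)" for f f' using *[of 1] that by simp
  show "(\<lambda>z. - \<i> * sym_ext U 1 f z) \<in> L2 (leb V) \<and> L2_norm (leb V) (\<lambda>z. - \<i> * sym_ext U 1 f z - - \<i> * sym_ext U 1 f' z) \<le> 2 * (L2_norm (leb U) (\<lambda>z. f z - f' z) + L2_norm (leb U) (\<lambda>z. k z - k' z))"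
    if "f \<in> L2 (leb U)" "f' \<in> L2 (leb U)" "k \<in> L2 (leb U)" "k' \<in> L2 (leb U)" for f f' k k'
    unfolding n using *[of 1 f f'] that(1,2) by (intro conjI up L2_cmult) auto
  show "(\<lambda>z. - \<i> * sym_ext U (-1) k z) \<in> L2 (leb V) \<and> L2_norm (leb V) (\<lambda>z. - \<i> * sym_ext U (-1) k z - - \<i> * sym_ext U (-1) k' z) \<le> 2 * (L2_norm (leb U) (\<lambda>z. f z - f' z) + L2_norm (leb U) (\<lambda>z. k z - k' z))"
    if "f \<in> L2 (leb U)" "f' \<in> L2 (leb U)" "k \<in> L2 (leb U)" "k' \<in> L2 (leb U)" for f f' k k'
    unfolding n using *[of "-1" k k'] that(3,4) by (intro conjI up L2_cmult) auto
  show "ABcl V (sym_ext U 1 \<phi>) (\<lambda>z. - \<i> * sym_ext U 1 (pd 1 \<phi>) z) (\<lambda>z. - \<i> * sym_ext U (-1) (pd \<i> \<phi>) z)"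
    if "\<phi> \<in> test_functions (- C)" for \<phi> by (rule sym_ext_core[OF that])
qed

end

text \<open>Unlike the distance to the slit, this function is smooth off \<open>0\<close>; it vanishes quadratically at the slit.\<close>

definition slit_dist :: "complex \<Rightarrow> real"
  where "slit_dist z = cmod z + Re z"

lemma slit_dist_pos: "z \<in> slit \<longleftrightarrow> 0 < slit_dist z"
proof
  assume z: "z \<in> slit"
  show "0 < slit_dist z"
  proof (cases "Im z = 0")
    case True
    then show ?thesis using z by (simp add: slit_def slit_dist_def cmod_def)
  next
    case False
    then have "(Re z)\<^sup>2 < (cmod z)\<^sup>2" by (simp add: cmod_power2)
    then have "\<bar>Re z\<bar> < cmod z" using power2_less_imp_less[of "\<bar>Re z\<bar>" "cmod z"] by simp
    then show ?thesis by (simp add: slit_dist_def)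
  qed
next
  assume *: "0 < slit_dist z"
  show "z \<in> slit"
  proof (rule ccontr)
    assume "z \<notin> slit"
    then have "Im z = 0" "Re z \<le> 0" by (auto simp: slit_def)
    then have "cmod z = - Re z" by (simp add: cmod_def)
    then show False using * by (simp add: slit_dist_def)
  qed
qed

lemma smooth_on_norm: "open S \<Longrightarrow> 0 \<notin> S \<Longrightarrow> smooth_on (\<lambda>z::complex. cmod z) S"
proof -
  assume S: "open S" "0 \<notin> S"
  have "smooth_on (\<lambda>z. Re z * Re z + Im z * Im z) S"
    by (intro smooth_on_add[OF S(1)] smooth_on_mult[OF S(1)] smooth_on_Re[OF S(1)] smooth_on_Im[OF S(1)])
  then have "smooth_on (\<lambda>z. sqrt (Re z * Re z + Im z * Im z)) S"
  proof (rule smooth_on_sqrt[OF S(1), rotated])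
    fix z assume "z \<in> S"
    then have "z \<noteq> 0" using S(2) by auto
    then have "0 < (cmod z)\<^sup>2" by simp
    then show "0 < Re z * Re z + Im z * Im z" by (simp add: cmod_power2 power2_eq_square[of "Re z"] power2_eq_square[of "Im z"])
  qed
  moreover have "sqrt (Re z * Re z + Im z * Im z) = cmod z" for z by (simp add: cmod_def power2_eq_square)
  ultimately show ?thesis by simp
qed

lemma smooth_on_slit_dist: "open S \<Longrightarrow> 0 \<notin> S \<Longrightarrow> smooth_on slit_dist S"
  unfolding slit_dist_def[abs_def] by (intro smooth_on_add smooth_on_norm smooth_on_Re)

lemma slit_dist_has_derivative:
  "z \<noteq> 0 \<Longrightarrow> (slit_dist has_derivative (\<lambda>e. e \<bullet> sgn z + Re e)) (at z)"
  unfolding slit_dist_def[abs_def]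
  using has_derivative_norm[of z] by (intro has_derivative_add bounded_linear_imp_has_derivative[OF bounded_linear_Re]) (simp add: inner_commute)

text \<open>This is why cutting off near the slit costs no energy in the limit.\<close>

lemma slit_dist_pd_bound:
  assumes lip: "\<And>x y. cmod (\<Phi> x - \<Phi> y) \<le> L * cmod (x - y)" "L \<ge> 0"
    and zero: "\<And>x. x \<le> 0 \<Longrightarrow> \<Phi> (complex_of_real x) = 0" and z: "z \<in> slit" and e: "e \<in> Basis"
  shows "\<bar>pd e slit_dist z\<bar> * cmod (\<Phi> z) \<le> 2 * L * slit_dist z"
proof -
  define r x y where "r = cmod z" and "x = Re z" and "y = \<bar>Im z\<bar>"
  have nz: "z \<noteq> 0" using z by (rule slit_nonzero)
  have r: "r > 0" "\<bar>x\<bar> \<le> r" "y \<le> r" "y \<ge> 0" "r * r = x * x + y * y"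
    using nz abs_Re_le_cmod[of z] abs_Im_le_cmod[of z] cmod_power2[of z] by (simp_all add: r_def x_def y_def power2_eq_square)
  have sd: "slit_dist z = r + x" by (simp add: slit_dist_def r_def x_def)
  have pd: "pd e slit_dist z = e \<bullet> sgn z + Re e" by (rule pd_eqI[OF slit_dist_has_derivative[OF nz]])
  \<comment> \<open>Up to sign the partial derivatives of \<open>r + x\<close> are
    \<open>(r + x) / r\<close> and \<open>y / r\<close>.\<close>
  have P: "\<bar>pd e slit_dist z\<bar> * r \<le> max (r + x) y"
  proof -
    have "pd 1 slit_dist z = x / r + 1" "\<bar>pd \<i> slit_dist z\<bar> = y / r"
      using pd_eqI[OF slit_dist_has_derivative[OF nz], of 1] pd_eqI[OF slit_dist_has_derivative[OF nz], of \<i>] r(1)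
      by (simp_all add: inner_complex_def sgn_div_norm r_def x_def y_def divide_inverse abs_mult mult.commute)
    then have "pd 1 slit_dist z * r = r + x" and i: "\<bar>pd \<i> slit_dist z\<bar> * r = y"
      using r(1) by (simp_all add: field_simps)
    then have "\<bar>pd 1 slit_dist z\<bar> * r = \<bar>r + x\<bar>" using r(1) by (metis abs_mult abs_of_pos)
    then have "\<bar>pd 1 slit_dist z\<bar> * r = r + x" "\<bar>pd \<i> slit_dist z\<bar> * r = y" using i r(2) by auto
    then show ?thesis using e by (auto simp: Basis_complex)
  qed
  show ?thesis
  \<comment> \<open>The nearest zero available is 0 in the right half-plane and the projection
    \<open>x\<close> in the left one, at distance \<open>r\<close> and \<open>y\<close>.\<close>
  proof (cases "x \<ge> 0")
    case True
    have "cmod (\<Phi> z) \<le> L * r" using lip(1)[of z 0] zero[of 0] by (simp add: r_def)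
    then have "\<bar>pd e slit_dist z\<bar> * cmod (\<Phi> z) \<le> \<bar>pd e slit_dist z\<bar> * (L * r)" by (intro mult_left_mono) auto
    also have "\<dots> = L * (\<bar>pd e slit_dist z\<bar> * r)" by simp
    also have "\<dots> \<le> L * (2 * (r + x))" using P r True lip(2) by (intro mult_left_mono) auto
    finally show ?thesis by (simp add: sd algebra_simps)
  next
    case False
    have "cmod (\<Phi> z) \<le> L * cmod (z - of_real x)" using lip(1)[of z "of_real x"] zero[of x] False by simp
    also have "z - of_real x = \<i> * of_real (Im z)" by (simp add: x_def complex_eq_iff)
    finally have F: "cmod (\<Phi> z) \<le> L * y" by (simp add: y_def norm_mult)
    have s: "r + x \<ge> 0" using r by linarith
    have "(\<bar>pd e slit_dist z\<bar> * y) * r \<le> max (r + x) y * y"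
      using mult_right_mono[OF P r(4)] by (simp add: algebra_simps)
    also have "\<dots> \<le> 2 * (r + x) * r"
    proof -
      have "(r + x) * y \<le> 2 * (r + x) * r" using mult_left_mono[OF r(3) s] mult_nonneg_nonneg[OF s, of r] r(1) by (simp add: algebra_simps)
      moreover have "y * y \<le> 2 * (r + x) * r"
      proof -
        \<comment> \<open>On the left \<open>r + x\<close> is only of the order
          \<open>y^2 / r\<close>; this factorisation bounds \<open>y^2\<close> by it.\<close>
        have "y * y = (r + x) * (r - x)" using r(5) by (simp add: algebra_simps)
        also have "\<dots> \<le> (r + x) * (2 * r)" using r(2) s by (intro mult_left_mono) auto
        finally show ?thesis by (simp add: algebra_simps)
      qed
      ultimately show ?thesis by (simp add: max_def)
    qed
    finally have "\<bar>pd e slit_dist z\<bar> * y \<le> 2 * (r + x)" using r(1) by simp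
    then have "L * (\<bar>pd e slit_dist z\<bar> * y) \<le> L * (2 * (r + x))" using lip(2) by (rule mult_left_mono)
    moreover have "\<bar>pd e slit_dist z\<bar> * cmod (\<Phi> z) \<le> \<bar>pd e slit_dist z\<bar> * (L * y)" using F by (intro mult_left_mono) auto
    ultimately show ?thesis by (simp add: sd algebra_simps)
  qed
qed

text \<open>Zero where \<open>n * slit_dist z <= 1\<close>, a region around the whole closed
  negative axis, and tending to 1 at every point of the slit plane.\<close>

definition slit_cut :: "nat \<Rightarrow> complex \<Rightarrow> real"
  where "slit_cut n z = flat 0 (real n * slit_dist z - 1)"

lemma smooth_on_slit_cut: "open S \<Longrightarrow> 0 \<notin> S \<Longrightarrow> smooth_on (slit_cut n) S"
  unfolding slit_cut_def[abs_def]
  by (rule smooth_on_flat) (auto intro!: smooth_on_diff smooth_on_mult smooth_on_const smooth_on_slit_dist)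

lemma slit_cut_has_derivative:
  "z \<noteq> 0 \<Longrightarrow> (slit_cut n has_derivative (\<lambda>e. (real n * pd e slit_dist z) * flat 2 (real n * slit_dist z - 1))) (at z)"
proof -
  assume z: "z \<noteq> 0"
  have "(slit_dist has_derivative (\<lambda>e. pd e slit_dist z)) (at z)"
    by (rule has_derivative_pd[OF differentiableI_at[OF slit_dist_has_derivative[OF z]]])
  then have "((\<lambda>z. real n * slit_dist z - 1) has_derivative (\<lambda>e. real n * pd e slit_dist z - 0)) (at z)"
    by (intro has_derivative_diff has_derivative_mult_right has_derivative_const)
  from flat_compose_has_derivative[OF this, of 0] show ?thesis
    by (simp add: slit_cut_def[abs_def] numeral_2_eq_2)
qed

lemma seq_at_top: "z \<in> slit \<Longrightarrow> filterlim (\<lambda>n. real n * slit_dist z - 1) at_top sequentially"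
proof -
  assume "z \<in> slit"
  then have "0 < slit_dist z" by (simp add: slit_dist_pos)
  then have "filterlim (\<lambda>n. slit_dist z * real n) at_top sequentially"
    by (rule filterlim_tendsto_pos_mult_at_top[OF tendsto_const _ filterlim_real_sequentially])
  then have "filterlim (\<lambda>n. - 1 + slit_dist z * real n) at_top sequentially"
    by (rule filterlim_tendsto_add_at_top[OF tendsto_const])
  then show ?thesis by (simp add: mult.commute)
qed

text \<open>The inverse gauge: for \<open>e\<close> in \<open>Basis\<close> the bracket is
  \<open>i\<close> times the magnetic derivative of \<open>\<Phi>\<close> in the direction
  \<open>e\<close>.\<close>

lemma gauge_pd:
  assumes \<Phi>: "\<Phi> \<in> test_functions T" and z: "z \<in> slit"
  shows "((\<lambda>z. cnj (half_phase z) * \<Phi> z) has_derivative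
      (\<lambda>e. cnj (half_phase z) * (pd e \<Phi> z - \<i> * of_real (Re e * A1 z + Im e * A2 z) * \<Phi> z))) (at z)"
proof -
  have "((\<lambda>z. cnj (half_phase z) * \<Phi> z) has_derivative
      (\<lambda>e. cnj (half_phase z) * pd e \<Phi> z + cnj (\<i> * of_real (Re e * A1 z + Im e * A2 z) * half_phase z) * \<Phi> z)) (at z)"
    by (intro has_derivative_mult has_derivative_cnj half_phase_has_derivative[OF z] test_has_derivative[OF \<Phi>])
  then show ?thesis by (simp add: algebra_simps)
qed

section \<open>Folding maps the magnetic form domain to that of the mixed problem\<close>

context sym_domain
begin

text \<open>Vanishing on the ray suffices for membership in the closure, without vanishing near it.
  Cutting off costs the term \<open>R\<close>, in which the growing factor \<open>n\<close> is
  compensated by the smallness of \<open>\<Phi>\<close>; it stays bounded and tends to 0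
  pointwise.\<close>

lemma slit_approx:
  assumes \<Phi>: "\<Phi> \<in> test_functions V" and zero: "\<And>x. x \<le> 0 \<Longrightarrow> \<Phi> (complex_of_real x) = 0"
  shows "DNcl U C (\<lambda>z. cnj (half_phase z) * \<Phi> z) (\<lambda>z. \<i> * (cnj (half_phase z) * DA1 \<Phi> z)) (\<lambda>z. \<i> * (cnj (half_phase z) * DA2 \<Phi> z))"
proof -
  let ?S = "W \<inter> slit"
  define \<psi> where "\<psi> n z = of_real (slit_cut n z) * (cnj (half_phase z) * \<Phi> z)" for n z
  have S0: "0 \<notin> ?S" using slit_nonzero by auto
  obtain K where K: "compact K" "K \<subseteq> V" "\<And>z. z \<notin> K \<Longrightarrow> \<Phi> z = 0" by (rule test_compact[OF \<Phi>]) blast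
  have \<psi>: "\<psi> n \<in> test_functions ?S" for n
  proof (rule test_functionsI[OF S_open(1), where K = "K \<inter> {z. 1 \<le> real n * slit_dist z}"])
    show "smooth_on (\<psi> n) ?S" unfolding \<psi>_def
      by (intro smooth_on_mult[OF S_open(1)] smooth_on_of_real[OF S_open(1)] smooth_on_slit_cut[OF S_open(1) S0]
          smooth_on_cnj[OF S_open(1)] smooth_on_half_phase[OF S_open(1,2)] test_smooth_on[OF \<Phi>])
    have "closed {z. 1 \<le> real n * slit_dist z}" unfolding slit_dist_def by (intro closed_Collect_le continuous_intros)
    then show "compact (K \<inter> {z. 1 \<le> real n * slit_dist z})" by (rule compact_Int_closed[OF K(1)])
    show "K \<inter> {z. 1 \<le> real n * slit_dist z} \<subseteq> ?S"
    proof
      fix z assume z: "z \<in> K \<inter> {z. 1 \<le> real n * slit_dist z}"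
      then have "0 < real n * slit_dist z" by simp
      then have "0 < slit_dist z" by (simp add: zero_less_mult_iff)
      then show "z \<in> ?S" using z K(2) by (auto simp: slit_dist_pos V_def punctured_def)
    qed
    show "\<psi> n z = 0" if "z \<notin> K \<inter> {z. 1 \<le> real n * slit_dist z}" for z
      using that K(3)[of z] by (cases "z \<in> K") (auto simp: \<psi>_def slit_cut_def)
  qed
  have \<psi>C: "\<psi> n \<in> test_functions (- C)" for n by (rule test_mono[OF \<psi> C_slit])
  obtain L where L: "L \<ge> 0" "\<And>x y. cmod (\<Phi> x - \<Phi> y) \<le> L * cmod (x - y)" by (rule test_lipschitz[OF \<Phi>]) blast
  obtain B0 where B0: "B0 \<ge> 0" "\<And>z. cmod (\<Phi> z) \<le> B0" by (rule test_bounded[OF \<Phi>]) blast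
  obtain B1 where B1: "B1 \<ge> 0" "\<And>z. cmod (DA1 \<Phi> z) \<le> B1" by (rule test_bounded[OF test_DA(1)[OF V_open(1,2) \<Phi>]]) blast
  obtain B2 where B2: "B2 \<ge> 0" "\<And>z. cmod (DA2 \<Phi> z) \<le> B2" by (rule test_bounded[OF test_DA(2)[OF V_open(1,2) \<Phi>]]) blast
  have fin: "finite_measure (leb U)"
    using U_open V_open(4) by (intro finite_measure_leb) (auto simp: U_eq(1) intro: bounded_subset)
  have US: "z \<in> U \<Longrightarrow> z \<in> slit" for z by (auto simp: U_eq(1) slit_def)
  define R where "R n e z = of_real ((real n * pd e slit_dist z) * flat 2 (real n * slit_dist z - 1)) * (cnj (half_phase z) * \<Phi> z)" for n e z
  have pd\<psi>: "pd 1 (\<psi> n) z = of_real (slit_cut n z) * (\<i> * (cnj (half_phase z) * DA1 \<Phi> z)) + R n 1 z"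
    "pd \<i> (\<psi> n) z = of_real (slit_cut n z) * (\<i> * (cnj (half_phase z) * DA2 \<Phi> z)) + R n \<i> z" if z: "z \<in> slit" for n z
  proof -
    have "(\<psi> n has_derivative (\<lambda>e. of_real (slit_cut n z) * (cnj (half_phase z) * (pd e \<Phi> z - \<i> * of_real (Re e * A1 z + Im e * A2 z) * \<Phi> z)) + R n e z)) (at z)"
      unfolding \<psi>_def R_def
      by (intro has_derivative_mult gauge_pd[OF \<Phi> z] bounded_linear.has_derivative[OF bounded_linear_of_real] slit_cut_has_derivative slit_nonzero z)
    from pd_eqI[OF this, of 1] pd_eqI[OF this, of \<i>] show "pd 1 (\<psi> n) z = of_real (slit_cut n z) * (\<i> * (cnj (half_phase z) * DA1 \<Phi> z)) + R n 1 z"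
      "pd \<i> (\<psi> n) z = of_real (slit_cut n z) * (\<i> * (cnj (half_phase z) * DA2 \<Phi> z)) + R n \<i> z"
      by (simp_all add: DA1_def DA2_def algebra_simps)
  qed
  have cut: "0 \<le> slit_cut n z" "slit_cut n z \<le> 1" for n z by (simp_all add: slit_cut_def flat_0_le)
  have Rb: "cmod (R n e z) \<le> 2 * L * ((real n * slit_dist z) * flat 2 (real n * slit_dist z - 1))"
    if "z \<in> slit" "e \<in> Basis" for n e z
  proof -
    have "cmod (R n e z) = (real n * flat 2 (real n * slit_dist z - 1)) * (\<bar>pd e slit_dist z\<bar> * cmod (\<Phi> z))"
      by (simp add: R_def norm_mult abs_mult)
    also have "\<dots> \<le> (real n * flat 2 (real n * slit_dist z - 1)) * (2 * L * slit_dist z)"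
      by (intro mult_left_mono slit_dist_pd_bound[OF L(2,1) zero that]) auto
    finally show ?thesis by (simp add: algebra_simps)
  qed
  \<comment> \<open>The constant is \<open>6 = 2 * 3\<close>, with 3 from \<open>flat_Suc_le\<close>
    and 2 from \<open>slit_dist_pd_bound\<close>.\<close>
  have Rb3: "cmod (R n e z) \<le> 6 * L" if "z \<in> slit" "e \<in> Basis" for n e z
  proof -
    have "2 * L * ((real n * slit_dist z) * flat 2 (real n * slit_dist z - 1)) \<le> 2 * L * 3"
      using flat_Suc_le(1)[of "real n * slit_dist z - 1"] L(1) by (intro mult_left_mono) auto
    with Rb[OF that, of n] show ?thesis by simp
  qed
  have R0: "(\<lambda>n. R n e z) \<longlonglongrightarrow> 0" if "z \<in> slit" "e \<in> Basis" for e z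
  proof (rule Lim_null_comparison[OF always_eventually])
    show "\<forall>n. norm (R n e z) \<le> 2 * L * ((real n * slit_dist z) * flat 2 (real n * slit_dist z - 1))" using Rb[OF that] by blast
    have "(\<lambda>n. ((real n * slit_dist z - 1) + 1) * flat 2 (real n * slit_dist z - 1)) \<longlonglongrightarrow> 0"
      by (rule filterlim_compose[OF flat_Suc_tendsto seq_at_top[OF that(1)]])
    then have "(\<lambda>n. 2 * L * ((real n * slit_dist z) * flat 2 (real n * slit_dist z - 1))) \<longlonglongrightarrow> 2 * L * 0"
      by (intro tendsto_mult_left) simp
    then show "(\<lambda>n. 2 * L * ((real n * slit_dist z) * flat 2 (real n * slit_dist z - 1))) \<longlonglongrightarrow> 0" by simp
  qed
  have cut1: "(\<lambda>n. complex_of_real (slit_cut n z)) \<longlonglongrightarrow> 1" if "z \<in> slit" for z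
    using tendsto_of_real[OF filterlim_compose[OF flat_0_at_top seq_at_top[OF that]]] unfolding slit_cut_def by simp
  have hm: "half_phase \<in> borel_measurable (leb U)" by (rule borel_measurable_leb[OF half_phase_measurable])
  have hL: "(\<lambda>z. cnj (half_phase z) * f z) \<in> L2 (leb U)" if "f \<in> test_functions V" for f
    by (rule L2_mult_bounded[OF test_L2[OF that], where B = 1]) (use hm U_open in auto)
  have lims: "(\<lambda>n. of_real (slit_cut n z) * X + Y n) \<longlonglongrightarrow> X" if "z \<in> slit" "Y \<longlonglongrightarrow> 0" for X :: complex and Y z
    using tendsto_add[OF tendsto_mult[OF cut1[OF that(1)] tendsto_const[of X]] that(2)] by simp
  have bnd: "cmod ((of_real (slit_cut n z) * X + Y) - X) \<le> B + B'" if "cmod X \<le> B" "cmod Y \<le> B'" for X Y B B' n z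
  proof -
    have "(of_real (slit_cut n z) * X + Y) - X = Y - of_real (1 - slit_cut n z) * X" by (simp add: algebra_simps)
    also have "cmod \<dots> \<le> cmod Y + cmod (of_real (1 - slit_cut n z) * X)" by (rule norm_triangle_ineq4)
    also have "cmod (of_real (1 - slit_cut n z) * X) \<le> 1 * cmod X"
      unfolding norm_mult norm_of_real using cut[of n z] by (intro mult_right_mono) auto
    finally show ?thesis using that by simp
  qed
  note \<psi>L = DN_test_L2[OF U_open C_closed \<psi>C]
  have T1: "(\<lambda>z. \<i> * (cnj (half_phase z) * DA1 \<Phi> z)) \<in> L2 (leb U)" "(\<lambda>z. \<i> * (cnj (half_phase z) * DA2 \<Phi> z)) \<in> L2 (leb U)"
    by (intro L2_cmult hL test_DA[OF V_open(1,2) \<Phi>])+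
  have Bs: "(1::complex) \<in> Basis" "\<i> \<in> Basis" by (auto simp: Basis_complex)
  show ?thesis
  proof (rule form_graphI_seq[of \<psi>, OF \<psi>C hL[OF \<Phi>] T1])
    show "(\<lambda>n. L2_norm (leb U) (\<lambda>z. \<psi> n z - cnj (half_phase z) * \<Phi> z)) \<longlonglongrightarrow> 0"
    proof (rule L2_dominated_const[OF fin _ L2D(1)[OF hL[OF \<Phi>]], where B = "B0 + 0"])
      show "AE z in leb U. cmod (\<psi> n z - cnj (half_phase z) * \<Phi> z) \<le> B0 + 0" for n
        using bnd[of "cnj (half_phase _) * \<Phi> _" B0 0 0] B0 by (intro AE_I2) (simp add: \<psi>_def norm_mult)
      show "AE z in leb U. (\<lambda>n. \<psi> n z) \<longlonglongrightarrow> cnj (half_phase z) * \<Phi> z"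
        using lims[OF US tendsto_const] by (intro AE_I2) (simp add: \<psi>_def)
    qed (use \<psi>L in \<open>auto dest: L2D(1)\<close>)
    show "(\<lambda>n. L2_norm (leb U) (\<lambda>z. pd 1 (\<psi> n) z - \<i> * (cnj (half_phase z) * DA1 \<Phi> z))) \<longlonglongrightarrow> 0"
    proof (rule L2_dominated_const[OF fin _ L2D(1)[OF T1(1)], where B = "B1 + 6 * L"])
      show "AE z in leb U. cmod (pd 1 (\<psi> n) z - \<i> * (cnj (half_phase z) * DA1 \<Phi> z)) \<le> B1 + 6 * L" for n
      proof (rule AE_I2)
        fix z assume "z \<in> space (leb U)"
        then have z: "z \<in> slit" using US by simp
        show "cmod (pd 1 (\<psi> n) z - \<i> * (cnj (half_phase z) * DA1 \<Phi> z)) \<le> B1 + 6 * L"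
          unfolding pd\<psi>[OF z] by (rule bnd[OF _ Rb3[OF z Bs(1)]]) (use B1 in \<open>simp add: norm_mult\<close>)
      qed
      show "AE z in leb U. (\<lambda>n. pd 1 (\<psi> n) z) \<longlonglongrightarrow> \<i> * (cnj (half_phase z) * DA1 \<Phi> z)"
      proof (rule AE_I2)
        fix z assume "z \<in> space (leb U)"
        then have z: "z \<in> slit" using US by simp
        show "(\<lambda>n. pd 1 (\<psi> n) z) \<longlonglongrightarrow> \<i> * (cnj (half_phase z) * DA1 \<Phi> z)"
          unfolding pd\<psi>[OF z] by (rule lims[OF z R0[OF z Bs(1)]])
      qed
    qed (use \<psi>L in \<open>auto dest: L2D(1)\<close>)
    show "(\<lambda>n. L2_norm (leb U) (\<lambda>z. pd \<i> (\<psi> n) z - \<i> * (cnj (half_phase z) * DA2 \<Phi> z))) \<longlonglongrightarrow> 0"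
    proof (rule L2_dominated_const[OF fin _ L2D(1)[OF T1(2)], where B = "B2 + 6 * L"])
      show "AE z in leb U. cmod (pd \<i> (\<psi> n) z - \<i> * (cnj (half_phase z) * DA2 \<Phi> z)) \<le> B2 + 6 * L" for n
      proof (rule AE_I2)
        fix z assume "z \<in> space (leb U)"
        then have z: "z \<in> slit" using US by simp
        show "cmod (pd \<i> (\<psi> n) z - \<i> * (cnj (half_phase z) * DA2 \<Phi> z)) \<le> B2 + 6 * L"
          unfolding pd\<psi>[OF z] by (rule bnd[OF _ Rb3[OF z Bs(2)]]) (use B2 in \<open>simp add: norm_mult\<close>)
      qed
      show "AE z in leb U. (\<lambda>n. pd \<i> (\<psi> n) z) \<longlonglongrightarrow> \<i> * (cnj (half_phase z) * DA2 \<Phi> z)"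
      proof (rule AE_I2)
        fix z assume "z \<in> space (leb U)"
        then have z: "z \<in> slit" using US by simp
        show "(\<lambda>n. pd \<i> (\<psi> n) z) \<longlonglongrightarrow> \<i> * (cnj (half_phase z) * DA2 \<Phi> z)"
          unfolding pd\<psi>[OF z] by (rule lims[OF z R0[OF z Bs(2)]])
      qed
    qed (use \<psi>L in \<open>auto dest: L2D(1)\<close>)
  qed
qed

text \<open>Before gauging, the folded function is
  \<open>\<phi> z + phase z * \<phi> (cnj z)\<close>, the sum of \<open>\<phi>\<close> and of its
  image under \<open>conj_refl 1\<close> and \<open>Kop\<close>. This sum is smooth across the
  negative axis, unlike the gauge factor, and hence a test function of \<open>V\<close>.\<close>

lemma fold_up_core:
  assumes \<phi>: "\<phi> \<in> test_functions V"
  shows "DNcl U C (fold_up 1 \<phi>) (\<lambda>z. \<i> * fold_up 1 (DA1 \<phi>) z) (\<lambda>z. \<i> * fold_up (-1) (DA2 \<phi>) z)"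
proof -
  have VV: "{z. reflect 1 z \<in> V} = V" using V_sym[of "cnj _"] V_sym by (force simp: reflect_1)
  have r: "conj_refl 1 \<phi> \<in> test_functions V" using conj_refl_test[of 1, OF _ V_open(1) \<phi>] VV by simp
  have k: "Kop (conj_refl 1 \<phi>) \<in> test_functions V" by (rule Kop_test[OF V_open(1,2) r])
  define \<Phi> where "\<Phi> z = \<phi> z + Kop (conj_refl 1 \<phi>) z" for z
  have \<Phi>: "\<Phi> \<in> test_functions V" unfolding \<Phi>_def by (rule test_add[OF V_open(1) \<phi> k])
  have e: "\<Phi> z = \<phi> z + phase z * \<phi> (cnj z)" for z by (simp add: \<Phi>_def Kop_eq conj_refl_def reflect_1)
  have zero: "\<Phi> (complex_of_real x) = 0" if "x \<le> 0" for x
  proof (cases "x = 0")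
    case True
    have "\<phi> 0 = 0" by (rule test_compact[OF \<phi>]) (use V_open(2) in blast)
    then show ?thesis using True by (simp add: e)
  next
    case False
    then have "phase (complex_of_real x) = -1" using that by (simp add: phase_def)
    then show ?thesis by (simp add: e)
  qed
  have D: "DA1 \<Phi> z = DA1 \<phi> z + phase z * DA1 \<phi> (cnj z)" "DA2 \<Phi> z = DA2 \<phi> z - phase z * DA2 \<phi> (cnj z)" if "z \<noteq> 0" for z
  proof -
    have a: "DA1 \<Phi> z = DA1 \<phi> z + DA1 (Kop (conj_refl 1 \<phi>)) z" "DA2 \<Phi> z = DA2 \<phi> z + DA2 (Kop (conj_refl 1 \<phi>)) z"
      unfolding DA1_def DA2_def \<Phi>_def using test_differentiable[OF \<phi>] test_differentiable[OF k]
      by (simp_all add: pd_add algebra_simps)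
    have "DA1 (conj_refl 1 \<phi>) z = - cnj (DA1 \<phi> (cnj z))" "DA2 (conj_refl 1 \<phi>) z = cnj (DA2 \<phi> (cnj z))"
      using conj_refl_DA[of 1, OF _ \<phi>] by (simp_all add: refl_grad1_def refl_grad2_def reflect_1)
    then show "DA1 \<Phi> z = DA1 \<phi> z + phase z * DA1 \<phi> (cnj z)" "DA2 \<Phi> z = DA2 \<phi> z - phase z * DA2 \<phi> (cnj z)"
      unfolding a Kop_DA[OF r that] by (simp_all add: Kop_eq)
  qed
  have h: "cnj (half_phase z) * (x + phase z * y) = cnj (half_phase z) * x + 1 * (half_phase z * y)" "cnj (half_phase z) * (x - phase z * y) = cnj (half_phase z) * x + - 1 * (half_phase z * y)" for x y z
  proof -
    have "cnj (half_phase z) * (phase z * y) = half_phase z * y"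
      unfolding half_phase_square[symmetric] by (simp add: mult.assoc[symmetric])
    then show "cnj (half_phase z) * (x + phase z * y) = cnj (half_phase z) * x + 1 * (half_phase z * y)" "cnj (half_phase z) * (x - phase z * y) = cnj (half_phase z) * x + - 1 * (half_phase z * y)"
      by (simp_all add: distrib_left right_diff_distrib)
  qed
  have u: "(\<lambda>z. cnj (half_phase z) * \<Phi> z) = fold_up 1 \<phi>" by (simp add: fun_eq_iff e h fold_up_def)
  note ap = slit_approx[OF \<Phi> zero, unfolded u]
  have L: "\<phi> \<in> L2 (leb V)" "DA1 \<phi> \<in> L2 (leb V)" "DA2 \<phi> \<in> L2 (leb V)" using AB_test_L2[OF V_open(1,2) \<phi>] by auto
  show ?thesis
  proof (rule form_graph_cong_AE[OF ap _ _ _ _ DN_test_L2[OF U_open C_closed]])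
    have nz: "z \<in> U \<Longrightarrow> z \<noteq> 0" for z by (auto simp: U_eq(1))
    show "AE z in leb U. \<i> * (cnj (half_phase z) * DA1 \<Phi> z) = \<i> * fold_up 1 (DA1 \<phi>) z"
      by (intro AE_I2) (simp add: D nz h fold_up_def)
    show "AE z in leb U. \<i> * (cnj (half_phase z) * DA2 \<Phi> z) = \<i> * fold_up (-1) (DA2 \<phi>) z"
      by (intro AE_I2) (simp add: D nz h fold_up_def)
    show "(\<lambda>z. \<i> * fold_up 1 (DA1 \<phi>) z) \<in> L2 (leb U)"
      using fold_up_L2(1)[OF V_open(3) V_sym, folded U_eq(1), of 1, OF _ _ L(2)] by (intro L2_cmult) simp
    show "(\<lambda>z. \<i> * fold_up (-1) (DA2 \<phi>) z) \<in> L2 (leb U)"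
      using fold_up_L2(1)[OF V_open(3) V_sym, folded U_eq(1), of "-1", OF _ _ L(3)] by (intro L2_cmult) simp
  qed
qed

lemma fold_up_cl:
  assumes "ABcl V u g h"
  shows "DNcl U C (fold_up 1 u) (\<lambda>z. \<i> * fold_up 1 g z) (\<lambda>z. \<i> * fold_up (-1) h z)"
proof (rule form_graph_transfer[OF assms AB_test_L2[OF V_open(1,2)] DN_test_L2[OF U_open C_closed],
    where J = "fold_up 1" and A = "\<lambda>k l z. \<i> * fold_up 1 k z" and B = "\<lambda>k l z. \<i> * fold_up (-1) l z" and c = 2])
  have *: "fold_up s f \<in> L2 (leb U) \<and> L2_norm (leb U) (\<lambda>z. fold_up s f z - fold_up s f' z) \<le> 2 * L2_norm (leb V) (\<lambda>z. f z - f' z)"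
    if "s = 1 \<or> s = -1" "f \<in> L2 (leb V)" "f' \<in> L2 (leb V)" for s f f'
  proof -
    have s: "cmod s = 1" using that(1) by auto
    have 1: "fold_up s f \<in> L2 (leb U)" using fold_up_L2(1)[OF V_open(3) V_sym s, folded U_eq(1), OF _ that(2)] by blast
    have 2: "L2_norm (leb U) (fold_up s (\<lambda>z. f z - f' z)) \<le> 2 * L2_norm (leb V) (\<lambda>z. f z - f' z)"
      using fold_up_L2(2)[OF V_open(3) V_sym s, folded U_eq(1), OF _ L2_diff[OF that(2,3)]] by blast
    have 3: "(\<lambda>z. fold_up s f z - fold_up s f' z) = fold_up s (\<lambda>z. f z - f' z)"
      by (auto simp: fold_up_def algebra_simps)
    show ?thesis unfolding 3 using 1 2 by blast
  qed
  have n: "L2_norm (leb U) (\<lambda>z. \<i> * f z - \<i> * f' z) = L2_norm (leb U) (\<lambda>z. f z - f' z)" for f f'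
    using L2_norm_cmult[of "leb U" "\<i>" "\<lambda>z. f z - f' z"] by (simp add: right_diff_distrib)
  have up: "a \<le> 2 * (b + c)" "a \<le> 2 * (c + b)" if "a \<le> 2 * b" "0 \<le> c" for a b c :: real
    using that by simp_all
  show "fold_up 1 f \<in> L2 (leb U) \<and> L2_norm (leb U) (\<lambda>z. fold_up 1 f z - fold_up 1 f' z) \<le> 2 * L2_norm (leb V) (\<lambda>z. f z - f' z)"
    if "f \<in> L2 (leb V)" "f' \<in> L2 (leb V)" for f f' using *[of 1] that by simp
  show "(\<lambda>z. \<i> * fold_up 1 f z) \<in> L2 (leb U) \<and> L2_norm (leb U) (\<lambda>z. \<i> * fold_up 1 f z - \<i> * fold_up 1 f' z) \<le> 2 * (L2_norm (leb V) (\<lambda>z. f z - f' z) + L2_norm (leb V) (\<lambda>z. k z - k' z))"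
    if "f \<in> L2 (leb V)" "f' \<in> L2 (leb V)" "k \<in> L2 (leb V)" "k' \<in> L2 (leb V)" for f f' k k'
    unfolding n using *[of 1 f f'] that(1,2) by (intro conjI up L2_cmult) auto
  show "(\<lambda>z. \<i> * fold_up (-1) k z) \<in> L2 (leb U) \<and> L2_norm (leb U) (\<lambda>z. \<i> * fold_up (-1) k z - \<i> * fold_up (-1) k' z) \<le> 2 * (L2_norm (leb V) (\<lambda>z. f z - f' z) + L2_norm (leb V) (\<lambda>z. k z - k' z))"
    if "f \<in> L2 (leb V)" "f' \<in> L2 (leb V)" "k \<in> L2 (leb V)" "k' \<in> L2 (leb V)" for f f' k k'
    unfolding n using *[of "-1" k k'] that(3,4) by (intro conjI up L2_cmult) auto
  show "DNcl U C (fold_up 1 \<phi>) (\<lambda>z. \<i> * fold_up 1 (DA1 \<phi>) z) (\<lambda>z. \<i> * fold_up (-1) (DA2 \<phi>) z)"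
    if "\<phi> \<in> test_functions V" for \<phi> by (rule fold_up_core[OF that])
qed

end

section \<open>Isospectrality\<close>

definition ABspec :: "complex set \<Rightarrow> complex set"
  where "ABspec V = {\<mu>. \<exists>u. \<not> (AE z in leb V. u z = 0) \<and> ABeig V \<mu> u}"

definition DNspec :: "complex set \<Rightarrow> complex set \<Rightarrow> complex set"
  where "DNspec U C = {\<mu>. \<exists>u. \<not> (AE z in leb U. u z = 0) \<and> DNeig U C \<mu> u}"

lemma AB_operator_iff:
  assumes "open S" "bounded S"
  shows "AB_operator S u (\<lambda>z. \<mu> * u z) \<longleftrightarrow> ABeig (punctured S) \<mu> u"
proof -
  have "open (punctured S)" "0 \<notin> punctured S" "bounded (punctured S)"
    using assms by (auto simp: punctured_def intro: bounded_subset)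
  from friedrichs_iff[OF this] show ?thesis by (simp add: AB_operator_def)
qed

lemma AB_eigenvalues_eq: "open S \<Longrightarrow> bounded S \<Longrightarrow> AB_eigenvalues S = ABspec (punctured S)"
  using AB_operator_iff[of S] by (auto simp: AB_eigenvalues_def eigenvalues_def ABspec_def dest: weak_eigen_L2)

lemma DN_eigenvalues_eq: "open U \<Longrightarrow> closed (frontier U - N) \<Longrightarrow> DN_eigenvalues U N = DNspec U (frontier U - N)"
  using DN_iff[of U "frontier U - N"] by (auto simp: DN_eigenvalues_def eigenvalues_def DNspec_def dest: weak_eigen_L2)

section \<open>Invariance of both spectra under reflections\<close>

lemma conj_refl_nonzero:
  assumes a: "cmod a = 1" and V: "V \<in> sets borel" and z: "AE z in leb {z. reflect a z \<in> V}. conj_refl a u z = 0"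
  shows "AE z in leb V. u z = 0"
  using preserves_AE[OF preserves_reflect'[OF a V] z] a by (simp add: conj_refl_def)

lemma ABspec_refl_sub:
  assumes a: "cmod a = 1" and V: "open V" "0 \<notin> V"
  shows "ABspec V \<subseteq> ABspec {z. reflect a z \<in> V}"
proof
  fix \<mu> assume "\<mu> \<in> ABspec V"
  then obtain u where u: "\<not> (AE z in leb V. u z = 0)" "ABeig V \<mu> u" by (auto simp: ABspec_def)
  have "ABeig {z. reflect a z \<in> V} \<mu> (conj_refl a u)" using AB_refl[OF a V u(2)] weak_eigen_real[OF u(2,1)] by simp
  moreover have "\<not> (AE z in leb {z. reflect a z \<in> V}. conj_refl a u z = 0)" using conj_refl_nonzero[OF a _, of V u] u(1) V(1) by auto
  ultimately show "\<mu> \<in> ABspec {z. reflect a z \<in> V}" by (auto simp: ABspec_def)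
qed

lemma ABspec_refl:
  assumes a: "cmod a = 1" and V: "open V" "0 \<notin> V"
  shows "ABspec {z. reflect a z \<in> V} = ABspec V"
proof
  have V': "open {z. reflect a z \<in> V}" "0 \<notin> {z. reflect a z \<in> V}" using V open_reflect_vimage by (auto simp: reflect_def)
  show "ABspec {z. reflect a z \<in> V} \<subseteq> ABspec V" using ABspec_refl_sub[OF a V'] a by simp
qed (rule ABspec_refl_sub[OF a V])

lemma closed_reflect_vimage: "closed C \<Longrightarrow> closed {z. reflect a z \<in> C}"
  using open_reflect_vimage[of "- C" a] by (simp add: closed_def Compl_eq)

lemma DNspec_refl_sub:
  assumes a: "cmod a = 1" and U: "open U" "closed C"
  shows "DNspec U C \<subseteq> DNspec {z. reflect a z \<in> U} {z. reflect a z \<in> C}"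
proof
  fix \<mu> assume "\<mu> \<in> DNspec U C"
  then obtain u where u: "\<not> (AE z in leb U. u z = 0)" "DNeig U C \<mu> u" by (auto simp: DNspec_def)
  have "DNeig {z. reflect a z \<in> U} {z. reflect a z \<in> C} \<mu> (conj_refl a u)" using DN_refl[OF a U u(2)] weak_eigen_real[OF u(2,1)] by simp
  moreover have "\<not> (AE z in leb {z. reflect a z \<in> U}. conj_refl a u z = 0)" using conj_refl_nonzero[OF a _, of U u] u(1) U(1) by auto
  ultimately show "\<mu> \<in> DNspec {z. reflect a z \<in> U} {z. reflect a z \<in> C}" by (auto simp: DNspec_def)
qed

lemma DNspec_refl:
  assumes a: "cmod a = 1" and U: "open U" "closed C"
  shows "DNspec {z. reflect a z \<in> U} {z. reflect a z \<in> C} = DNspec U C"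
proof
  show "DNspec {z. reflect a z \<in> U} {z. reflect a z \<in> C} \<subseteq> DNspec U C"
    using DNspec_refl_sub[OF a open_reflect_vimage[OF U(1)] closed_reflect_vimage[OF U(2)], of a a] a by simp
qed (rule DNspec_refl_sub[OF a U])

text \<open>The preimage under an involution is also its image, and closures commute with injective
  linear maps.\<close>

lemma frontier_reflect_vimage:
  assumes a: "cmod a = 1" shows "frontier {z. reflect a z \<in> U} = {z. reflect a z \<in> frontier U}"
proof -
  have im: "{z. reflect a z \<in> X} = reflect a ` X" for X
    using a by (force simp: image_iff)
  have c: "closure (reflect a ` X) = reflect a ` closure X" for X
  proof (rule closure_injective_linear_image[symmetric])
    show "linear (reflect a)" by (rule bounded_linear.linear[OF bounded_linear_reflect])
    show "inj (reflect a)" using a by (metis injI reflect_rf)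
  qed
  have "- {z. reflect a z \<in> X} = {z. reflect a z \<in> - X}" for X by auto
  then show ?thesis unfolding frontier_closures using c[of U] c[of "- U"] unfolding im[symmetric] by auto
qed

text \<open>The mirror image of a point at angle theta in the upper half-plane has angle
  \<open>pi - theta\<close>. The factor \<open>i\<close> arising here turns the sum of the two
  folded terms into their difference.\<close>

lemma half_phase_refl: "0 < Im z \<Longrightarrow> half_phase (- cnj z) = \<i> * cnj (half_phase z)"
proof -
  assume z: "0 < Im z"
  then have nz: "cnj z \<noteq> 0" and nr: "z \<notin> \<real>" by (auto simp: complex_is_Real_iff)
  have "Arg (cnj z) = - Arg z" using nr by (simp add: Arg_cnj)
  moreover have "Arg z > 0" using z Arg_lt_pi[of z] by simp
  ultimately have "Arg (- cnj z) = pi - Arg z" using Arg_minus[OF nz] by simp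
  then have "Arg (- cnj z) / 2 = pi / 2 + - (Arg z / 2)" by (simp add: diff_divide_distrib)
  then have "half_phase (- cnj z) = cis (pi / 2) * cis (- (Arg z / 2))"
    unfolding half_phase_def cis_mult by (simp only:)
  then show ?thesis by (simp add: half_phase_def cis_cnj)
qed

lemma L2_inner_cmult_right: "L2_inner M u (\<lambda>z. c * v z) = cnj c * L2_inner M u v"
  by (simp add: L2_inner_def mult.assoc mult.left_commute)

section \<open>Equality of the spectra for a half-domain in normal form\<close>

context sym_domain
begin

lemma sym_ext_adjoint:
  assumes "s = 1 \<or> s = -1" "w \<in> L2 (leb U)" "v \<in> L2 (leb V)"
  shows "L2_inner (leb V) (sym_ext U s w) v = L2_inner (leb U) w (fold_up s v)"
proof -
  have "cmod s = 1" "cnj s = s" using assms(1) by auto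
  from sym_ext_Rs_adjoint[OF V_open(3) V_sym this, folded U_eq(1), OF _ assms(2,3)] show ?thesis by blast
qed

lemma fold_up_adjoint:
  assumes "s = 1 \<or> s = -1" "w \<in> L2 (leb U)" "v \<in> L2 (leb V)"
  shows "L2_inner (leb U) (fold_up s v) w = L2_inner (leb V) v (sym_ext U s w)"
  using sym_ext_adjoint[OF assms] L2_inner_cnj by metis

text \<open>Since \<open>- i\<close> and \<open>i\<close> are conjugate, the gradient maps, which
  carry these factors, are adjoint like the maps of functions.\<close>

lemma DN_imp_AB:
  assumes "DNeig U C \<mu> w" shows "ABeig V \<mu> (sym_ext U 1 w)"
proof (rule weak_eigen_linear[OF assms sym_ext_cl fold_up_cl])
  show "L2_inner (leb V) (\<lambda>z. - \<i> * sym_ext U 1 g z) k + L2_inner (leb V) (\<lambda>z. - \<i> * sym_ext U (- 1) h z) l =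
       L2_inner (leb U) g (\<lambda>z. \<i> * fold_up 1 k z) + L2_inner (leb U) h (\<lambda>z. \<i> * fold_up (- 1) l z)"
    if "g \<in> L2 (leb U)" "h \<in> L2 (leb U)" "k \<in> L2 (leb V)" "l \<in> L2 (leb V)" for g h k l
    unfolding L2_inner_cmult_left L2_inner_cmult_right using sym_ext_adjoint[of 1 g k] sym_ext_adjoint[of "-1" h l] that by simp
qed (simp_all add: sym_ext_adjoint)

lemma AB_imp_DN:
  assumes "ABeig V \<mu> u" shows "DNeig U C \<mu> (fold_up 1 u)"
proof (rule weak_eigen_linear[OF assms fold_up_cl sym_ext_cl])
  show "L2_inner (leb U) (\<lambda>z. \<i> * fold_up 1 g z) k + L2_inner (leb U) (\<lambda>z. \<i> * fold_up (- 1) h z) l =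
       L2_inner (leb V) g (\<lambda>z. - \<i> * sym_ext U 1 k z) + L2_inner (leb V) h (\<lambda>z. - \<i> * sym_ext U (- 1) l z)"
    if "g \<in> L2 (leb V)" "h \<in> L2 (leb V)" "k \<in> L2 (leb U)" "l \<in> L2 (leb U)" for g h k l
    unfolding L2_inner_cmult_left L2_inner_cmult_right using fold_up_adjoint[of 1 k g] fold_up_adjoint[of "-1" l h] that by simp
qed (simp_all add: fold_up_adjoint)

lemma sym_ext_nonzero:
  assumes "AE z in leb V. sym_ext U 1 w z = 0" shows "AE z in leb U. w z = 0"
proof -
  have U: "U \<in> sets borel" using U_open by simp
  have "AE z in lborel. z \<in> U \<longrightarrow> w z = 0"
    using assms unfolding AE_leb[OF V_open(3)]
  proof eventually_elim
    case (elim z)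
    have "half_phase z \<noteq> 0" using norm_half_phase[of z] by (metis norm_zero zero_neq_one)
    then show ?case using elim by (auto simp: sym_ext_def U_eq(1))
  qed
  then show ?thesis by (simp add: AE_leb[OF U])
qed

text \<open>The reflection in the imaginary axis interchanges the symmetric and the antisymmetric part of an
  eigenfunction, and the unfolding only loses the antisymmetric part.\<close>

lemma fold_up_nonzero:
  assumes sym2: "\<And>z. z \<in> W \<Longrightarrow> - cnj z \<in> W"
    and 1: "AE z in leb U. fold_up 1 u z = 0" and 2: "AE z in leb U. fold_up 1 (conj_refl (-1) u) z = 0"
  shows "AE z in leb V. u z = 0"
proof -
  have U: "U \<in> sets borel" using U_open by simp
  have UU: "{z. reflect (-1) z \<in> U} = U" using sym2 sym2[of "- cnj _"] by (force simp: reflect_def U_eq(2))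
  have p: "preserves (leb U) (leb U) (reflect (-1))" using preserves_reflect[OF _ U, of "-1"] by (simp add: UU)
  have "AE z in leb U. z \<in> U" by (rule AE_I2) simp
  then have "AE z in leb U. u z = 0 \<and> u (cnj z) = 0"
    using 1 preserves_AE[OF p 2]
  proof eventually_elim
    case (elim z)
    have hz: "half_phase (- cnj z) = \<i> * cnj (half_phase z)" using elim(1) by (intro half_phase_refl) (simp add: U_eq(1))
    have nz: "half_phase z \<noteq> 0" using norm_half_phase[of z] by (metis norm_zero zero_neq_one)
    have "cnj (cnj (half_phase (- cnj z)) * cnj (u z) + half_phase (- cnj z) * cnj (u (cnj z))) = cnj 0"
      using elim(3) by (intro arg_cong[where f = cnj]) (simp add: fold_up_def conj_refl_def reflect_def)
    \<comment> \<open>Conjugated, the second relation states that the difference of the two terms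
      vanishes, while by the first their sum does.\<close>
    then have "\<i> * (cnj (half_phase z) * u z - half_phase z * u (cnj z)) = 0" by (simp add: hz algebra_simps)
    moreover have "cnj (half_phase z) * u z + half_phase z * u (cnj z) = 0" using elim(2) by (simp add: fold_up_def)
    ultimately have "cnj (half_phase z) * u z = 0" "half_phase z * u (cnj z) = 0"
      by (simp_all add: eq_neg_iff_add_eq_0[symmetric]) 
    then show ?case using nz by simp
  qed
  then have b: "AE z in lborel. z \<in> U \<longrightarrow> u z = 0" and c: "AE z in leb U. u (cnj z) = 0"
    by (auto simp: AE_leb[OF U])
  have d: "AE z in lborel. reflect 1 z \<in> U \<longrightarrow> u z = 0"
    using preserves_AE[OF preserves_reflect[OF _ U, of 1] c] AE_leb[OF reflect_vimage_borel[OF U, of 1]] by (simp add: reflect_1)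
  have "AE z in lborel. z \<in> V \<longrightarrow> u z = 0"
    using b d AE_Im_nonzero
  proof eventually_elim
    case (elim z)
    then show ?case using V_sym[of z] by (cases "0 < Im z") (auto simp: U_eq(1) reflect_1)
  qed
  then show ?thesis by (simp add: AE_leb[OF V_open(3)])
qed

lemma DNspec_eq_ABspec:
  assumes sym2: "\<And>z. z \<in> W \<Longrightarrow> - cnj z \<in> W"
  shows "DNspec U C = ABspec V"
proof (intro equalityI subsetI)
  fix \<mu> assume "\<mu> \<in> DNspec U C"
  then show "\<mu> \<in> ABspec V" unfolding DNspec_def ABspec_def using DN_imp_AB sym_ext_nonzero by blast
next
  fix \<mu> assume "\<mu> \<in> ABspec V"
  then obtain u where u: "\<not> (AE z in leb V. u z = 0)" "ABeig V \<mu> u" by (auto simp: ABspec_def)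
  have VV: "{z. reflect (-1) z \<in> V} = V" using sym2 sym2[of "- cnj _"] by (force simp: reflect_def V_def punctured_def)
  \<comment> \<open>The reflection yields the conjugate eigenvalue, which is the same one because
    eigenvalues are real.\<close>
  have "ABeig V \<mu> (conj_refl (-1) u)" using AB_refl[of "-1", OF _ V_open(1,2) u(2)] weak_eigen_real[OF u(2,1)] by (simp add: VV)
  then have "DNeig U C \<mu> (fold_up 1 u)" "DNeig U C \<mu> (fold_up 1 (conj_refl (-1) u))" using AB_imp_DN u(2) by blast+
  then show "\<mu> \<in> DNspec U C" unfolding DNspec_def using fold_up_nonzero[OF sym2, of u] u(1) by blast
qed

end

text \<open>The half-domain to the right of the ray through \<^term>\<open>b\<close>, with the Neumann condition on that ray.\<close>

lemma DN_right:
  assumes S: "open S" "bounded S" "0 \<in> S" and b: "cmod b = 1"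
    and sym: "\<And>z. reflect b z \<in> S \<Longrightarrow> reflect b (cnj z) \<in> S" "\<And>z. reflect b z \<in> S \<Longrightarrow> reflect b (- cnj z) \<in> S"
  defines "U \<equiv> {z \<in> S. 0 < Im (reflect b z)}" and "N \<equiv> {z \<in> S. Im (reflect b z) = 0 \<and> 0 < Re (reflect b z)}"
  shows "open U" "closed (frontier U - N)" "DNspec U (frontier U - N) = ABspec (punctured S)"
proof -
  \<comment> \<open>\<open>reflect b\<close> sends 1 to \<open>b\<close>, so in \<open>W\<close> the
    ray through \<open>b\<close> becomes the positive real axis and \<open>U\<close> the upper
    half.\<close>
  define W where "W = {z. reflect b z \<in> S}"
  have z0: "reflect b z = 0 \<longleftrightarrow> z = 0" for z using norm_reflect[OF b, of z] by (metis norm_eq_zero)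
  have WU: "{z. reflect b z \<in> U} = {z \<in> punctured W. 0 < Im z}" and WN: "{z. reflect b z \<in> N} = {z \<in> W. Im z = 0 \<and> 0 < Re z}"
    and Wp: "{z. reflect b z \<in> punctured S} = punctured W"
    using b by (auto simp: U_def N_def W_def punctured_def z0)
  interpret sym_domain W "punctured W" "{z \<in> punctured W. 0 < Im z}" "{z \<in> W. Im z = 0 \<and> 0 < Re z}"
    "frontier {z \<in> punctured W. 0 < Im z} - {z \<in> W. Im z = 0 \<and> 0 < Re z}"
  proof unfold_locales
    show "open W" unfolding W_def by (rule open_reflect_vimage[OF S(1)])
    obtain r where "S \<subseteq> ball 0 r" using bounded_subset_ballD[OF S(2)] by blast
    then have "W \<subseteq> ball 0 r" using b by (auto simp: W_def)
    then show "bounded W" using bounded_ball bounded_subset by blast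
    show "0 \<in> W" using S(3) by (simp add: W_def reflect_def)
    show "cnj z \<in> W" if "z \<in> W" for z using that sym(1) by (simp add: W_def)
  qed simp_all
  have C: "{z. reflect b z \<in> frontier U - N} = frontier {z \<in> punctured W. 0 < Im z} - {z \<in> W. Im z = 0 \<and> 0 < Re z}"
    unfolding WU[symmetric] WN[symmetric] frontier_reflect_vimage[OF b] by auto
  have inv: "{z. reflect b z \<in> {z. reflect b z \<in> X}} = X" for X using b by simp
  show U: "open U" using open_reflect_vimage[OF U_open, of b] unfolding WU[symmetric] inv .
  show cl: "closed (frontier U - N)" using closed_reflect_vimage[OF C_closed, of b] unfolding C[symmetric] inv .
  have "DNspec U (frontier U - N) = DNspec {z. reflect b z \<in> U} {z. reflect b z \<in> frontier U - N}"
    by (rule DNspec_refl[OF b U cl, symmetric])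
  also have "\<dots> = ABspec (punctured W)"
    unfolding C WU by (rule DNspec_eq_ABspec) (use sym(2) in \<open>simp add: W_def\<close>)
  also have "\<dots> = ABspec (punctured S)"
    unfolding Wp[symmetric] by (rule ABspec_refl[OF b]) (use S in \<open>auto simp: punctured_def\<close>)
  finally show "DNspec U (frontier U - N) = ABspec (punctured S)" .
qed

section \<open>The symmetries of the square: diagonal half-domains and restricted operators\<close>

context
  fixes S :: "complex set"
  assumes S: "open S" "bounded S" "0 \<in> S" and c: "\<And>z. z \<in> S \<Longrightarrow> cnj z \<in> S" and i: "\<And>z. z \<in> S \<Longrightarrow> \<i> * z \<in> S"
begin

lemma square_rotations: "z \<in> S \<Longrightarrow> - z \<in> S" "z \<in> S \<Longrightarrow> - \<i> * z \<in> S" "z \<in> S \<Longrightarrow> - cnj z \<in> S"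
proof -
  show 1: "- z \<in> S" if "z \<in> S" for z using i[OF i[OF that]] by (simp add: mult.assoc[symmetric])
  show "- \<i> * z \<in> S" if "z \<in> S" using 1[OF i[OF that]] by simp
  show "- cnj z \<in> S" if "z \<in> S" using 1[OF c[OF that]] .
qed

lemma diagonal_symmetry:
  assumes p: "p = 1 \<or> p = -1" and q: "q = 1 \<or> q = -1" and b: "b = Complex (p / sqrt 2) (q / sqrt 2)"
  shows "cmod b = 1" "reflect b z \<in> S \<Longrightarrow> reflect b (cnj z) \<in> S" "reflect b z \<in> S \<Longrightarrow> reflect b (- cnj z) \<in> S"
proof -
  show "cmod b = 1" using p q unfolding b by (auto simp: cmod_def power_divide)
  \<comment> \<open>\<open>b\<close> lies on a diagonal, so \<open>b^2\<close> is \<open>i\<close>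
    or \<open>-i\<close>, and multiplications by \<open>b\<close> and by \<open>cnj b\<close> differ
    by a quarter turn. This matters because \<open>reflect b (cnj z) = b * z\<close>.\<close>
  have bb: "b = (\<i> * of_real (p * q)) * cnj b"
    using p q unfolding b by (auto simp: complex_eq_iff)
  have 2: "b * z \<in> S" if z: "reflect b z \<in> S"
  proof -
    have "cnj b * z \<in> S" using c[OF z] by (simp add: reflect_def)
    then have "\<i> * (cnj b * z) \<in> S" "- \<i> * (cnj b * z) \<in> S" using i square_rotations(2) by blast+
    moreover have e: "b * z = of_real (p * q) * (\<i> * (cnj b * z))" by (subst bb) (simp add: mult_ac)
    have "b * z = \<i> * (cnj b * z) \<or> b * z = - \<i> * (cnj b * z)"
    proof (cases "p * q = 1")
      case True
      then show ?thesis using e by (simp only: of_real_1 mult_1 simp_thms)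
    next
      case False
      then have "p * q = -1" using p q by auto
      then show ?thesis using e by (simp only: of_real_1 of_real_minus mult_minus_left mult_1 simp_thms)
    qed
    ultimately show ?thesis by metis
  qed
  show "reflect b z \<in> S \<Longrightarrow> reflect b (cnj z) \<in> S" using 2 by (simp add: reflect_def)
  show "reflect b z \<in> S \<Longrightarrow> reflect b (- cnj z) \<in> S" using square_rotations(1)[OF 2] by (simp add: reflect_def)
qed

text \<open>The signs select one of the four diagonal rays, through \<open>p + i * q\<close>. Up to
  the factor \<open>sqrt 2\<close> the linear forms are the imaginary and the real part of
  \<open>reflect b z\<close>.\<close>

lemma DN_diagonal_right:
  assumes p: "p = 1 \<or> p = -1" and q: "q = 1 \<or> q = -1"
  defines "U \<equiv> {z \<in> S. 0 < q * Re z - p * Im z}" and "N \<equiv> {z \<in> S. q * Re z = p * Im z \<and> 0 < p * Re z + q * Im z}"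
  shows "open U" "closed (frontier U - N)" "DNspec U (frontier U - N) = ABspec (punctured S)"
proof -
  define b where "b = Complex (p / sqrt 2) (q / sqrt 2)"
  have "Im (reflect b z) = (q * Re z - p * Im z) / sqrt 2" "Re (reflect b z) = (p * Re z + q * Im z) / sqrt 2" for z
    by (simp_all add: reflect_def b_def diff_divide_distrib add_divide_distrib)
  then have e: "{z \<in> S. 0 < Im (reflect b z)} = U" "{z \<in> S. Im (reflect b z) = 0 \<and> 0 < Re (reflect b z)} = N"
    by (auto simp: U_def N_def zero_less_divide_iff)
  note d = diagonal_symmetry[OF p q b_def]
  from DN_right[OF S d] show "open U" "closed (frontier U - N)" "DNspec U (frontier U - N) = ABspec (punctured S)"
    unfolding e by blast+
qed

lemma DN_right_eigenvalues:
  assumes p: "p = 1 \<or> p = -1" and q: "q = 1 \<or> q = -1"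
    and U: "U = {z \<in> S. 0 < q * Re z - p * Im z}" and N: "N = {z \<in> S. q * Re z = p * Im z \<and> 0 < p * Re z + q * Im z}"
  shows "DN_eigenvalues U N = AB_eigenvalues S"
  using DN_diagonal_right[OF p q] DN_eigenvalues_eq[of U N] AB_eigenvalues_eq[OF S(1,2)] unfolding U N by simp

text \<open>A half-domain lies to the right of one end of its boundary line and to the left of the
  other, so this covers the other choice of the Neumann ray. Reflection in the real axis exchanges
  the two sides.\<close>

lemma DN_left_eigenvalues:
  assumes p: "p = 1 \<or> p = -1" and q: "q = 1 \<or> q = -1"
    and U: "U = {z \<in> S. 0 < q * Re z + p * Im z}" and N: "N = {z \<in> S. q * Re z + p * Im z = 0 \<and> 0 < p * Re z - q * Im z}"
  shows "DN_eigenvalues U N = AB_eigenvalues S"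
proof -
  let ?U = "{z \<in> S. 0 < q * Re z - p * Im z}" and ?N = "{z \<in> S. q * Re z = p * Im z \<and> 0 < p * Re z + q * Im z}"
  note R = DN_diagonal_right[OF p q]
  have SS: "cnj z \<in> S \<longleftrightarrow> z \<in> S" for z using c[of z] c[of "cnj z"] by auto
  have U': "{z. reflect 1 z \<in> ?U} = U" and N': "{z. reflect 1 z \<in> ?N} = N" by (auto simp: U N reflect_1 SS)
  have C': "{z. reflect 1 z \<in> frontier ?U - ?N} = frontier U - N"
    unfolding U'[symmetric] N'[symmetric] using frontier_reflect_vimage[of 1 ?U] by auto
  have "DNspec U (frontier U - N) = ABspec (punctured S)"
    using DNspec_refl[of 1, OF _ R(1,2)] R(3) unfolding U' C' by simp
  moreover have "open U" using open_reflect_vimage[OF R(1), of 1] unfolding U' .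
  moreover have "closed (frontier U - N)" using closed_reflect_vimage[OF R(2), of 1] unfolding C' .
  ultimately show ?thesis using DN_eigenvalues_eq[of U N] AB_eigenvalues_eq[OF S(1,2)] by simp
qed

lemma DN_half_domains:
  "N \<in> antidiagonal_halves S \<Longrightarrow> DN_eigenvalues (dh_mm S) N = AB_eigenvalues S"
  "N \<in> antidiagonal_halves S \<Longrightarrow> DN_eigenvalues (dh_pp S) N = AB_eigenvalues S"
  "N \<in> diagonal_halves S \<Longrightarrow> DN_eigenvalues (dh_pm S) N = AB_eigenvalues S"
  "N \<in> diagonal_halves S \<Longrightarrow> DN_eigenvalues (dh_mp S) N = AB_eigenvalues S"
proof -
  show "DN_eigenvalues (dh_mm S) N = AB_eigenvalues S" if "N \<in> antidiagonal_halves S"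
  proof -
    from that consider "N = {z \<in> S. Re z + Im z = 0 \<and> Re z > 0}" | "N = {z \<in> S. Re z + Im z = 0 \<and> Re z < 0}"
      by (auto simp: antidiagonal_halves_def)
    then show ?thesis
    proof cases
      case 1
      show ?thesis by (rule DN_right_eigenvalues[of 1 "-1"]) (auto simp: 1 dh_mm_def)
    next
      case 2
      show ?thesis by (rule DN_left_eigenvalues[of "-1" "-1"]) (auto simp: 2 dh_mm_def)
    qed
  qed
  show "DN_eigenvalues (dh_pp S) N = AB_eigenvalues S" if "N \<in> antidiagonal_halves S"
  proof -
    from that consider "N = {z \<in> S. Re z + Im z = 0 \<and> Re z > 0}" | "N = {z \<in> S. Re z + Im z = 0 \<and> Re z < 0}"
      by (auto simp: antidiagonal_halves_def)
    then show ?thesis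
    proof cases
      case 1
      show ?thesis by (rule DN_left_eigenvalues[of 1 1]) (auto simp: 1 dh_pp_def)
    next
      case 2
      show ?thesis by (rule DN_right_eigenvalues[of "-1" 1]) (auto simp: 2 dh_pp_def)
    qed
  qed
  show "DN_eigenvalues (dh_pm S) N = AB_eigenvalues S" if "N \<in> diagonal_halves S"
  proof -
    from that consider "N = {z \<in> S. Re z - Im z = 0 \<and> Re z > 0}" | "N = {z \<in> S. Re z - Im z = 0 \<and> Re z < 0}"
      by (auto simp: diagonal_halves_def)
    then show ?thesis
    proof cases
      case 1
      show ?thesis by (rule DN_right_eigenvalues[of 1 1]) (auto simp: 1 dh_pm_def)
    next
      case 2
      show ?thesis by (rule DN_left_eigenvalues[of "-1" 1]) (auto simp: 2 dh_pm_def)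
    qed
  qed
  show "DN_eigenvalues (dh_mp S) N = AB_eigenvalues S" if "N \<in> diagonal_halves S"
  proof -
    from that consider "N = {z \<in> S. Re z - Im z = 0 \<and> Re z > 0}" | "N = {z \<in> S. Re z - Im z = 0 \<and> Re z < 0}"
      by (auto simp: diagonal_halves_def)
    then show ?thesis
    proof cases
      case 1
      show ?thesis by (rule DN_left_eigenvalues[of 1 "-1"]) (auto simp: 1 dh_mp_def)
    next
      case 2
      show ?thesis by (rule DN_right_eigenvalues[of "-1" "-1"]) (auto simp: 2 dh_mp_def)
    qed
  qed
qed

text \<open>A nonzero eigenfunction is moved into the real subspace \<open>L\<^sup>2\<^sub>K\<close>, where \<open>R\<close> is an involution; as \<open>R'\<close>
  anticommutes with \<open>R\<close>, it interchanges the two eigenspaces of \<open>R\<close>.\<close>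

lemma restricted_eigenfunction:
  fixes s :: real
  assumes s: "s = 1 \<or> s = -1" and RR': "R = Sig1c \<and> R' = Sig2c \<or> R = Sig2c \<and> R' = Sig1c"
    and u: "\<not> (AE z in leb (punctured S). u z = 0)" "ABeig (punctured S) \<mu> u"
  obtains v where "\<not> (AE z in leb (punctured S). v z = 0)" "ABeig (punctured S) \<mu> v"
    "\<And>z. z \<noteq> 0 \<Longrightarrow> Kop v z = v z" "\<And>z. R v z = of_real s * v z"
proof -
  let ?V = "punctured S"
  have V: "open ?V" "0 \<notin> ?V" "?V \<in> sets borel" using S(1) by (auto simp: punctured_def)
  have \<mu>: "cnj \<mu> = \<mu>" by (rule weak_eigen_real[OF u(2,1)])
  have S1: "Sig1c f = (\<lambda>z. \<i> * conj_refl (-1) f z)" for f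
  proof -
    have "Complex (- Re z) (Im z) = reflect (-1) z" for z by (simp add: reflect_def complex_eq_iff)
    then show ?thesis by (simp add: Sig1c_def Gam_def Sig1_def conj_refl_def)
  qed
  have S2: "Sig2c f = conj_refl 1 f" for f
  proof -
    have "Complex (Re z) (- Im z) = reflect 1 z" for z by (simp add: reflect_def complex_eq_iff)
    then show ?thesis by (simp add: Sig2c_def Gam_def Sig2_def conj_refl_def)
  qed
  have VV: "{z. reflect a z \<in> ?V} = ?V" if "a = 1 \<or> a = -1" for a
  proof -
    have fwd: "reflect a z \<in> ?V" if z: "z \<in> ?V" for z
      using z c[of z] square_rotations(3)[of z] \<open>a = 1 \<or> a = -1\<close> by (auto simp: reflect_def punctured_def)
    have "cmod a = 1" using that by auto
    then show ?thesis using fwd by (metis (no_types, lifting) Collect_cong Collect_mem_eq reflect_rf)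
  qed
  have rCe: "ABeig ?V \<mu> (conj_refl a f)" if "a = 1 \<or> a = -1" "ABeig ?V \<mu> f" for a f
    using AB_refl[OF _ V(1,2) that(2), of a] that(1) VV[OF that(1)] \<mu> by auto
  have Re: "ABeig ?V \<mu> (Q f)" if "Q = R \<or> Q = R'" "ABeig ?V \<mu> f" for Q f
    using that RR' AB_cmult[OF V(1,2) rCe[of "-1", OF _ that(2)], of \<i>] rCe[of 1, OF _ that(2)] by (auto simp: S1 S2)
  have Rnz: "AE z in leb ?V. f z = 0" if QR: "Q = R \<or> Q = R'" "AE z in leb ?V. Q f z = 0" for Q f
  proof -
    obtain a where a: "a = 1 \<or> a = -1" "AE z in leb ?V. conj_refl a f z = 0"
      using QR RR' by (force simp: S1 S2)
    have "cmod a = 1" using a(1) by auto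
    from conj_refl_nonzero[OF this V(3), of f, unfolded VV[OF a(1)], OF a(2)] show ?thesis .
  qed
  have s1: "Sig1c f z = \<i> * cnj (f (- cnj z))" and s2: "Sig2c f z = cnj (f (cnj z))" for f z
    by (simp_all add: S1 S2 conj_refl_def reflect_def)
  have RR: "R (R f) = f" for f
  proof
    fix z show "R (R f) z = f z" by (rule disjE[OF RR']) (simp_all only: s1 s2, simp_all)
  qed
  \<comment> \<open>The factor \<open>i\<close> in \<open>Sig1c\<close> is conjugated when the
    antilinear \<open>Sig2c\<close> passes it; this is the sign.\<close>
  have anti: "R (R' f) = (\<lambda>z. - R' (R f) z)" for f
  proof
    fix z show "R (R' f) z = - R' (R f) z" by (rule disjE[OF RR']) (simp_all only: s1 s2, simp_all)
  qed
  have Radd: "R (\<lambda>z. f z + of_real t * g z) = (\<lambda>z. R f z + of_real t * R g z)" for f g and t :: real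
  proof
    fix z show "R (\<lambda>z. f z + of_real t * g z) z = R f z + of_real t * R g z"
      by (rule disjE[OF RR']) (simp_all only: s1 s2, simp_all add: algebra_simps)
  qed
  have Rscale: "R' (\<lambda>z. of_real t * g z) = (\<lambda>z. of_real t * R' g z)" for g and t :: real
  proof
    fix z show "R' (\<lambda>z. of_real t * g z) z = of_real t * R' g z"
      by (rule disjE[OF RR']) (simp_all only: s1 s2, simp_all add: algebra_simps)
  qed
  have ph: "phase (cnj z) = cnj (phase z)" "phase (- cnj z) = - cnj (phase z)" if "z \<noteq> 0" for z
    using that by (simp_all add: phase_eq)
  \<comment> \<open>Reflection in the imaginary axis changes \<open>phase\<close> by a sign besides
    conjugation, which the factor \<open>i\<close> of \<open>Sig1c\<close> compensates. The point 0
    is left out, as \<open>phase 0 = 1\<close> does not follow this rule.\<close>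
  have Kcom: "Kop (Q f) z = Q f z" if Q: "Q = R \<or> Q = R'" and f: "\<And>z. z \<noteq> 0 \<Longrightarrow> Kop f z = f z" and z: "z \<noteq> 0" for Q f z
  proof -
    have f1: "phase (cnj z) * cnj (f (cnj z)) = f (cnj z)" and f2: "phase (- cnj z) * cnj (f (- cnj z)) = f (- cnj z)"
      using f[of "cnj z"] f[of "- cnj z"] z by (simp_all add: Kop_eq)
    have g1: "cnj (f (cnj z)) = phase z * f (cnj z)" using arg_cong[OF f1, of cnj] z by (simp add: ph)
    have g2: "cnj (f (- cnj z)) = - (phase z * f (- cnj z))" using arg_cong[OF f2, of cnj] z by (simp add: ph)
    have "Kop (Sig2c f) z = phase z * f (cnj z)" by (simp add: Kop_eq s2)
    also have "\<dots> = Sig2c f z" by (simp only: s2 g1)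
    finally have k2: "Kop (Sig2c f) z = Sig2c f z" .
    have "Kop (Sig1c f) z = \<i> * - (phase z * f (- cnj z))" by (simp add: Kop_eq s1)
    also have "\<dots> = Sig1c f z" by (simp only: s1 g2)
    finally have k1: "Kop (Sig1c f) z = Sig1c f z" .
    show ?thesis using Q RR' k1 k2 by blast
  qed
  \<comment> \<open>As \<open>Kop\<close> is an antilinear involution, both \<open>u + Kop u\<close>
    and \<open>i * (u - Kop u)\<close> are fixed by it. If the first vanishes almost everywhere, the
    second equals \<open>2 * i * u\<close> there.\<close>
  obtain v where v: "\<not> (AE z in leb ?V. v z = 0)" "ABeig ?V \<mu> v" "\<And>z. Kop v z = v z"
  proof (cases "AE z in leb ?V. u z + Kop u z = 0")
    case False
    have e: "ABeig ?V \<mu> (\<lambda>z. u z + Kop u z)" using AB_add[OF V(1,2) u(2) AB_Kop[OF V(1,2) u(2), unfolded \<mu>]] .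
    have KK: "phase z * cnj (phase z * cnj x) = x" for x z
      using complex_norm_square[of "phase z"] by (simp add: mult.assoc[symmetric])
    have k: "Kop (\<lambda>z. u z + Kop u z) z = u z + Kop u z" for z
      unfolding Kop_eq complex_cnj_add distrib_left KK by (rule add.commute)
    show ?thesis by (rule that[OF False e k])
  next
    case True
    let ?w = "\<lambda>z. \<i> * (u z + (-1) * Kop u z)"
    have e: "ABeig ?V \<mu> ?w"
      by (intro AB_cmult[OF V(1,2)] AB_add[OF V(1,2)] u(2) AB_Kop[OF V(1,2) u(2), unfolded \<mu>])
    have k: "Kop ?w z = ?w z" for z
    proof -
      have 1: "phase z * cnj (phase z) = 1" using complex_norm_square[of "phase z"] by simp
      have "Kop ?w z = - \<i> * (phase z * cnj (u z)) + \<i> * (phase z * cnj (phase z)) * u z"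
        by (simp add: Kop_eq algebra_simps)
      also have "\<dots> = ?w z" unfolding 1 by (simp add: Kop_eq algebra_simps)
      finally show ?thesis .
    qed
    have nz: "\<not> (AE z in leb ?V. ?w z = 0)"
    proof
      assume "AE z in leb ?V. ?w z = 0"
      then have "AE z in leb ?V. u z = 0" using True by eventually_elim simp
      with u(1) show False by blast
    qed
    show ?thesis by (rule that[OF nz e k])
  qed
  have ss: "of_real s * (of_real s * x) = x" for x :: complex using s by auto
  \<comment> \<open>Twice the projections onto the eigenspaces of \<open>R\<close> for
    \<open>t = 1\<close> and \<open>t = -1\<close>. They add up to \<open>2 * v\<close>, so one of
    them is nonzero.\<close>
  define w where "w t z = v z + of_real t * R v z" for t z
  have wE: "ABeig ?V \<mu> (w t)" for t
  proof -
    have "w t = (\<lambda>z. v z + of_real t * R v z)" by (rule ext) (rule w_def)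
    moreover have "ABeig ?V \<mu> (R v)" by (rule Re[OF disjI1[OF refl] v(2)])
    ultimately show ?thesis using AB_add[OF V(1,2) v(2) AB_cmult[OF V(1,2)]] by simp
  qed
  have wR: "R (w t) z = of_real t * w t z" if "t = 1 \<or> t = -1" for t z
  proof -
    have "w t = (\<lambda>z. v z + of_real t * R v z)" by (rule ext) (rule w_def)
    then have "R (w t) z = R v z + of_real t * v z" by (simp only: Radd RR)
    then have "R (w t) z = of_real t * (v z + of_real t * R v z)"
      using that by (elim disjE) (simp_all add: add.commute)
    then show ?thesis by (simp only: w_def)
  qed
  have wK: "Kop (w t) z = w t z" if "z \<noteq> 0" for t z
  proof -
    have "Kop (R v) z = R v z" using Kcom[of R v z] v(3) that by blast
    then have 1: "phase z * cnj (v z) = v z" "phase z * cnj (R v z) = R v z"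
      using v(3)[of z] by (simp_all only: Kop_eq)
    have "Kop (w t) z = phase z * cnj (v z) + of_real t * (phase z * cnj (R v z))"
      unfolding Kop_eq w_def by (simp add: algebra_simps)
    then show ?thesis unfolding 1 w_def .
  qed
  show ?thesis
  proof (cases "AE z in leb ?V. w s z = 0")
    case False
    show ?thesis by (rule that[OF False wE wK wR[OF s]])
  next
    case True
    have "\<not> (AE z in leb ?V. w (- s) z = 0)"
    proof
      assume "AE z in leb ?V. w (- s) z = 0"
      then have "AE z in leb ?V. v z = 0" using True
      proof eventually_elim
        case (elim z)
        have "2 * v z = w (- s) z + w s z" unfolding w_def by simp
        then show ?case using elim by simp
      qed
      with v(1) show False by blast
    qed
    then have nz: "\<not> (AE z in leb ?V. R' (w (- s)) z = 0)" using Rnz[of R'] by blast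
    have "R (w (- s)) = (\<lambda>z. of_real (- s) * w (- s) z)" using wR[of "- s"] s by auto
    then have "R' (R (w (- s))) = (\<lambda>z. of_real (- s) * R' (w (- s)) z)" by (simp only: Rscale)
    then have Rw: "R (R' (w (- s))) z = of_real s * R' (w (- s)) z" for z unfolding anti by simp
    show ?thesis
    proof (rule that[OF nz _ _ Rw])
      show "ABeig ?V \<mu> (R' (w (- s)))" by (rule Re[OF disjI2[OF refl] wE])
      show "Kop (R' (w (- s))) z = R' (w (- s)) z" if "z \<noteq> 0" for z
        by (rule Kcom[OF disjI2[OF refl] _ that]) (rule wK)
    qed
  qed
qed

text \<open>The sign \<open>s\<close> treats the symmetric and the antisymmetric subspace at
  once.\<close>

lemma restricted_eigenvalues:
  fixes s :: real
  assumes s: "s = 1 \<or> s = -1" and RR': "R = Sig1c \<and> R' = Sig2c \<or> R = Sig2c \<and> R' = Sig1c"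
    and X: "X = {u \<in> L2_K S. AE z in leb (punctured S). R u z = of_real s * u z}"
  shows "complex_of_real ` AB_restricted_eigenvalues S X = AB_eigenvalues S"
proof (intro equalityI subsetI)
  fix \<mu> assume "\<mu> \<in> complex_of_real ` AB_restricted_eigenvalues S X"
  then show "\<mu> \<in> AB_eigenvalues S"
    by (auto simp: AB_restricted_eigenvalues_def real_eigenvalues_def restrict_oper_def AB_eigenvalues_def eigenvalues_def)
next
  fix \<mu> assume "\<mu> \<in> AB_eigenvalues S"
  then obtain u where u: "\<not> (AE z in leb (punctured S). u z = 0)" "ABeig (punctured S) \<mu> u"
    using AB_eigenvalues_eq[OF S(1,2)] by (auto simp: ABspec_def)
  obtain m where m: "\<mu> = of_real m" using weak_eigen_real[OF u(2,1)] by (metis Reals_cases Reals_cnj_iff)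
  obtain v where v: "\<not> (AE z in leb (punctured S). v z = 0)" "ABeig (punctured S) \<mu> v"
    "\<And>z. z \<noteq> 0 \<Longrightarrow> Kop v z = v z" "\<And>z. R v z = of_real s * v z"
    by (rule restricted_eigenfunction[OF s RR' u]) blast
  \<comment> \<open>The restricted operator requires both \<open>v\<close> and its image
    \<open>m * v\<close> to lie in \<open>X\<close>, hence all real multiples.\<close>
  have vX: "(\<lambda>z. of_real t * v z) \<in> X" for t :: real
  proof -
    have "AE z in leb (punctured S). Kop (\<lambda>z. of_real t * v z) z = of_real t * v z"
      using v(3) by (intro AE_I2) (auto simp: punctured_def Kop_eq mult.left_commute)
    moreover have "R (\<lambda>z. of_real t * v z) z = of_real s * (of_real t * v z)" for z
    proof -
      have "R (\<lambda>z. of_real t * v z) z = of_real t * R v z"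
        using RR' by (auto simp: Sig1c_def Sig2c_def Sig1_def Sig2_def Gam_def)
      then show ?thesis by (simp add: v(4))
    qed
    ultimately show ?thesis using L2_cmult[OF weak_eigen_L2[OF v(2)]] by (simp add: X L2_K_def)
  qed
  have "AB_operator S v (\<lambda>z. of_real m * v z)" using AB_operator_iff[OF S(1,2)] v(2) m by simp
  then have "m \<in> AB_restricted_eigenvalues S X"
    unfolding AB_restricted_eigenvalues_def real_eigenvalues_def restrict_oper_def
    using v(1) weak_eigen_L2[OF v(2)] vX[of 1] vX[of m] by auto
  then show "\<mu> \<in> complex_of_real ` AB_restricted_eigenvalues S X" using m by blast
qed

end

theorem proposition6p3:
  fixes \<Omega> :: "complex set"
  assumes "bounded \<Omega>" and "convex \<Omega>" and "open \<Omega>"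
    and "piecewise_smooth_boundary \<Omega>"
    and "0 \<in> \<Omega>"
    and "(\<lambda>z. Complex (- Re z) (Im z)) ` \<Omega> = \<Omega>"
    and "(\<lambda>z. Complex (Re z) (- Im z)) ` \<Omega> = \<Omega>"
    and "(\<lambda>z. \<i> * z) ` \<Omega> = \<Omega>"
  shows "(\<forall>N\<in>antidiagonal_halves \<Omega>.
            DN_eigenvalues (dh_mm \<Omega>) N = AB_eigenvalues \<Omega> \<and>
            DN_eigenvalues (dh_pp \<Omega>) N = AB_eigenvalues \<Omega>) \<and>
         (\<forall>N\<in>diagonal_halves \<Omega>.
            DN_eigenvalues (dh_pm \<Omega>) N = AB_eigenvalues \<Omega> \<and>
            DN_eigenvalues (dh_mp \<Omega>) N = AB_eigenvalues \<Omega>) \<and>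
         complex_of_real ` AB_restricted_eigenvalues \<Omega> (L2_K_sym \<Omega> Sig1c) = AB_eigenvalues \<Omega> \<and>
         complex_of_real ` AB_restricted_eigenvalues \<Omega> (L2_K_antisym \<Omega> Sig1c) = AB_eigenvalues \<Omega> \<and>
         complex_of_real ` AB_restricted_eigenvalues \<Omega> (L2_K_sym \<Omega> Sig2c) = AB_eigenvalues \<Omega> \<and>
         complex_of_real ` AB_restricted_eigenvalues \<Omega> (L2_K_antisym \<Omega> Sig2c) = AB_eigenvalues \<Omega>"
proof -
  have cnj: "cnj z \<in> \<Omega>" if "z \<in> \<Omega>" for z
  proof -
    have "Complex (Re z) (- Im z) \<in> \<Omega>" using assms(7) that by blast
    moreover have "Complex (Re z) (- Im z) = cnj z" by (simp add: complex_eq_iff)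
    ultimately show ?thesis by simp
  qed
  have rot: "\<i> * z \<in> \<Omega>" if "z \<in> \<Omega>" for z using assms(8) that by blast
  note DN = DN_half_domains[OF assms(3,1,5)]
  show ?thesis
  proof (intro conjI ballI)
    fix N assume N: "N \<in> antidiagonal_halves \<Omega>"
    show "DN_eigenvalues (dh_mm \<Omega>) N = AB_eigenvalues \<Omega>" by (rule DN(1)) (use N cnj rot in auto)
    show "DN_eigenvalues (dh_pp \<Omega>) N = AB_eigenvalues \<Omega>" by (rule DN(2)) (use N cnj rot in auto)
  next
    fix N assume N: "N \<in> diagonal_halves \<Omega>"
    show "DN_eigenvalues (dh_pm \<Omega>) N = AB_eigenvalues \<Omega>" by (rule DN(3)) (use N cnj rot in auto)
    show "DN_eigenvalues (dh_mp \<Omega>) N = AB_eigenvalues \<Omega>" by (rule DN(4)) (use N cnj rot in auto)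
  next
    show "complex_of_real ` AB_restricted_eigenvalues \<Omega> (L2_K_sym \<Omega> Sig1c) = AB_eigenvalues \<Omega>"
      by (rule restricted_eigenvalues[OF assms(3,1,5), where s = "1" and R = Sig1c and R' = Sig2c])
        (use cnj rot in \<open>auto simp: L2_K_sym_def\<close>)
    show "complex_of_real ` AB_restricted_eigenvalues \<Omega> (L2_K_antisym \<Omega> Sig1c) = AB_eigenvalues \<Omega>"
      by (rule restricted_eigenvalues[OF assms(3,1,5), where s = "-1" and R = Sig1c and R' = Sig2c])
        (use cnj rot in \<open>auto simp: L2_K_antisym_def\<close>)
    show "complex_of_real ` AB_restricted_eigenvalues \<Omega> (L2_K_sym \<Omega> Sig2c) = AB_eigenvalues \<Omega>"
      by (rule restricted_eigenvalues[OF assms(3,1,5), where s = "1" and R = Sig2c and R' = Sig1c])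
        (use cnj rot in \<open>auto simp: L2_K_sym_def\<close>)
    show "complex_of_real ` AB_restricted_eigenvalues \<Omega> (L2_K_antisym \<Omega> Sig2c) = AB_eigenvalues \<Omega>"
      by (rule restricted_eigenvalues[OF assms(3,1,5), where s = "-1" and R = Sig2c and R' = Sig1c])
        (use cnj rot in \<open>auto simp: L2_K_antisym_def\<close>)
  qed
qed

end
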